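(* Let $f\colon M\to N$ be a proper branched cover between $n$-manifolds, and let $y\in f(B_f)$. If the local dimension of $f(B_f)$ at $y$ is less than $n-2$, then the local monodromy $\mathcal{G}_f(y)$ of $f$ at $y$ is a finite perfect group.
   Context: Conventions. Manifolds are topological manifolds and are assumed path-connected. A continuous map $f\colon X\to Y$ is a (generalized) branched cover if it is discrete (every fibre $f^{-1}(y)$ is a discrete set) and open (it maps open sets to open sets). The branch set $B_f\subset X$ is the set of points at which $f$ is not a local homeomorphism. Proper means that preimages of compact sets are compact. A subset $A\subset X$ does not locally separate $X$ if $U\setminus A$ is connected for every connected open $U\subset X$. Dimension. $\dim$ is covering dimension. A closed set $E\subset N$ has local dimension at most $k$ at $y\in E$ if there is a neighborhood $U\subset N$ of $y$ with $\dim(U\cap E)\le k$. "Less than $n-2$" means at most $n-3$. Regular part and monodromy group. For $f$ proper, let $N'=N\setminus f(B_f)$ and $M'=M\setminus f^{-1}(f(B_f))$. Then $f'=f|_{M'}\colon M'\to N'$ is a covering map, called the regular part of $f$; the sets $f(B_f)$ and $f^{-1}(f(B_f))$ are closed and do not locally separate $N$ and $M$. For $y_0\in N'$, the monodromy $\mu_f\colon \pi_1(N',y_0)\to \mathrm{Sym}(f^{-1}(y_0))$ sends $[\gamma]$ to the permutation $x\mapsto \tilde\gamma_x(1)$, where $\tilde\gamma_x$ is the lift of $\gamma$ under $f'$ starting at $x$. The monodromy group of $f$ is $G_f=\pi_1(N',y_0)/\ker\mu_f$. Normalization and local monodromy. Let $\widetilde{N'}$ be the universal cover of $N'$ and $\bar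 f'\colon \widetilde{N'}/\ker\mu_f\to N'$ the induced normal covering, with deck group $G_f$. It is known that there is an (essentially unique) locally connected, locally compact Hausdorff space $X_f$ containing $\widetilde{N'}/\ker\mu_f$ as an open dense subset whose complement does not locally separate $X_f$, such that $\bar f'$ extends to a proper branched cover $\bar f\colon X_f\to N$ (the Fox completion). The action of $G_f$ extends to an action by homeomorphisms on $X_f$, and $\bar f$ is the orbit map of this action. The map $\bar f$ is called the normalization of $f$. For $y\in N$, the stabilizers in $G_f$ of the points of $\bar f^{-1}(y)$ are conjugate to each other; the local monodromy $\mathcal{G}_f(y)$ is the conjugacy class of these subgroups. A group-theoretic property is attributed to $\mathcal{G}_f(y)$ if these stabilizers have it. A group $\Gamma$ is perfect if $\Gamma=[\Gamma,\Gamma]$. *)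

theory Defs
  imports "HOL-Analysis.Analysis" "HOL-Algebra.Group_Action" "HOL-Algebra.Generated_Groups"
begin

section \<open>Manifolds and branched covers\<close>

definition manifold :: "nat \<Rightarrow> 'a topology \<Rightarrow> bool" where
  "manifold n X \<longleftrightarrow>
     Hausdorff_space X \<and> second_countable X \<and> path_connected_space X \<and>
     (\<forall>x \<in> topspace X. \<exists>U V. openin X U \<and> x \<in> U \<and> openin (Euclidean_space n) V \<and>
        subtopology X U homeomorphic_space subtopology (Euclidean_space n) V)"

definition fibre :: "'a topology \<Rightarrow> ('a \<Rightarrow> 'b) \<Rightarrow> 'b \<Rightarrow> 'a set" where
  "fibre X f y = {x \<in> topspace X. f x = y}"

definition branched_cover :: "'a topology \<Rightarrow> 'b topology \<Rightarrow> ('a \<Rightarrow> 'b) \<Rightarrow> bool" where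
  "branched_cover X Y f \<longleftrightarrow>
     continuous_map X Y f \<and> open_map X Y f \<and>
     (\<forall>y \<in> topspace Y. subtopology X (fibre X f y) = discrete_topology (fibre X f y))"

text \<open>The library's \<open>proper_map\<close> (closed with compact fibres) is a different, in general
  stronger, condition.\<close>

definition compact_preimages :: "'a topology \<Rightarrow> 'b topology \<Rightarrow> ('a \<Rightarrow> 'b) \<Rightarrow> bool" where
  "compact_preimages X Y f \<longleftrightarrow>
     (\<forall>K. compactin Y K \<longrightarrow> compactin X {x \<in> topspace X. f x \<in> K})"

definition branch_set :: "'a topology \<Rightarrow> 'b topology \<Rightarrow> ('a \<Rightarrow> 'b) \<Rightarrow> 'a set" where
  "branch_set X Y f = {x \<in> topspace X.
     \<not> (\<exists>U. openin X U \<and> x \<in> U \<and> openin Y (f ` U) \<and>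
           homeomorphic_map (subtopology X U) (subtopology Y (f ` U)) f)}"

definition locally_separates :: "'a topology \<Rightarrow> 'a set \<Rightarrow> bool" where
  "locally_separates X A \<longleftrightarrow> (\<exists>U. openin X U \<and> connectedin X U \<and> \<not> connectedin X (U - A))"


section \<open>Covering dimension\<close>

text \<open>As for the library's small inductive dimension \<open>dim_le\<close>, the bound is an integer and the
  empty space has dimension \<open>-1\<close>.\<close>

definition covering_dim_le :: "'a topology \<Rightarrow> int \<Rightarrow> bool" where
  "covering_dim_le X k \<longleftrightarrow> -1 \<le> k \<and>
     (\<forall>\<U>. finite \<U> \<and> (\<forall>U \<in> \<U>. openin X U) \<and> \<Union>\<U> = topspace X \<longrightarrow>
       (\<exists>\<V>. finite \<V> \<and> (\<forall>V \<in> \<V>. openin X V) \<and> \<Union>\<V> = topspace X \<and>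
          (\<forall>V \<in> \<V>. \<exists>U \<in> \<U>. V \<subseteq> U) \<and>
          (\<forall>x \<in> topspace X. int (card {V \<in> \<V>. x \<in> V}) \<le> k + 1)))"

definition local_dim_le :: "'a topology \<Rightarrow> 'a set \<Rightarrow> 'a \<Rightarrow> int \<Rightarrow> bool" where
  "local_dim_le X E y k \<longleftrightarrow>
     (\<exists>W U. openin X W \<and> y \<in> W \<and> W \<subseteq> U \<and> U \<subseteq> topspace X \<and>
        covering_dim_le (subtopology X (U \<inter> E)) k)"


section \<open>Fundamental group\<close>

definition path_homotopic :: "'a topology \<Rightarrow> (real \<Rightarrow> 'a) \<Rightarrow> (real \<Rightarrow> 'a) \<Rightarrow> bool" where
  "path_homotopic X p q \<longleftrightarrow>
     homotopic_with (\<lambda>r. r 0 = p 0 \<and> r 1 = p 1) (top_of_set {0..1}) X p q"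

definition path_class :: "'a topology \<Rightarrow> (real \<Rightarrow> 'a) \<Rightarrow> (real \<Rightarrow> 'a) set" where
  "path_class X p = {q. path_homotopic X p q}"

text \<open>The library's \<open>joinpaths\<close> is restricted to types of class \<open>topological_space\<close>.\<close>

definition path_join :: "(real \<Rightarrow> 'a) \<Rightarrow> (real \<Rightarrow> 'a) \<Rightarrow> real \<Rightarrow> 'a" where
  "path_join p q = (\<lambda>t. if t \<le> 1/2 then p (2 * t) else q (2 * t - 1))"

definition class_mult ::
    "'a topology \<Rightarrow> (real \<Rightarrow> 'a) set \<Rightarrow> (real \<Rightarrow> 'a) set \<Rightarrow> (real \<Rightarrow> 'a) set" where
  "class_mult X a b = {r. \<exists>p \<in> a. \<exists>q \<in> b. path_homotopic X (path_join p q) r}"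

definition fundamental_group :: "'a topology \<Rightarrow> 'a \<Rightarrow> (real \<Rightarrow> 'a) set monoid" where
  "fundamental_group X x0 =
     \<lparr>carrier = {path_class X p | p. pathin X p \<and> p 0 = x0 \<and> p 1 = x0},
      mult = class_mult X,
      one = path_class X (\<lambda>_. x0)\<rparr>"


section \<open>Regular part and monodromy group\<close>

definition regular_base :: "'a topology \<Rightarrow> 'b topology \<Rightarrow> ('a \<Rightarrow> 'b) \<Rightarrow> 'b topology" where
  "regular_base M N f = subtopology N (topspace N - f ` branch_set M N f)"

definition regular_total :: "'a topology \<Rightarrow> 'b topology \<Rightarrow> ('a \<Rightarrow> 'b) \<Rightarrow> 'a topology" where
  "regular_total M N f = subtopology M {x \<in> topspace M. f x \<notin> f ` branch_set M N f}"

definition monodromy ::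
    "'a topology \<Rightarrow> 'b topology \<Rightarrow> ('a \<Rightarrow> 'b) \<Rightarrow> 'b \<Rightarrow> (real \<Rightarrow> 'b) set \<Rightarrow> 'a \<Rightarrow> 'a" where
  "monodromy M N f y0 c = (\<lambda>x \<in> fibre M f y0.
     THE z. \<exists>\<gamma> \<in> c. \<exists>g. pathin (regular_total M N f) g \<and> g 0 = x \<and>
       (\<forall>t \<in> {0..1}. f (g t) = \<gamma> t) \<and> g 1 = z)"

text \<open>With paths multiplied from left to right, \<open>monodromy\<close> reverses products. This affects
  neither its kernel, which is the set of classes acting as the identity, nor the quotient.\<close>

definition monodromy_kernel ::
    "'a topology \<Rightarrow> 'b topology \<Rightarrow> ('a \<Rightarrow> 'b) \<Rightarrow> 'b \<Rightarrow> (real \<Rightarrow> 'b) set set" where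
  "monodromy_kernel M N f y0 =
     kernel (fundamental_group (regular_base M N f) y0) (BijGroup (fibre M f y0))
            (monodromy M N f y0)"

definition monodromy_group ::
    "'a topology \<Rightarrow> 'b topology \<Rightarrow> ('a \<Rightarrow> 'b) \<Rightarrow> 'b \<Rightarrow> (real \<Rightarrow> 'b) set set monoid" where
  "monodromy_group M N f y0 =
     fundamental_group (regular_base M N f) y0 Mod monodromy_kernel M N f y0"


section \<open>Universal cover and the normal covering of the regular part\<close>

text \<open>The universal cover as the space of homotopy classes of paths starting at the base point.
  The sheet of \<open>U\<close> at \<open>c\<close> consists of the classes obtained from \<open>c\<close> by appending a path in \<open>U\<close>.\<close>

definition sheet ::
    "'a topology \<Rightarrow> (real \<Rightarrow> 'a) set \<Rightarrow> 'a set \<Rightarrow> (real \<Rightarrow> 'a) set set" where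
  "sheet X c U = {path_class X (path_join p q) | p q.
     p \<in> c \<and> pathin X q \<and> q ` {0..1} \<subseteq> U \<and> q 0 = p 1}"

definition universal_cover :: "'a topology \<Rightarrow> 'a \<Rightarrow> (real \<Rightarrow> 'a) set topology" where
  "universal_cover X x0 = topology_generated_by
     {sheet X (path_class X p) U | p U. pathin X p \<and> p 0 = x0 \<and> openin X U}"

definition quotient_topology :: "'a topology \<Rightarrow> ('a \<Rightarrow> 'b) \<Rightarrow> 'b topology" where
  "quotient_topology X q =
     topology (\<lambda>W. W \<subseteq> q ` topspace X \<and> openin X {x \<in> topspace X. q x \<in> W})"

lemma openin_quotient_topology:
  "openin (quotient_topology X q) W \<longleftrightarrow>
     W \<subseteq> q ` topspace X \<and> openin X {x \<in> topspace X. q x \<in> W}"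
proof -
  have "istopology (\<lambda>W. W \<subseteq> q ` topspace X \<and> openin X {x \<in> topspace X. q x \<in> W})"
    unfolding istopology_def
  proof (intro conjI allI impI)
    fix S T
    assume S: "S \<subseteq> q ` topspace X \<and> openin X {x \<in> topspace X. q x \<in> S}"
      and T: "T \<subseteq> q ` topspace X \<and> openin X {x \<in> topspace X. q x \<in> T}"
    have "{x \<in> topspace X. q x \<in> S \<inter> T} =
        {x \<in> topspace X. q x \<in> S} \<inter> {x \<in> topspace X. q x \<in> T}"
      by blast
    then show "openin X {x \<in> topspace X. q x \<in> S \<inter> T}"
      using S T by (simp add: openin_Int)
    show "S \<inter> T \<subseteq> q ` topspace X"
      using S by blast
  next
    fix \<K>
    assume K: "\<forall>S\<in>\<K>. S \<subseteq> q ` topspace X \<and> openin X {x \<in> topspace X. q x \<in> S}"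
    have "{x \<in> topspace X. q x \<in> \<Union>\<K>} = (\<Union>S\<in>\<K>. {x \<in> topspace X. q x \<in> S})"
      by blast
    moreover have "openin X (\<Union>S\<in>\<K>. {x \<in> topspace X. q x \<in> S})"
      using K by (intro openin_Union) blast
    ultimately show "openin X {x \<in> topspace X. q x \<in> \<Union>\<K>}"
      by (rule ssubst)
    show "\<Union>\<K> \<subseteq> q ` topspace X"
      using K by blast
  qed
  then show ?thesis
    by (simp add: quotient_topology_def topology_inverse')
qed

text \<open>The fundamental group acts on the universal cover from the left by \<open>class_mult\<close>; the normal
  covering is the space of orbits of the monodromy kernel.\<close>

definition normal_cover ::
    "'a topology \<Rightarrow> 'b topology \<Rightarrow> ('a \<Rightarrow> 'b) \<Rightarrow> 'b \<Rightarrow> (real \<Rightarrow> 'b) set set topology" where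
  "normal_cover M N f y0 =
     quotient_topology (universal_cover (regular_base M N f) y0)
       (orbit ((fundamental_group (regular_base M N f) y0)\<lparr>carrier := monodromy_kernel M N f y0\<rparr>)
          (class_mult (regular_base M N f)))"

text \<open>The common end point of all paths representing an orbit.\<close>

definition normal_cover_proj :: "(real \<Rightarrow> 'b) set set \<Rightarrow> 'b" where
  "normal_cover_proj C = (THE z. \<exists>c \<in> C. \<exists>p \<in> c. p 1 = z)"

text \<open>With \<open>K\<close> the monodromy kernel, the coset \<open>K g\<close> sends the orbit \<open>K c\<close> to the orbit
  \<open>K (g c)\<close>, which, as \<open>K\<close> is normal, is the set of all products of elements of \<open>K g\<close> and \<open>K c\<close>.\<close>

definition deck_action ::
    "'a topology \<Rightarrow> 'b topology \<Rightarrow> ('a \<Rightarrow> 'b) \<Rightarrow>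
     (real \<Rightarrow> 'b) set set \<Rightarrow> (real \<Rightarrow> 'b) set set \<Rightarrow> (real \<Rightarrow> 'b) set set" where
  "deck_action M N f A C = {class_mult (regular_base M N f) a c | a c. a \<in> A \<and> c \<in> C}"


section \<open>Normalization and local monodromy\<close>

text \<open>\<open>fbar\<close>, defined on \<open>X\<close>, is a normalization of \<open>f\<close>; the inclusion of the normal covering
  into \<open>X\<close> is given by an open embedding \<open>\<iota>\<close>.\<close>

definition normalization ::
    "'a topology \<Rightarrow> 'b topology \<Rightarrow> ('a \<Rightarrow> 'b) \<Rightarrow> 'b \<Rightarrow>
     'x topology \<Rightarrow> ((real \<Rightarrow> 'b) set set \<Rightarrow> 'x) \<Rightarrow> ('x \<Rightarrow> 'b) \<Rightarrow> bool" where
  "normalization M N f y0 X \<iota> fbar \<longleftrightarrow>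
     locally_connected_space X \<and> locally_compact_space X \<and> Hausdorff_space X \<and>
     embedding_map (normal_cover M N f y0) X \<iota> \<and>
     openin X (\<iota> ` topspace (normal_cover M N f y0)) \<and>
     X closure_of (\<iota> ` topspace (normal_cover M N f y0)) = topspace X \<and>
     \<not> locally_separates X (topspace X - \<iota> ` topspace (normal_cover M N f y0)) \<and>
     branched_cover X N fbar \<and> compact_preimages X N fbar \<and>
     (\<forall>C \<in> topspace (normal_cover M N f y0). fbar (\<iota> C) = normal_cover_proj C)"

text \<open>\<open>\<psi>\<close> is the extension to \<open>X\<close> of the deck action of the monodromy group. It is determined
  by density of the image of \<open>\<iota>\<close>.\<close>

definition extended_deck_action ::
    "'a topology \<Rightarrow> 'b topology \<Rightarrow> ('a \<Rightarrow> 'b) \<Rightarrow> 'b \<Rightarrow>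
     'x topology \<Rightarrow> ((real \<Rightarrow> 'b) set set \<Rightarrow> 'x) \<Rightarrow>
     ((real \<Rightarrow> 'b) set set \<Rightarrow> 'x \<Rightarrow> 'x) \<Rightarrow> bool" where
  "extended_deck_action M N f y0 X \<iota> \<psi> \<longleftrightarrow>
     group_action (monodromy_group M N f y0) (topspace X) \<psi> \<and>
     (\<forall>A \<in> carrier (monodromy_group M N f y0).
        homeomorphic_map X X (\<psi> A) \<and>
        (\<forall>C \<in> topspace (normal_cover M N f y0). \<psi> A (\<iota> C) = \<iota> (deck_action M N f A C)))"

text \<open>The conjugacy class formed by the stabilizers of the points above \<open>y\<close>.\<close>

definition local_monodromy ::
    "'a topology \<Rightarrow> 'b topology \<Rightarrow> ('a \<Rightarrow> 'b) \<Rightarrow> 'b \<Rightarrow>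
     'x topology \<Rightarrow> ('x \<Rightarrow> 'b) \<Rightarrow> ((real \<Rightarrow> 'b) set set \<Rightarrow> 'x \<Rightarrow> 'x) \<Rightarrow>
     'b \<Rightarrow> (real \<Rightarrow> 'b) set set set set" where
  "local_monodromy M N f y0 X fbar \<psi> y =
     stabilizer (monodromy_group M N f y0) \<psi> ` fibre X fbar y"

definition perfect_group :: "('g, 'r) monoid_scheme \<Rightarrow> bool" where
  "perfect_group G \<longleftrightarrow> group G \<and> derived G (carrier G) = carrier G"

end

theory Submission
  imports Defs "HOL-Homology.Homology"
begin

text \<open>
  Let \<open>E\<close> be the image of the branch set, \<open>H\<close> the stabilizer of a point \<open>x\<close> above \<open>y\<close>, and \<open>W\<close> a
  small coordinate cube around \<open>y\<close>. The regular part of the component of \<open>x\<close> in the preimage of \<open>W\<close>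
  is a connected normal covering of \<open>W - E\<close> with deck group \<open>H\<close>. Transport along paths in \<open>W - E\<close>
  with values in \<open>H / [H, H]\<close> is a singular 1-cocycle; since \<open>H\<^sub>1 (W - E) = 0\<close>, it vanishes on
  loops, and every element of \<open>H\<close> is the transport of a loop, so \<open>H = [H, H]\<close>.

  That \<open>H\<^sub>q (W - E) = 0\<close> for \<open>1 \<le> q \<le> n - 2 - dim E\<close> is shown by induction on \<open>dim E\<close>, as in the
  classical proof of the Jordan--Brouwer separation theorem. Write \<open>E\<close> as a union of two closed
  sets whose intersection has smaller dimension; by Mayer--Vietoris, a cycle which bounds in the
  complement of both pieces bounds in the complement of \<open>E\<close>. Repeating this, one is left with
  small pieces of \<open>E\<close>, which are avoided because the cycle bounds in the complement of each point.

  The lifting theory of the covering \<open>f'\<close> is avoided: that the monodromy kernel is a normal subgroup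
  follows from \<open>G\<^sub>f\<close> being a group, which is finite because the fibres of the normalization are
  compact and discrete.
\<close>

section \<open>Singular cycles that bound\<close>

text \<open>Passing from a closed set to the intersection of its two pieces lowers the bound
  \<open>m\<close> of \<open>fine_covers\<close> by one and raises the degree q in Mayer--Vietoris
  by one, so \<open>q + m < n\<close> is kept throughout. It makes the complement of a point acyclic
  in degree q, and at m = 0 nothing is left to remove. Dimension at most n - 3 means m = n - 2,
  which leaves room for exactly the degree 1 that the abelianization of \<open>H\<close> requires.

  The obstacle is that the dimension is defined by covers while the induction needs closed pieces
  with thin intersection. These are obtained as limits, from covers of ever smaller mesh.

  The cocycle stands in for the Hurewicz theorem. A regular point of the component of x is chosen
  above each point of \<open>W - E\<close>, and a path is closed up to a loop at \<open>y0\<close>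
  through the chosen points above its ends. Another choice changes the transport of a loop only by
  conjugation in \<open>H\<close>, and \<open>[H, H]\<close> is stable under that.\<close>

definition acyclic_in :: "nat \<Rightarrow> 'a topology \<Rightarrow> bool" where
  "acyclic_in p X \<longleftrightarrow> (\<forall>c. singular_relcycle p X {} c \<longrightarrow> singular_relboundary p X {} c)"

text \<open>Known computations provide homology groups, while the arguments below follow one cycle
  through the complements of varying sets.\<close>

lemma acyclic_in_iff_trivial_group:
  "acyclic_in p X \<longleftrightarrow> trivial_group (homology_group (int p) X)"
proof
  assume *: "acyclic_in p X"
  have "carrier (homology_group (int p) X) = {singular_relboundary_set p X {}}"
  proof
    show "carrier (homology_group (int p) X) \<subseteq> {singular_relboundary_set p X {}}"
      unfolding carrier_relative_homology_group image_subset_iff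
      using * by (simp add: acyclic_in_def homologous_rel_set_eq_relboundary)
    have "homologous_rel_set p X {} 0 = singular_relboundary_set p X {}"
      by (simp add: homologous_rel_set_eq_relboundary)
    then show "{singular_relboundary_set p X {}} \<subseteq> carrier (homology_group (int p) X)"
      unfolding carrier_relative_homology_group
      by (intro subsetI image_eqI[where x = 0]) auto
  qed
  then show "trivial_group (homology_group (int p) X)"
    by (simp add: trivial_group_def)
next
  assume *: "trivial_group (homology_group (int p) X)"
  show "acyclic_in p X"
    unfolding acyclic_in_def
  proof (intro allI impI)
    fix c assume "singular_relcycle p X {} c"
    then have "homologous_rel_set p X {} c \<in> carrier (homology_group (int p) X)"
      unfolding carrier_relative_homology_group by (intro imageI) simp
    with * have "homologous_rel_set p X {} c = singular_relboundary_set p X {}"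
      by (simp add: trivial_group_def)
    then show "singular_relboundary p X {} c"
      by (simp add: homologous_rel_set_eq_relboundary)
  qed
qed

lemma acyclic_in_contractible:
  assumes "contractible_space X" and "p \<noteq> 0"
  shows "acyclic_in p X"
  using trivial_reduced_homology_group_contractible_space[OF assms(1), of "int p"]
    un_reduced_homology_group[of "int p" X] assms(2)
  by (simp add: acyclic_in_iff_trivial_group)

text \<open>A chain has finitely many simplexes, each with compact image. This is what turns
  avoiding a point into avoiding a ball around it.\<close>

lemma singular_chain_image_compactin:
  assumes "singular_chain p X c"
  shows "compactin X (\<Union>f \<in> Poly_Mapping.keys c. f ` standard_simplex p)"
proof -
  have "compactin X (f ` standard_simplex p)" if "f \<in> Poly_Mapping.keys c" for f
  proof -
    have "continuous_map (subtopology (powertop_real UNIV) (standard_simplex p)) X f"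
      using assms that by (auto simp: singular_chain_def singular_simplex_def)
    moreover have "compactin (subtopology (powertop_real UNIV) (standard_simplex p)) (standard_simplex p)"
      by (simp add: compactin_subtopology compactin_standard_simplex)
    ultimately show ?thesis
      by (metis image_compactin)
  qed
  then show ?thesis
    by (intro compactin_Union) auto
qed

lemma chain_boundary_iterated_singular_subdivision:
  assumes "singular_chain (Suc p) X c"
  shows "chain_boundary (Suc p) ((singular_subdivision (Suc p) ^^ n) c) =
    (singular_subdivision p ^^ n) (chain_boundary (Suc p) c) \<and>
    singular_chain (Suc p) X ((singular_subdivision (Suc p) ^^ n) c)"
proof (induction n)
  case (Suc n)
  then show ?case
    using chain_boundary_singular_subdivision[of "Suc p" X "(singular_subdivision (Suc p) ^^ n) c"]
      singular_chain_singular_subdivision[of "Suc p" X "(singular_subdivision (Suc p) ^^ n) c"]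
    by simp
qed (use assms in simp)

text \<open>On a cycle, the chain homotopy from iterated subdivision to the identity loses the term
  with the boundary of the argument; the other term is the required boundary.\<close>

lemma iterated_singular_subdivision_relcycle:
  assumes "singular_relcycle p X {} z"
  shows "singular_relboundary p X {} ((singular_subdivision p ^^ n) z - z)"
proof -
  obtain h where h0: "\<And>p. h p 0 = (0 :: 'a chain)"
    and hc: "\<And>p X c. singular_chain p X c \<Longrightarrow> singular_chain (Suc p) X (h p c)"
    and hb: "\<And>p X c. singular_chain p X c \<Longrightarrow>
       chain_boundary (Suc p) (h p c) + h (p - Suc 0) (chain_boundary p c) =
       (singular_subdivision p ^^ n) c - c"
    using chain_homotopic_iterated_singular_subdivision[of n] by metis
  have z: "singular_chain p X z" "chain_boundary p z = 0"
    using assms by (auto simp: singular_cycle)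
  have "chain_boundary (Suc p) (h p z) = (singular_subdivision p ^^ n) z - z"
    using hb[OF z(1)] by (simp add: z h0)
  then show ?thesis
    unfolding singular_boundary using hc[OF z(1)] by blast
qed

text \<open>Mayer--Vietoris on the level of chains. If c bounds z away from C and d bounds z away
  from D, then c - d is a cycle, hence the boundary of some b. A fine subdivision of b splits into
  b1 away from D and b2 away from C. Moving the boundary of b2 to the side of c gives a chain with
  two descriptions, one avoiding C and one avoiding D.\<close>

proposition singular_boundary_complement_Un:
  assumes C: "closedin X C" and D: "closedin X D" and disj: "C \<inter> D = {}"
    and acyc: "acyclic_in (Suc p) X"
    and bc: "singular_relboundary p (subtopology X (topspace X - C)) {} z"
    and bd: "singular_relboundary p (subtopology X (topspace X - D)) {} z"
    and z: "singular_relcycle p (subtopology X (topspace X - (C \<union> D))) {} z"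
  shows "singular_relboundary p (subtopology X (topspace X - (C \<union> D))) {} z"
proof -
  let ?S = "\<lambda>n. singular_subdivision (Suc p) ^^ n"
  obtain c where c: "singular_chain (Suc p) (subtopology X (topspace X - C)) c"
    and bc: "chain_boundary (Suc p) c = z"
    using bc by (auto simp: singular_boundary)
  obtain d where d: "singular_chain (Suc p) (subtopology X (topspace X - D)) d"
    and bd: "chain_boundary (Suc p) d = z"
    using bd by (auto simp: singular_boundary)
  have cX: "singular_chain (Suc p) X c" "singular_chain (Suc p) X d"
    using c d by (auto simp: singular_chain_subtopology)
  then have "singular_relcycle (Suc p) X {} (c - d)"
    by (simp add: singular_cycle singular_chain_diff chain_boundary_diff bc bd)
  then obtain b where b: "singular_chain (Suc (Suc p)) X b"
    and bb: "chain_boundary (Suc (Suc p)) b = c - d"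
    using acyc by (auto simp: acyclic_in_def singular_boundary)
  have "(X closure_of D) \<subseteq> X interior_of (topspace X - C)"
    using C D disj closedin_subset[OF D]
    by (simp add: closure_of_closedin interior_of_openin openin_diff) blast
  then obtain n b1 b2 where b1: "singular_chain (Suc (Suc p)) (subtopology X (topspace X - D)) b1"
    and b2: "singular_chain (Suc (Suc p)) (subtopology X (topspace X - C)) b2"
    and Sb: "(singular_subdivision (Suc (Suc p)) ^^ n) b = b1 + b2"
    by (rule excised_chain_exists[of X D "topspace X - C" "topspace X" "Suc (Suc p)" b]) (use b in auto)
  have "chain_boundary (Suc (Suc p)) b1 + chain_boundary (Suc (Suc p)) b2 = ?S n c - ?S n d"
    using chain_boundary_iterated_singular_subdivision[OF b, of n]
    by (simp add: Sb bb chain_boundary_add singular_subdivision_power_diff)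
  then have eq: "?S n c - chain_boundary (Suc (Suc p)) b2 = ?S n d + chain_boundary (Suc (Suc p)) b1"
    by (simp add: algebra_simps)
  let ?e = "?S n c - chain_boundary (Suc (Suc p)) b2"
  have e1: "singular_chain (Suc p) (subtopology X (topspace X - C)) ?e"
    using chain_boundary_iterated_singular_subdivision[OF c, of n] singular_chain_boundary_alt[OF b2]
    by (simp add: singular_chain_diff)
  have e2: "singular_chain (Suc p) (subtopology X (topspace X - D)) ?e"
    using chain_boundary_iterated_singular_subdivision[OF d, of n] singular_chain_boundary_alt[OF b1]
    by (simp add: singular_chain_add eq)
  \<comment> \<open>Chains are free on simplexes, so each simplex that occurs in \<open>?e\<close>
    avoids C by the first description and D by the second.\<close>
  have e: "singular_chain (Suc p) (subtopology X (topspace X - (C \<union> D))) ?e"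
    using e1 e2 unfolding singular_chain_subtopology by blast
  have "chain_boundary (Suc p) (chain_boundary (Suc (Suc p)) b2) = 0"
    using chain_boundary_boundary_alt[OF b2] .
  then have "chain_boundary (Suc p) ?e = (singular_subdivision p ^^ n) z"
    using chain_boundary_iterated_singular_subdivision[OF c, of n]
    by (simp add: chain_boundary_diff bc)
  then have "singular_relboundary p (subtopology X (topspace X - (C \<union> D))) {} ((singular_subdivision p ^^ n) z)"
    using e by (auto simp: singular_boundary)
  \<comment> \<open>So far a subdivision of z bounds; it differs from z by a boundary.\<close>
  from singular_relboundary_diff[OF this iterated_singular_subdivision_relcycle[OF z, of n]]
  show ?thesis by simp
qed

section \<open>Punctured convex sets\<close>

lemma Euclidean_space_eq_top_of_set:
  "Euclidean_space n = top_of_set (topspace (Euclidean_space n))"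
  by (simp add: Euclidean_space_def euclidean_product_topology)

text \<open>H_q of the punctured space is H_(q+1) of the pair (R^n, R^n - 0), which agrees with
  H_(q+1-n) of a point. This degree is negative since q + 1 < n. Complements of homeomorphic closed
  sets have the same homology, and this moves the puncture from the origin to e.\<close>

lemma acyclic_in_Euclidean_punctured:
  assumes e: "e \<in> topspace (Euclidean_space n)" and q: "1 \<le> q" "q + 1 < n"
  shows "acyclic_in q (subtopology (Euclidean_space n) (topspace (Euclidean_space n) - {e}))"
proof -
  let ?E = "Euclidean_space n" and ?o = "(\<lambda>i. 0) :: nat \<Rightarrow> real"
  have o: "topspace (Euclidean_space 0) = {?o}" "?o \<in> topspace ?E"
    by (auto simp: topspace_Euclidean_space)
  have cl: "closedin (Euclidean_space m) {x}" if "x \<in> topspace (Euclidean_space m)" for x m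
    using that by (simp add: closedin_Euclidean_space_iff)
  let ?p = "int q + 1 - int n"
  have "trivial_group (homology_group ?p (Euclidean_space 0))"
    using trivial_reduced_homology_group_contractible_space[of "Euclidean_space 0" ?p]
      un_reduced_homology_group[of ?p "Euclidean_space 0"] q by simp
  then have "trivial_group (relative_homology_group ?p (Euclidean_space 0) (topspace (Euclidean_space 0) - {?o}))"
    by (simp add: o)
  then have "trivial_group (relative_homology_group (?p + n) (Euclidean_space (0 + n)) (topspace (Euclidean_space (0 + n)) - {?o}))"
    using relative_homology_group_Euclidean_complement_step[of 0 "{?o}" ?p n] cl[of ?o 0]
      isomorphic_group_triviality group_relative_homology_group o by blast
  then have "trivial_group (relative_homology_group (int q + 1) ?E (topspace ?E - {?o}))"
    by simp
  moreover have "topspace ?E \<inter> (topspace ?E - {?o}) \<noteq> {}"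
  proof -
    have "(\<lambda>i. if i = 0 then 1 else 0) \<in> topspace ?E - {?o}"
      using q by (auto simp: topspace_Euclidean_space fun_eq_iff)
    then show ?thesis by blast
  qed
  ultimately have "trivial_group (reduced_homology_group (int q) (subtopology ?E (topspace ?E - {?o})))"
    using isomorphic_group_reduced_homology_of_contractible[of ?E "topspace ?E - {?o}" "int q"]
      isomorphic_group_triviality group_relative_homology_group group_reduced_homology_group
      contractible_Euclidean_space by blast
  then have "trivial_group (homology_group (int q) (subtopology ?E (topspace ?E - {?o})))"
    using q by (simp add: un_reduced_homology_group)
  moreover have "subtopology ?E {?o} homeomorphic_space subtopology ?E {e}"
    unfolding homeomorphic_space_def homeomorphic_maps_def
    by (rule exI[where x = "\<lambda>_. e"], rule exI[where x = "\<lambda>_. ?o"])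
      (use e o in \<open>auto simp: continuous_map_in_subtopology\<close>)
  then have "homology_group (int q) (subtopology ?E (topspace ?E - {?o}))
       \<cong> homology_group (int q) (subtopology ?E (topspace ?E - {e}))"
    using isomorphic_homology_groups_Euclidean_complements cl e o by blast
  ultimately show ?thesis
    using acyclic_in_iff_trivial_group isomorphic_group_triviality group_relative_homology_group by blast
qed

text \<open>Functions on \<open>nat\<close> do not form an instance of \<open>real_vector\<close>, so the library's \<open>convex\<close>
  does not apply to subsets of \<open>Euclidean_space n\<close>.\<close>

definition fconvex :: "(nat \<Rightarrow> real) set \<Rightarrow> bool" where
  "fconvex V \<longleftrightarrow> (\<forall>x \<in> V. \<forall>y \<in> V. \<forall>t \<in> {0..1}. (\<lambda>i. (1 - t) * x i + t * y i) \<in> V)"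

lemma continuous_on_snd_coordinate:
  "continuous_on S (\<lambda>z::'a::topological_space \<times> (nat \<Rightarrow> real). snd z i)"
  by (rule continuous_on_product_then_coordinatewise) (intro continuous_intros)

lemma continuous_on_coordinate: "continuous_on S (\<lambda>x :: nat \<Rightarrow> real. x i)"
  by (rule continuous_on_product_then_coordinatewise) (intro continuous_intros)

lemma contractible_fconvex:
  assumes "fconvex V"
  shows "contractible V"
proof (cases "V = {}")
  case False
  then obtain a where a: "a \<in> V" by auto
  have "homotopic_with_canon (\<lambda>x. True) V V id (\<lambda>x. a)"
    unfolding homotopic_with_def
  proof (intro exI conjI)
    let ?h = "\<lambda>z. \<lambda>i. (1 - fst z) * snd z i + fst z * a i"
    have "continuous_on ({0..1} \<times> V) ?h"
      by (intro continuous_on_coordinatewise_then_product continuous_intros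
          continuous_on_snd_coordinate)
    moreover have "?h \<in> ({0..1} \<times> V) \<rightarrow> V"
      using assms a by (auto simp: fconvex_def)
    ultimately show "continuous_map (prod_topology (top_of_set {0..1}) (top_of_set V)) (top_of_set V) ?h"
      by simp
  qed auto
  then show ?thesis
    by (auto simp: contractible_def)
qed auto

text \<open>Beyond the first n coordinates all points of \<open>Euclidean_space n\<close> agree, so
  the least of the first n radii of a basic box serves. The 1 in the minimum takes care of n =
  0.\<close>

lemma cube_in_open:
  assumes "openin (Euclidean_space n) V" and a: "a \<in> V"
  obtains r where "r > 0"
    and "\<And>x. x \<in> topspace (Euclidean_space n) \<Longrightarrow> (\<And>i. i < n \<Longrightarrow> \<bar>x i - a i\<bar> < r) \<Longrightarrow> x \<in> V"
proof -
  obtain T where T: "openin (powertop_real UNIV) T" "V = T \<inter> topspace (Euclidean_space n)"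
    using assms by (auto simp: Euclidean_space_def openin_subtopology)
  then obtain U where "finite {i. U i \<noteq> topspace euclideanreal}"
    and U: "\<And>i. openin euclideanreal (U i)" and aU: "a \<in> Pi\<^sub>E UNIV U" and UT: "Pi\<^sub>E UNIV U \<subseteq> T"
    using a by (auto simp: openin_product_topology_alt)
  have "\<exists>\<epsilon>>0. \<forall>t. \<bar>t - a i\<bar> < \<epsilon> \<longrightarrow> t \<in> U i" for i
    using U[of i] aU by (auto simp: open_dist dist_real_def PiE_iff)
  then obtain \<epsilon> where \<epsilon>: "\<And>i. \<epsilon> i > 0" "\<And>i t. \<bar>t - a i\<bar> < \<epsilon> i \<Longrightarrow> t \<in> U i"
    by metis
  define r where "r = Min (insert 1 (\<epsilon> ` {..<n}))"
  have aR: "a i = 0" if "i \<ge> n" for i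
    using a T that by (auto simp: topspace_Euclidean_space)
  show thesis
  proof
    show "r > 0"
      using \<epsilon>(1) by (auto simp: r_def)
    fix x assume x: "x \<in> topspace (Euclidean_space n)" "\<And>i. i < n \<Longrightarrow> \<bar>x i - a i\<bar> < r"
    have "x i \<in> U i" for i
    proof (cases "i < n")
      case True
      then have "r \<le> \<epsilon> i"
        by (auto simp: r_def)
      with x(2)[OF True] show ?thesis
        by (intro \<epsilon>(2)) simp
    next
      case False
      then have "x i = a i"
        using x(1) aR by (auto simp: topspace_Euclidean_space)
      then show ?thesis
        using aU by (auto simp: PiE_iff)
    qed
    then show "x \<in> V"
      using UT T x(1) by (auto simp: PiE_iff)
  qed
qed

text \<open>A cycle in \<open>V - {e}\<close> bounds in the punctured whole space. A radial
  compression r towards e carries the bounding chain into \<open>V - {e}\<close>, and on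
  \<open>V - {e}\<close> it is homotopic to the identity along segments.\<close>

lemma acyclic_in_punctured_fconvex:
  assumes V: "openin (Euclidean_space n) V" "fconvex V" and q: "1 \<le> q" "q + 1 < n"
  shows "acyclic_in q (top_of_set (V - {e}))"
proof (cases "e \<in> V")
  case False
  then show ?thesis
    using contractible_fconvex[OF V(2)] q by (simp add: acyclic_in_contractible)
next
  case True
  let ?R = "topspace (Euclidean_space n)"
  have VR: "V \<subseteq> ?R"
    using V(1) openin_subset by blast
  then have eR: "e i = 0" if "i \<ge> n" for i
    using True that by (auto simp: topspace_Euclidean_space)
  obtain \<rho> where \<rho>: "\<rho> > 0" and cube: "\<And>x. x \<in> ?R \<Longrightarrow> (\<And>i. i < n \<Longrightarrow> \<bar>x i - e i\<bar> < \<rho>) \<Longrightarrow> x \<in> V"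
    using cube_in_open[OF V(1) True] by blast
  define \<nu> where "\<nu> = (\<lambda>x. \<Sum>i<n. \<bar>x i - e i\<bar>)"
  \<comment> \<open>With this factor the compressed offset, of size at most
    \<open>m x * \<nu> x\<close>, stays below \<open>\<rho>\<close> however far away x lies.\<close>
  define m where "m = (\<lambda>x. \<rho> / (\<rho> + \<nu> x))"
  define r where "r = (\<lambda>x i. e i + m x * (x i - e i))"
  have \<nu>0: "\<nu> x \<ge> 0" for x
    by (simp add: \<nu>_def sum_nonneg)
  have m: "0 < m x" "m x \<le> 1" for x
    using \<rho> \<nu>0[of x] by (auto simp: m_def field_simps)
  have le\<nu>: "\<bar>x i - e i\<bar> \<le> \<nu> x" if "i < n" for x i
    unfolding \<nu>_def by (rule member_le_sum) (use that in auto)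
  have rV: "r x \<in> V" if "x \<in> ?R" for x
  proof (rule cube)
    show "r x \<in> ?R"
      using that eR by (auto simp: r_def topspace_Euclidean_space)
    show "\<bar>r x i - e i\<bar> < \<rho>" if "i < n" for i
    proof -
      have "\<bar>r x i - e i\<bar> \<le> m x * \<nu> x"
        using le\<nu>[OF that, of x] m[of x] by (simp add: r_def abs_mult)
      also have "\<dots> < \<rho>"
        using \<rho> \<nu>0[of x] by (simp add: m_def field_simps)
      finally show ?thesis .
    qed
  qed
  have re: "r x \<noteq> e" if "x \<noteq> e" for x
  proof
    assume "r x = e"
    then have "m x * (x i - e i) = 0" for i
      by (auto simp: r_def fun_eq_iff)
    then have "x i = e i" for i
      using m(1)[of x] by (simp add: less_imp_neq[symmetric])
    with that show False by (simp add: fun_eq_iff)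
  qed
  have contm: "continuous_on S m" for S
    unfolding m_def \<nu>_def
    by (intro continuous_intros continuous_on_coordinate)
      (use \<rho> \<nu>0 in \<open>auto simp: \<nu>_def add_pos_nonneg less_imp_neq[symmetric]\<close>)
  have contr: "continuous_on S r" for S
    unfolding r_def
    by (intro continuous_on_coordinatewise_then_product continuous_intros contm
        continuous_on_coordinate)
  have contr2: "continuous_on S (\<lambda>z. r (snd z) i)" for S :: "(real \<times> (nat \<Rightarrow> real)) set" and i
    by (rule continuous_on_product_then_coordinatewise, rule continuous_on_compose2[OF contr[of UNIV]])
      (auto intro: continuous_intros)
  let ?P = "top_of_set (?R - {e})" and ?V = "top_of_set (V - {e})"
  have P: "acyclic_in q ?P"
    using acyclic_in_Euclidean_punctured[of e n q] VR True q
    by (subst (asm) Euclidean_space_eq_top_of_set) (auto simp: subtopology_subtopology Int_absorb2 Int_absorb1 Diff_subset)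
  have "homotopic_with (\<lambda>h. h \<in> {} \<rightarrow> {}) ?V ?V r id"
    unfolding homotopic_with_def
  proof (intro exI conjI)
    let ?h = "\<lambda>z i. (1 - fst z) * r (snd z) i + fst z * snd z i"
    have "continuous_on ({0..1} \<times> (V - {e})) ?h"
      by (intro continuous_on_coordinatewise_then_product continuous_intros
          continuous_on_snd_coordinate contr2)
    moreover have "?h \<in> ({0..1} \<times> (V - {e})) \<rightarrow> V - {e}"
    proof (rule Pi_I)
      fix z :: "real \<times> (nat \<Rightarrow> real)" assume *: "z \<in> {0..1} \<times> (V - {e})"
      obtain t x where z: "z = (t, x)"
        by (cases z)
      then have t: "t \<in> {0..1}" and x: "x \<in> V" "x \<noteq> e"
        using * by auto
      \<comment> \<open>On the segment from \<open>r x\<close> to x the offset from e is that of x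
        times a positive factor, so the coordinate j still tells the point from e.\<close>
      obtain j where "x j \<noteq> e j"
        using x(2) by auto
      moreover have "(1 - t) * m x + t > 0"
        using t m(1)[of x] by (cases "t = 1") (auto intro: add_pos_nonneg)
      moreover have "?h (t, x) j = e j + ((1 - t) * m x + t) * (x j - e j)"
        by (simp add: r_def algebra_simps)
      ultimately have "?h (t, x) j \<noteq> e j"
        by (smt (verit) mult_eq_0_iff)
      then have "?h (t, x) \<noteq> e"
        by metis
      moreover have "?h (t, x) \<in> V"
        using V(2) rV[of x] x VR t by (auto simp: fconvex_def)
      ultimately show "?h z \<in> V - {e}"
        unfolding z by blast
    qed
    ultimately show "continuous_map (prod_topology (top_of_set {0..1}) ?V) ?V ?h"
      by simp
  qed auto
  then have hom: "homologous_rel q ?V {} (chain_map q r z) (chain_map q id z)"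
    if "singular_relcycle q ?V {} z" for z
    using homotopic_imp_homologous_rel_chain_maps that by blast
  show ?thesis
    unfolding acyclic_in_def
  proof (intro allI impI)
    fix z assume z: "singular_relcycle q ?V {} z"
    then have "singular_relcycle q ?P {} z"
      using singular_cycle_mono[of q euclidean "V - {e}" z "?R - {e}"] VR by auto
    then have "singular_relboundary q ?P {} z"
      using P by (simp add: acyclic_in_def)
    then have "singular_relboundary q ?V {} (chain_map q r z)"
    proof (rule singular_relboundary_chain_map)
      show "continuous_map ?P ?V r"
        using contr rV re by auto
    qed auto
    moreover have "chain_map q id z = z"
      using z by (simp add: singular_cycle chain_map_ident[of q ?V])
    ultimately show "singular_relboundary q ?V {} z"
      using hom[OF z] singular_relboundary_diff[of q ?V "{}" "chain_map q r z" "chain_map q r z - z"]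
      by (simp add: homologous_rel_def)
  qed
qed

section \<open>Covers of compact metric spaces\<close>

text \<open>For a compact set this means that its covering dimension is less than \<open>m\<close>.\<close>

definition fine_covers :: "nat \<Rightarrow> 'a::metric_space set \<Rightarrow> bool" where
  "fine_covers m F \<longleftrightarrow> (\<forall>\<epsilon>>0. \<exists>\<U>. finite \<U> \<and>
     (\<forall>U \<in> \<U>. openin (top_of_set F) U \<and> (\<forall>x \<in> U. \<forall>y \<in> U. dist x y < \<epsilon>)) \<and>
     \<Union>\<U> = F \<and> (\<forall>x \<in> F. card {U \<in> \<U>. x \<in> U} \<le> m))"

text \<open>Traces of distinct members on G may coincide, which only lowers the multiplicity. The
  family has to cover G alone, so it may be a part of a cover of F.\<close>

lemma trace_cover:
  assumes "finite \<U>" and "\<And>U. U \<in> \<U> \<Longrightarrow> openin (top_of_set F) U \<and> (\<forall>x \<in> U. \<forall>y \<in> U. dist x y < \<epsilon>)"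
    and "G \<subseteq> F" and "G \<subseteq> \<Union>\<U>" and card: "\<And>x. x \<in> G \<Longrightarrow> card {U \<in> \<U>. x \<in> U} \<le> m"
  shows "\<exists>\<V>. finite \<V> \<and>
     (\<forall>V \<in> \<V>. openin (top_of_set G) V \<and> (\<forall>x \<in> V. \<forall>y \<in> V. dist x y < \<epsilon>)) \<and>
     \<Union>\<V> = G \<and> (\<forall>x \<in> G. card {V \<in> \<V>. x \<in> V} \<le> m)"
proof -
  let ?\<V> = "(\<lambda>U. U \<inter> G) ` \<U>"
  have "finite ?\<V>"
    using assms(1) by simp
  moreover have "\<Union>?\<V> = G"
    using assms(4) by auto
  moreover have "openin (top_of_set G) V \<and> (\<forall>x \<in> V. \<forall>y \<in> V. dist x y < \<epsilon>)" if V: "V \<in> ?\<V>" for V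
  proof -
    obtain U where U: "U \<in> \<U>" "V = U \<inter> G"
      using V by auto
    moreover obtain T where "open T" "U = F \<inter> T"
      using assms(2)[OF U(1)] by (auto simp: openin_open)
    ultimately have "V = G \<inter> T"
      using assms(3) by auto
    then show ?thesis
      using \<open>open T\<close> assms(2)[OF U(1)] U(2) by auto
  qed
  moreover have "card {V \<in> ?\<V>. x \<in> V} \<le> m" if "x \<in> G" for x
  proof -
    have "{V \<in> ?\<V>. x \<in> V} = (\<lambda>U. U \<inter> G) ` {U \<in> \<U>. x \<in> U}"
      using that by auto
    then have "card {V \<in> ?\<V>. x \<in> V} \<le> card {U \<in> \<U>. x \<in> U}"
      using assms(1) by (simp add: card_image_le)
    with card[OF that] show ?thesis by simp
  qed
  ultimately show ?thesis
    by (intro exI[of _ ?\<V>] conjI ballI) auto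
qed

lemma fine_covers_subset:
  assumes "fine_covers m F" and "G \<subseteq> F"
  shows "fine_covers m G"
  unfolding fine_covers_def
proof (intro allI impI)
  fix \<epsilon> :: real assume "\<epsilon> > 0"
  then obtain \<U> where \<U>: "finite \<U>"
    "\<And>U. U \<in> \<U> \<Longrightarrow> openin (top_of_set F) U \<and> (\<forall>x \<in> U. \<forall>y \<in> U. dist x y < \<epsilon>)"
    "\<Union>\<U> = F" "\<And>x. x \<in> F \<Longrightarrow> card {U \<in> \<U>. x \<in> U} \<le> m"
    using assms(1) unfolding fine_covers_def by metis
  show "\<exists>\<V>. finite \<V> \<and>
     (\<forall>V \<in> \<V>. openin (top_of_set G) V \<and> (\<forall>x \<in> V. \<forall>y \<in> V. dist x y < \<epsilon>)) \<and>
     \<Union>\<V> = G \<and> (\<forall>x \<in> G. card {V \<in> \<V>. x \<in> V} \<le> m)"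
    by (rule trace_cover[OF \<U>(1,2) assms(2)]) (use \<U>(3,4) assms(2) in blast)+
qed

lemma fine_covers_0_imp_empty:
  assumes "fine_covers 0 F"
  shows "F = {}"
proof -
  obtain \<U> where \<U>: "finite \<U>" "\<Union>\<U> = F" "\<And>x. x \<in> F \<Longrightarrow> card {U \<in> \<U>. x \<in> U} \<le> 0"
    using assms unfolding fine_covers_def by (metis zero_less_one)
  have "x \<notin> F" for x
  proof
    assume "x \<in> F"
    then have "card {U \<in> \<U>. x \<in> U} = 0" "finite {U \<in> \<U>. x \<in> U}"
      using \<U> by auto
    then have "{U \<in> \<U>. x \<in> U} = {}"
      by simp
    then show False
      using \<U>(2) \<open>x \<in> F\<close> by blast
  qed
  then show ?thesis by blast
qed

lemma separate_compact_compact: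
  fixes A B :: "'a::metric_space set"
  assumes "compact A" "compact B" "A \<inter> B = {}"
  obtains \<delta> where "\<delta> > 0" "\<And>a b. a \<in> A \<Longrightarrow> b \<in> B \<Longrightarrow> \<delta> \<le> dist a b"
proof (cases "A \<times> B = {}")
  case True
  then show ?thesis
    using that[of 1] by auto
next
  case False
  have "continuous_on (A \<times> B) (\<lambda>z. dist (fst z) (snd z))"
    by (intro continuous_intros)
  then have "\<exists>z \<in> A \<times> B. \<forall>w \<in> A \<times> B. dist (fst z) (snd z) \<le> dist (fst w) (snd w)"
    by (intro continuous_attains_inf compact_Times assms(1,2) False)
  then obtain z where z: "z \<in> A \<times> B" "\<And>w. w \<in> A \<times> B \<Longrightarrow> dist (fst z) (snd z) \<le> dist (fst w) (snd w)"
    by blast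
  show ?thesis
  proof (rule that)
    show "dist (fst z) (snd z) > 0"
      using z(1) assms(3) by auto
    show "dist (fst z) (snd z) \<le> dist a b" if "a \<in> A" "b \<in> B" for a b
      using z(2)[of "(a, b)"] that by simp
  qed
qed

text \<open>In a fine cover let \<open>\<A>\<close> be the members that meet the neighbourhood of A
  and \<open>\<B>\<close> the others. A point outside A' and B' lies in members of both kinds, so
  forgetting \<open>\<A>\<close> costs at least one of its at most m + 1 memberships.\<close>

lemma partition_step:
  fixes F :: "'a::metric_space set"
  assumes F: "compact F" "fine_covers (Suc m) F" and A: "closed A" "A \<subseteq> F" and B: "closed B" "B \<subseteq> F"
    and disj: "A \<inter> B = {}" and \<epsilon>: "\<epsilon> > 0"
  shows "\<exists>A' B'. closed A' \<and> A' \<subseteq> F \<and> closed B' \<and> B' \<subseteq> F \<and> A' \<inter> B' = {} \<and>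
    (\<exists>T. openin (top_of_set F) T \<and> A \<subseteq> T \<and> T \<subseteq> A') \<and> (\<exists>T. openin (top_of_set F) T \<and> B \<subseteq> T \<and> T \<subseteq> B') \<and>
    (\<exists>\<V>. finite \<V> \<and>
     (\<forall>V \<in> \<V>. openin (top_of_set (F - (A' \<union> B'))) V \<and> (\<forall>x \<in> V. \<forall>y \<in> V. dist x y < \<epsilon>)) \<and>
     \<Union>\<V> = F - (A' \<union> B') \<and> (\<forall>x \<in> F - (A' \<union> B'). card {V \<in> \<V>. x \<in> V} \<le> m))"
proof -
  have "compact (F \<inter> A)" "compact (F \<inter> B)"
    using F(1) A(1) B(1) compact_Int_closed by blast+
  then have "compact A" "compact B"
    using A(2) B(2) by (simp_all add: Int_absorb1)
  then obtain \<delta> where \<delta>: "\<delta> > 0" "\<And>a b. a \<in> A \<Longrightarrow> b \<in> B \<Longrightarrow> \<delta> \<le> dist a b"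
    using separate_compact_compact disj by blast
  \<comment> \<open>The radius around A, the diameter of a member and the radius around B add up to
    less than \<open>\<delta>\<close>, so no member meets the neighbourhoods of both A and
    B.\<close>
  have pos: "min \<epsilon> (\<delta>/4) > 0"
    using \<delta>(1) \<epsilon> by simp
  obtain \<U> where fin: "finite \<U>"
    and U: "\<And>U. U \<in> \<U> \<Longrightarrow> openin (top_of_set F) U \<and> (\<forall>x \<in> U. \<forall>y \<in> U. dist x y < min \<epsilon> (\<delta>/4))"
    and cov: "\<Union>\<U> = F" and card: "\<And>x. x \<in> F \<Longrightarrow> card {U \<in> \<U>. x \<in> U} \<le> Suc m"
    using F(2)[unfolded fine_covers_def, rule_format, OF pos] by metis
  define T where "T = (\<lambda>S. F \<inter> (\<Union>s\<in>S. ball s (\<delta>/4)))"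
  have T: "openin (top_of_set F) (T S)" "S \<subseteq> F \<Longrightarrow> S \<subseteq> T S" for S
    using \<delta>(1) by (auto simp: T_def intro: openin_open_Int)
  define \<A> where "\<A> = {U \<in> \<U>. U \<inter> T A \<noteq> {}}"
  define \<B> where "\<B> = \<U> - \<A>"
  define A' where "A' = F - \<Union>\<B>"
  define B' where "B' = F - \<Union>\<A>"
  have op: "openin (top_of_set F) (\<Union>\<A>)" "openin (top_of_set F) (\<Union>\<B>)"
    using U by (auto simp: \<A>_def \<B>_def)
  have cl: "closed (F - S)" if "openin (top_of_set F) S" for S
    using that F(1) by (metis closedin_closed_trans closedin_diff closedin_topspace compact_imp_closed topspace_euclidean_subtopology)
  have TA: "T A \<subseteq> A'"
    by (auto simp: A'_def \<B>_def \<A>_def T_def)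
  have TB: "T B \<subseteq> B'"
  proof
    fix x assume x: "x \<in> T B"
    show "x \<in> B'"
    proof (rule ccontr)
      assume "x \<notin> B'"
      then have "x \<in> \<Union>\<A>"
        using x by (simp add: B'_def T_def)
      then obtain V u where V: "V \<in> \<U>" "x \<in> V" "u \<in> V" "u \<in> T A"
        unfolding \<A>_def by blast
      then obtain a b where "a \<in> A" "u \<in> ball a (\<delta>/4)" "b \<in> B" "x \<in> ball b (\<delta>/4)"
        using x unfolding T_def by blast
      then have "a \<in> A" "dist a u < \<delta>/4" "b \<in> B" "dist b x < \<delta>/4"
        by simp_all
      moreover have "dist x u < \<delta>/4"
        using U[OF V(1)] V by auto
      moreover have "dist a b \<le> dist a u + dist x u + dist b x"
        using dist_triangle[of a b u] dist_triangle[of u b x] by (simp add: dist_commute)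
      ultimately show False
        using \<delta>(2)[of a b] \<delta>(1) by linarith
    qed
  qed
  have dj: "A' \<inter> B' = {}"
    using cov by (auto simp: A'_def B'_def \<A>_def \<B>_def)
  have cov': "\<exists>\<V>. finite \<V> \<and>
     (\<forall>V \<in> \<V>. openin (top_of_set (F - (A' \<union> B'))) V \<and> (\<forall>x \<in> V. \<forall>y \<in> V. dist x y < \<epsilon>)) \<and>
     \<Union>\<V> = F - (A' \<union> B') \<and> (\<forall>x \<in> F - (A' \<union> B'). card {V \<in> \<V>. x \<in> V} \<le> m)"
  proof (rule trace_cover)
    show "finite \<B>"
      using fin by (simp add: \<B>_def)
    show "openin (top_of_set F) U \<and> (\<forall>x \<in> U. \<forall>y \<in> U. dist x y < \<epsilon>)" if "U \<in> \<B>" for U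
      using U[of U] that by (auto simp: \<B>_def)
    show "F - (A' \<union> B') \<subseteq> F" "F - (A' \<union> B') \<subseteq> \<Union>\<B>"
      by (auto simp: A'_def)
    fix x assume x: "x \<in> F - (A' \<union> B')"
    then obtain U0 where U0: "U0 \<in> \<A>" "x \<in> U0"
      by (auto simp: B'_def)
    then have "insert U0 {U \<in> \<B>. x \<in> U} \<subseteq> {U \<in> \<U>. x \<in> U}"
      by (auto simp: \<A>_def \<B>_def)
    then have "card (insert U0 {U \<in> \<B>. x \<in> U}) \<le> card {U \<in> \<U>. x \<in> U}"
      using fin by (intro card_mono) auto
    moreover have "card (insert U0 {U \<in> \<B>. x \<in> U}) = Suc (card {U \<in> \<B>. x \<in> U})"
      using U0 fin by (simp add: \<B>_def)
    ultimately show "card {U \<in> \<B>. x \<in> U} \<le> m"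
      using card[of x] x by simp
  qed
  have opA: "\<exists>U. openin (top_of_set F) U \<and> A \<subseteq> U \<and> U \<subseteq> A'"
    using T[of A] A(2) TA by blast
  have opB: "\<exists>U. openin (top_of_set F) U \<and> B \<subseteq> U \<and> U \<subseteq> B'"
    using T[of B] B(2) TB by blast
  have clA: "closed A'" "A' \<subseteq> F" and clB: "closed B'" "B' \<subseteq> F"
    unfolding A'_def B'_def using cl op by blast+
  show ?thesis
    by (rule exI[of _ A'], rule exI[of _ B'], intro conjI)
      (fact clA clB dj opA opB cov')+
qed

text \<open>This is the inductive step in comparing covering dimension with large inductive dimension.
  The increasing neighbourhoods \<open>a n\<close> of \<open>A\<close> and \<open>b n\<close> of \<open>B\<close> leave between them a set with covers
  of mesh below \<open>1 / (n + 1)\<close> and order at most \<open>m\<close>: each point there lies in a member of the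
  \<open>n\<close>-th cover of \<open>F\<close> that meets the neighbourhood of \<open>A\<close>, and only the others are kept.\<close>

proposition fine_covers_partition:
  fixes F :: "'a::metric_space set"
  assumes F: "compact F" "fine_covers (Suc m) F" and A: "closed A" "A \<subseteq> F" and B: "closed B" "B \<subseteq> F"
    and disj: "A \<inter> B = {}"
  obtains F1 F2 where "closed F1" "closed F2" "F1 \<union> F2 = F" "F1 \<inter> B = {}" "F2 \<inter> A = {}"
    "fine_covers m (F1 \<inter> F2)"
proof -
  define P where "P = (\<lambda>(A, B). closed A \<and> A \<subseteq> F \<and> closed B \<and> B \<subseteq> F \<and> A \<inter> B = {})"
  define Q where "Q = (\<lambda>n (A, B) (A', B').
    (\<exists>T. openin (top_of_set F) T \<and> A \<subseteq> T \<and> T \<subseteq> A') \<and> (\<exists>T. openin (top_of_set F) T \<and> B \<subseteq> T \<and> T \<subseteq> B') \<and>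
    (\<exists>\<V>. finite \<V> \<and>
     (\<forall>V \<in> \<V>. openin (top_of_set (F - (A' \<union> B'))) V \<and> (\<forall>x \<in> V. \<forall>y \<in> V. dist x y < inverse (real (Suc n)))) \<and>
     \<Union>\<V> = F - (A' \<union> B') \<and> (\<forall>x \<in> F - (A' \<union> B'). card {V \<in> \<V>. x \<in> V} \<le> m)))"
  have "\<exists>S. \<forall>n. (P (S n) \<and> (n = 0 \<longrightarrow> S n = (A, B))) \<and> Q n (S n) (S (Suc n))"
  proof (rule dependent_nat_choice)
    show "\<exists>x. P x \<and> (0 = (0::nat) \<longrightarrow> x = (A, B))"
      using A B disj by (auto simp: P_def)
    fix x :: "'a set \<times> 'a set" and n :: nat
    assume "P x \<and> (n = 0 \<longrightarrow> x = (A, B))"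
    then have x: "closed (fst x)" "fst x \<subseteq> F" "closed (snd x)" "snd x \<subseteq> F" "fst x \<inter> snd x = {}"
      by (simp_all add: P_def split: prod.splits)
    have "\<exists>A' B'. P (A', B') \<and> Q n (fst x, snd x) (A', B')"
      unfolding P_def Q_def prod.case conj_assoc
      by (rule partition_step[OF F x]) simp
    then obtain A' B' where "P (A', B')" "Q n (fst x, snd x) (A', B')"
      by metis
    then show "\<exists>y. (P y \<and> (Suc n = 0 \<longrightarrow> y = (A, B))) \<and> Q n x y"
      by (intro exI[of _ "(A', B')"]) simp
  qed
  then obtain S where PS: "\<And>n. P (S n)" and S0: "S 0 = (A, B)" and QS: "\<And>n. Q n (S n) (S (Suc n))"
    by metis
  define a where "a = (\<lambda>n. fst (S n))"
  define b where "b = (\<lambda>n. snd (S n))"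
  have S: "S n = (a n, b n)" for n
    by (simp add: a_def b_def)
  have disjn: "a n \<inter> b n = {}" for n
    using PS[of n] by (simp add: P_def S)
  have "\<exists>T. openin (top_of_set F) T \<and> a n \<subseteq> T \<and> T \<subseteq> a (Suc n)"
    "\<exists>T. openin (top_of_set F) T \<and> b n \<subseteq> T \<and> T \<subseteq> b (Suc n)" for n
    using QS[of n] by (simp_all add: Q_def S)
  then obtain s t where s: "\<And>n. openin (top_of_set F) (s n)" "\<And>n. a n \<subseteq> s n" "\<And>n. s n \<subseteq> a (Suc n)"
    and t: "\<And>n. openin (top_of_set F) (t n)" "\<And>n. b n \<subseteq> t n" "\<And>n. t n \<subseteq> b (Suc n)"
    by metis
  \<comment> \<open>Between consecutive closed sets of the sequence lies a relatively open one. The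
    union of the closed sets is therefore relatively open, and its complement in F is
    closed.\<close>
  have interleave: "(\<Union>n. u n) = (\<Union>n. v n)" if "\<And>n. u n \<subseteq> v n" "\<And>n. v n \<subseteq> u (Suc n)" for u v :: "nat \<Rightarrow> 'a set"
  proof (intro equalityI UN_least)
    show "u n \<subseteq> (\<Union>n. v n)" for n
      using that(1)[of n] by blast
    show "v n \<subseteq> (\<Union>n. u n)" for n
      using that(2)[of n] by blast
  qed
  have "(\<Union>n. a n) = (\<Union>n. s n)" "(\<Union>n. b n) = (\<Union>n. t n)"
    by (intro interleave s t)+
  then have op: "openin (top_of_set F) (\<Union>n. a n)" "openin (top_of_set F) (\<Union>n. b n)"
    using s(1) t(1) by auto
  have cl: "closed (F - S)" if "openin (top_of_set F) S" for S
    using that F(1) by (metis closedin_closed_trans closedin_diff closedin_topspace compact_imp_closed topspace_euclidean_subtopology)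
  have mono: "mono a" "mono b"
    using s(2,3) t(2,3) by (intro incseq_SucI; metis order_trans)+
  have "(\<Union>n. a n) \<inter> (\<Union>n. b n) = {}"
  proof -
    have "a i \<inter> b j \<subseteq> a (max i j) \<inter> b (max i j)" for i j
      using monoD[OF mono(1), of i "max i j"] monoD[OF mono(2), of j "max i j"] by auto
    then show ?thesis
      using disjn by blast
  qed
  moreover have "A \<subseteq> (\<Union>n. a n)" "B \<subseteq> (\<Union>n. b n)"
    using S0 S[of 0] by auto
  moreover have "fine_covers m ((F - (\<Union>n. b n)) \<inter> (F - (\<Union>n. a n)))"
    unfolding fine_covers_def
  proof (intro allI impI)
    fix \<epsilon> :: real assume "\<epsilon> > 0"
    then obtain n where n: "inverse (real (Suc n)) < \<epsilon>"
      using reals_Archimedean by blast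
    let ?G = "(F - (\<Union>n. b n)) \<inter> (F - (\<Union>n. a n))" and ?H = "F - (a (Suc n) \<union> b (Suc n))"
    have "\<exists>\<V>. finite \<V> \<and> (\<forall>V \<in> \<V>. openin (top_of_set ?H) V \<and> (\<forall>x \<in> V. \<forall>y \<in> V. dist x y < inverse (real (Suc n)))) \<and>
      \<Union>\<V> = ?H \<and> (\<forall>x \<in> ?H. card {V \<in> \<V>. x \<in> V} \<le> m)"
      using QS[of n] unfolding Q_def S by simp
    then obtain \<V> where \<V>: "finite \<V>"
      "\<And>V. V \<in> \<V> \<Longrightarrow> openin (top_of_set ?H) V \<and> (\<forall>x \<in> V. \<forall>y \<in> V. dist x y < inverse (real (Suc n)))"
      "\<Union>\<V> = ?H" "\<And>x. x \<in> ?H \<Longrightarrow> card {V \<in> \<V>. x \<in> V} \<le> m"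
      by metis
    \<comment> \<open>What remains in the limit lies in the gap left at every stage, so it inherits
      covers of arbitrarily small mesh.\<close>
    have GH: "?G \<subseteq> ?H" by blast
    show "\<exists>\<U>. finite \<U> \<and> (\<forall>U \<in> \<U>. openin (top_of_set ?G) U \<and> (\<forall>x \<in> U. \<forall>y \<in> U. dist x y < \<epsilon>)) \<and>
      \<Union>\<U> = ?G \<and> (\<forall>x \<in> ?G. card {U \<in> \<U>. x \<in> U} \<le> m)"
    proof (rule trace_cover[OF \<V>(1) _ GH])
      show "openin (top_of_set ?H) V \<and> (\<forall>x \<in> V. \<forall>y \<in> V. dist x y < \<epsilon>)" if "V \<in> \<V>" for V
        using \<V>(2)[OF that] n by (meson less_trans)
      show "?G \<subseteq> \<Union>\<V>"
        using GH \<V>(3) by simp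
      show "card {V \<in> \<V>. x \<in> V} \<le> m" if "x \<in> ?G" for x
        using \<V>(4) GH that by (metis subsetD)
    qed
  qed
  ultimately show thesis
    by (intro that[of "F - (\<Union>n. b n)" "F - (\<Union>n. a n)"] cl op) blast+
qed

section \<open>Complements of sets of codimension at least three\<close>

text \<open>The degree has to vary in the induction: degree q for m + 1 rests on degree q + 1 for m,
  applied to the intersection of two pieces.\<close>

proposition acyclic_in_fconvex_complement:
  assumes V: "openin (Euclidean_space n) V" "fconvex V"
  shows "compact E \<Longrightarrow> fine_covers m E \<Longrightarrow> 1 \<le> q \<Longrightarrow> q + m < n \<Longrightarrow> acyclic_in q (top_of_set (V - E))"
proof (induction m arbitrary: q E)
  case 0
  then show ?case
    using fine_covers_0_imp_empty[of E] contractible_fconvex[OF V(2)]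
    by (simp add: acyclic_in_contractible)
next
  case (Suc m)
  show ?case
    unfolding acyclic_in_def
  proof (intro allI impI)
    fix z assume z: "singular_relcycle q (top_of_set (V - E)) {} z"
    define bounds where "bounds = (\<lambda>F. singular_relboundary q (top_of_set (V - F)) {} z)"
    have antimono: "bounds F" if "bounds G" "F \<subseteq> G" for F G
      using singular_boundary_mono[of "V - G" "V - F" q euclidean z] that
      unfolding bounds_def by blast
    have cyc: "singular_relcycle q (top_of_set (V - F)) {} z" if "F \<subseteq> E" for F
      using singular_cycle_mono[OF z, of "V - F"] that by blast
    have "acyclic_in q (top_of_set V)"
      using contractible_fconvex[OF V(2)] Suc.prems by (simp add: acyclic_in_contractible)
    then have empty: "bounds {}"
      using cyc[of "{}"] by (simp add: acyclic_in_def bounds_def)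
    \<comment> \<open>A chain that bounds z away from e has compact image, hence avoids a ball
      around e.\<close>
    have "\<exists>r>0. bounds (ball e r)" if e: "e \<in> E" for e
    proof -
      have "acyclic_in q (top_of_set (V - {e}))"
        using acyclic_in_punctured_fconvex[OF V, of q e] Suc.prems by simp
      then obtain c where c: "singular_chain (Suc q) (top_of_set (V - {e})) c"
        and cz: "chain_boundary (Suc q) c = z"
        using cyc[of "{e}"] e by (auto simp: acyclic_in_def singular_boundary)
      define S where "S = (\<Union>f \<in> Poly_Mapping.keys c. f ` standard_simplex (Suc q))"
      have S: "compact S" "S \<subseteq> V - {e}"
        using singular_chain_image_compactin[OF c] by (auto simp: compactin_subtopology S_def)
      have "open (- S)" "e \<in> - S"
        using compact_imp_closed[OF S(1)] S(2) by auto
      then obtain r where r: "r > 0" "ball e r \<subseteq> - S"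
        by (rule openE)
      have "f ` standard_simplex (Suc q) \<subseteq> V - ball e r" if "f \<in> Poly_Mapping.keys c" for f
      proof -
        have "f ` standard_simplex (Suc q) \<subseteq> S"
          using that by (auto simp: S_def)
        then show ?thesis
          using S(2) r(2) by blast
      qed
      then have "singular_chain (Suc q) (top_of_set (V - ball e r)) c"
        using c unfolding singular_chain_subtopology by blast
      then show ?thesis
        using r(1) cz by (auto simp: bounds_def singular_boundary)
    qed
    then obtain r where r: "\<And>e. e \<in> E \<Longrightarrow> r e > 0" "\<And>e. e \<in> E \<Longrightarrow> bounds (ball e (r e))"
      by metis
    \<comment> \<open>A Lebesgue number of the cover of E by these balls makes the radius
      uniform.\<close>
    have "\<exists>\<delta>>0. \<forall>T. T \<subseteq> E \<longrightarrow> diameter T < \<delta> \<longrightarrow> bounds T"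
    proof (cases "E = {}")
      case True
      then show ?thesis
        using empty by (intro exI[of _ 1]) auto
    next
      case False
      obtain \<delta> where "\<delta> > 0"
        and \<delta>: "\<And>T. \<lbrakk>T \<subseteq> E; diameter T < \<delta>\<rbrakk> \<Longrightarrow> \<exists>B \<in> (\<lambda>e. ball e (r e)) ` E. T \<subseteq> B"
        by (rule Lebesgue_number_lemma[of E "(\<lambda>e. ball e (r e)) ` E"])
          (use False Suc.prems(1) r(1) in auto)
      then show ?thesis
        using antimono r(2) by blast
    qed
    then obtain \<delta> where \<delta>: "\<delta> > 0" "\<And>T. T \<subseteq> E \<Longrightarrow> diameter T < \<delta> \<Longrightarrow> bounds T"
      by metis
    \<comment> \<open>Induction on the number of balls that cover F. One ball is split off at a
      time: the piece F1 near its centre is small, and the rest F2 lies in the remaining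
      balls.\<close>
    have main: "finite X \<Longrightarrow> compact F \<Longrightarrow> F \<subseteq> E \<Longrightarrow> F \<subseteq> (\<Union>x\<in>X. ball x (\<delta>/5)) \<Longrightarrow> bounds F" for X F
    proof (induction X arbitrary: F rule: finite_induct)
      case empty
      then show ?case using \<open>bounds {}\<close> by simp
    next
      case (insert x X)
      \<comment> \<open>F1 misses \<open>?B\<close>, so it lies within \<open>2*\<delta>/5\<close>
        of x and has diameter at most \<open>4*\<delta>/5\<close>. F2 misses \<open>?A\<close>, so
        the ball around x contributes nothing to its cover.\<close>
      let ?A = "F \<inter> cball x (\<delta>/5)" and ?B = "F - ball x (2*\<delta>/5)"
      have disj: "?A \<inter> ?B = {}"
        using \<delta>(1) by auto
      have clF: "closed F"
        using insert.prems(1) compact_imp_closed by blast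
      have "fine_covers (Suc m) F"
        using fine_covers_subset[OF Suc.prems(2) insert.prems(2)] .
      then obtain F1 F2 where F: "closed F1" "closed F2" "F1 \<union> F2 = F" "F1 \<inter> ?B = {}" "F2 \<inter> ?A = {}"
        "fine_covers m (F1 \<inter> F2)"
        using fine_covers_partition[of F m ?A ?B] clF disj insert.prems(1)
        by (metis Diff_subset closed_Diff closed_Int closed_cball inf_le1 open_ball)
      have "F \<inter> F2 = F2" "F \<inter> (F1 \<inter> F2) = F1 \<inter> F2"
        using F(3) by blast+
      then have cF: "compact F2" "compact (F1 \<inter> F2)"
        using F(1,2) insert.prems(1) compact_Int_closed closed_Int by metis+
      have "F1 \<subseteq> ball x (2*\<delta>/5)"
        using F(3,4) by auto
      then have small: "dist x a < 2*\<delta>/5" if "a \<in> F1" for a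
        using that by auto
      have dist: "dist a b \<le> 4*\<delta>/5" if "a \<in> F1" "b \<in> F1" for a b
        using small[OF that(1)] small[OF that(2)] dist_triangle3[of a b x] by linarith
      have "diameter F1 \<le> 4*\<delta>/5"
      proof (cases "F1 = {}")
        case False
        then have "(SUP (a, b)\<in>F1 \<times> F1. dist a b) \<le> 4*\<delta>/5"
          by (intro cSUP_least) (use dist in auto)
        with False show ?thesis
          by (simp add: diameter_def)
      qed (use \<delta>(1) in simp)
      also have "\<dots> < \<delta>"
        using \<delta>(1) by simp
      finally have b1: "bounds F1"
        using \<delta>(2)[of F1] F(3) insert.prems(2) by auto
      have "F2 \<subseteq> (\<Union>x\<in>X. ball x (\<delta>/5))"
        using insert.prems(3) F(3,5) by fastforce
      then have b2: "bounds F2"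
        using insert.IH[of F2] cF(1) F(3) insert.prems(2) by auto
      \<comment> \<open>With the intersection removed beforehand, the two pieces become disjoint
        closed sets, and acyclicity of \<open>?Y\<close> in degree q + 1 is the induction
        hypothesis.\<close>
      let ?Y = "top_of_set (V - F1 \<inter> F2)"
      have eq: "subtopology ?Y (topspace ?Y - C) = top_of_set (V - G)" if "C = (V - F1 \<inter> F2) \<inter> G" "F1 \<inter> F2 \<subseteq> G" for C G
      proof -
        have "(V - F1 \<inter> F2) \<inter> (topspace ?Y - C) = V - G"
          using that by auto
        then show ?thesis by (simp add: subtopology_subtopology)
      qed
      have "(V - F1 \<inter> F2) \<inter> F1 \<union> (V - F1 \<inter> F2) \<inter> F2 = (V - F1 \<inter> F2) \<inter> F" "F1 \<inter> F2 \<subseteq> F"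
        using F(3) by blast+
      then have eqF: "subtopology ?Y (topspace ?Y - ((V - F1 \<inter> F2) \<inter> F1 \<union> (V - F1 \<inter> F2) \<inter> F2)) = top_of_set (V - F)"
        by (rule eq)
      have "singular_relboundary q (subtopology ?Y (topspace ?Y - ((V - F1 \<inter> F2) \<inter> F1 \<union> (V - F1 \<inter> F2) \<inter> F2))) {} z"
      proof (rule singular_boundary_complement_Un)
        show "closedin ?Y ((V - F1 \<inter> F2) \<inter> F1)" "closedin ?Y ((V - F1 \<inter> F2) \<inter> F2)"
          using F(1,2) by (auto intro: closedin_closed_Int)
        show "(V - F1 \<inter> F2) \<inter> F1 \<inter> ((V - F1 \<inter> F2) \<inter> F2) = {}"
          by auto
        show "acyclic_in (Suc q) ?Y"
          using Suc.IH[OF cF(2) F(6), of "Suc q"] Suc.prems by simp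
        show "singular_relboundary q (subtopology ?Y (topspace ?Y - (V - F1 \<inter> F2) \<inter> F1)) {} z"
          using b1 eq[OF refl, of F1] by (simp add: bounds_def)
        show "singular_relboundary q (subtopology ?Y (topspace ?Y - (V - F1 \<inter> F2) \<inter> F2)) {} z"
          using b2 eq[OF refl, of F2] by (simp add: bounds_def)
        show "singular_relcycle q (subtopology ?Y (topspace ?Y - ((V - F1 \<inter> F2) \<inter> F1 \<union> (V - F1 \<inter> F2) \<inter> F2))) {} z"
          unfolding eqF by (rule cyc[OF insert.prems(2)])
      qed
      then show ?case
        unfolding eqF bounds_def .
    qed
    have "E \<subseteq> (\<Union>x\<in>E. ball x (\<delta>/5))"
      using \<delta>(1) by auto
    then obtain X where "finite X" "E \<subseteq> (\<Union>x\<in>X. ball x (\<delta>/5))"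
      by (rule compactE_image[OF Suc.prems(1) open_ball])
    then show "singular_relboundary q (top_of_set (V - E)) {} z"
      using main[of X E] Suc.prems(1) by (simp add: bounds_def)
  qed
qed

section \<open>Cubes, charts and complements of closed sets in a manifold\<close>

lemma compact_cube:
  "compact {x :: nat \<Rightarrow> real. (\<forall>i<n. \<bar>x i - a i\<bar> \<le> r) \<and> (\<forall>i\<ge>n. x i = 0)}" (is "compact ?B")
proof -
  let ?I = "\<lambda>i. if i < n then {a i - r..a i + r} else {0}"
  have "compactin (powertop_real UNIV) (Pi\<^sub>E UNIV ?I)"
    by (rule compactin_PiE[THEN iffD2]) (auto simp: compact_Icc)
  moreover have "Pi\<^sub>E UNIV ?I = ?B"
    by (auto simp: PiE_UNIV_domain Pi_iff abs_le_iff split: if_splits) (smt (verit) not_less)+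
  ultimately show ?thesis
    by (simp add: euclidean_product_topology)
qed

lemma openin_Euclidean_cube:
  "openin (Euclidean_space n) {x. (\<forall>i<n. \<bar>x i - a i\<bar> < r) \<and> (\<forall>i\<ge>n. x i = 0)}"
proof -
  have "open (\<Inter>i<n. {x :: nat \<Rightarrow> real. \<bar>x i - a i\<bar> < r})"
    by (intro open_INT ballI open_Collect_less continuous_intros continuous_on_coordinate) simp
  then have "openin (top_of_set (topspace (Euclidean_space n)))
      (topspace (Euclidean_space n) \<inter> (\<Inter>i<n. {x. \<bar>x i - a i\<bar> < r}))"
    by (rule openin_open_Int)
  moreover have "{x. (\<forall>i<n. \<bar>x i - a i\<bar> < r) \<and> (\<forall>i\<ge>n. x i = 0)} =
      topspace (Euclidean_space n) \<inter> (\<Inter>i<n. {x. \<bar>x i - a i\<bar> < r})"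
    by (auto simp: topspace_Euclidean_space)
  ultimately show ?thesis
    by (simp only: Euclidean_space_eq_top_of_set[symmetric])
qed

lemma fconvex_cube: "fconvex {x. (\<forall>i<n. \<bar>x i - a i\<bar> < r) \<and> (\<forall>i\<ge>n. x i = 0)}"
proof -
  have "\<bar>(1 - t) * u + t * v - c\<bar> < r" if "\<bar>u - c\<bar> < r" "\<bar>v - c\<bar> < r" "0 \<le> t" "t \<le> 1" for t u v c :: real
  proof -
    have "\<bar>(1 - t) * u + t * v - c\<bar> = \<bar>(1 - t) * (u - c) + t * (v - c)\<bar>"
      by (simp add: algebra_simps)
    also have "\<dots> \<le> (1 - t) * \<bar>u - c\<bar> + t * \<bar>v - c\<bar>"
      using that by (intro order_trans[OF abs_triangle_ineq]) (simp add: abs_mult)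
    also have "\<dots> < r"
      using that by (intro convex_bound_lt) auto
    finally show ?thesis .
  qed
  then show ?thesis
    by (auto simp: fconvex_def)
qed

text \<open>The open cube V is where homology is computed. The closed cube B around it makes the
  traces of closed sets compact, as the dimension argument requires.\<close>

lemma manifold_chart:
  assumes N: "manifold n N" and Q: "openin N Q" "y \<in> Q"
  obtains V B h g where "openin (Euclidean_space n) V" "fconvex V" "V \<subseteq> B" "compact B"
    "h y \<in> V" "openin N (g ` V)" "g (h y) = y" "compactin N (g ` B)" "g ` B \<subseteq> Q"
    "homeomorphic_maps (subtopology N (g ` B)) (top_of_set B) h g"
proof -
  have "y \<in> topspace N"
    using Q openin_subset by blast
  then obtain U0 V0 where U0: "openin N U0" "y \<in> U0" and V0: "openin (Euclidean_space n) V0"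
    and "subtopology N U0 homeomorphic_space subtopology (Euclidean_space n) V0"
    using N unfolding manifold_def by blast
  then obtain h g where hg: "homeomorphic_maps (subtopology N U0) (subtopology (Euclidean_space n) V0) h g"
    by (auto simp: homeomorphic_space_def)
  have V0R: "V0 \<subseteq> topspace (Euclidean_space n)"
    using V0 openin_subset by blast
  have top: "subtopology (Euclidean_space n) V0 = top_of_set V0"
    by (subst Euclidean_space_eq_top_of_set) (simp add: subtopology_subtopology Int_absorb1 V0R)
  have U0N: "U0 \<subseteq> topspace N"
    using U0(1) openin_subset by blast
  have ch: "continuous_map (subtopology N U0) (top_of_set V0) h"
    and cg: "continuous_map (top_of_set V0) (subtopology N U0) g"
    and gh: "\<And>x. x \<in> U0 \<Longrightarrow> g (h x) = x" and hgi: "\<And>x. x \<in> V0 \<Longrightarrow> h (g x) = x"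
    using hg U0N unfolding homeomorphic_maps_def top by auto
  have gV0: "g x \<in> U0" if "x \<in> V0" for x
    using cg that U0N by (auto simp: continuous_map_def Pi_iff)
  have hU0: "h x \<in> V0" if "x \<in> U0" for x
    using ch that U0N by (auto simp: continuous_map_def Pi_iff)
  have img: "g ` S = {x \<in> U0. h x \<in> S}" if "S \<subseteq> V0" for S
    using that gV0 hgi gh by force
  have "openin (top_of_set V0) {x \<in> V0. g x \<in> U0 \<inter> Q}"
  proof -
    have "openin (subtopology N U0) (U0 \<inter> Q)"
      using U0(1) Q(1) by (simp add: openin_subtopology_Int2)
    from openin_continuous_map_preimage[OF cg this] show ?thesis by simp
  qed
  then have "openin (Euclidean_space n) {x \<in> V0. g x \<in> U0 \<inter> Q}"
    using openin_trans_full[OF _ V0] by (simp only: top)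
  moreover have "h y \<in> {x \<in> V0. g x \<in> U0 \<inter> Q}"
    using U0(2) Q(2) hU0 gh by simp
  ultimately obtain r where r: "r > 0" "\<And>x. x \<in> topspace (Euclidean_space n) \<Longrightarrow>
      (\<And>i. i < n \<Longrightarrow> \<bar>x i - h y i\<bar> < r) \<Longrightarrow> x \<in> {x \<in> V0. g x \<in> U0 \<inter> Q}"
    by (rule cube_in_open) blast
  \<comment> \<open>Halving r keeps the closed cube, too, inside the preimage of Q.\<close>
  define V where "V = {x. (\<forall>i<n. \<bar>x i - h y i\<bar> < r/2) \<and> (\<forall>i\<ge>n. x i = 0)}"
  define B where "B = {x. (\<forall>i<n. \<bar>x i - h y i\<bar> \<le> r/2) \<and> (\<forall>i\<ge>n. x i = 0)}"
  have VB: "V \<subseteq> B"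
    by (auto simp: V_def B_def less_imp_le)
  have B: "x \<in> V0" "g x \<in> Q" if "x \<in> B" for x
  proof -
    have "\<bar>x i - h y i\<bar> < r" if "i < n" for i
    proof -
      have "\<bar>x i - h y i\<bar> \<le> r/2"
        using \<open>x \<in> B\<close> that by (simp add: B_def)
      then show ?thesis
        using r(1) by linarith
    qed
    moreover have "x \<in> topspace (Euclidean_space n)"
      using that by (auto simp: B_def topspace_Euclidean_space)
    ultimately show "x \<in> V0" "g x \<in> Q"
      using r(2) by auto
  qed
  have cB: "compact B"
    unfolding B_def by (rule compact_cube)
  show thesis
  proof
    show V: "openin (Euclidean_space n) V" "fconvex V"
      unfolding V_def by (rule openin_Euclidean_cube fconvex_cube)+
    show "V \<subseteq> B" "compact B" by fact+
    show "h y \<in> V"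
      using hU0[OF U0(2)] V0R r(1) by (auto simp: V_def topspace_Euclidean_space)
    have "V \<subseteq> V0"
      using VB B by auto
    moreover have "openin (top_of_set V0) V"
      using openin_subtopology_Int2[OF V(1), of V0] calculation by (simp add: top Int_absorb1)
    then have "openin (subtopology N U0) {x \<in> topspace (subtopology N U0). h x \<in> V}"
      by (rule openin_continuous_map_preimage[OF ch])
    ultimately show "openin N (g ` V)"
      using U0N openin_trans_full[OF _ U0(1)] by (simp add: img Int_absorb1)
    show "g (h y) = y"
      by (rule gh[OF U0(2)])
    have "B \<subseteq> V0"
      using B by blast
    then have "compactin (top_of_set V0) B"
      using cB by (simp add: compactin_subtopology)
    then show "compactin N (g ` B)"
      using image_compactin[OF _ cg] by (simp add: compactin_subtopology)
    show "g ` B \<subseteq> Q"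
      using B by blast
    have gBU: "g ` B \<subseteq> U0"
      using B gV0 by blast
    show "homeomorphic_maps (subtopology N (g ` B)) (top_of_set B) h g"
      unfolding homeomorphic_maps_def
    proof (intro conjI ballI)
      have "continuous_map (subtopology N (g ` B)) (top_of_set V0) h"
        by (rule continuous_map_from_subtopology_mono[OF ch gBU])
      then show "continuous_map (subtopology N (g ` B)) (top_of_set B) h"
        using B(1) hgi by (auto simp: continuous_map_in_subtopology)
      have "continuous_map (top_of_set B) (subtopology N U0) g"
        by (rule continuous_map_from_subtopology_mono[OF cg \<open>B \<subseteq> V0\<close>])
      then show "continuous_map (top_of_set B) (subtopology N (g ` B)) g"
        by (auto simp: continuous_map_in_subtopology)
    qed (use B hgi in auto)
  qed
qed

lemma manifold_locally_compact:
  assumes "manifold n N"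
  shows "locally_compact_space N"
  unfolding locally_compact_space_def
proof (intro ballI)
  fix y assume y: "y \<in> topspace N"
  obtain V B :: "(nat \<Rightarrow> real) set" and h g
    where "V \<subseteq> B" "h y \<in> V" "openin N (g ` V)" "g (h y) = y" "compactin N (g ` B)"
    by (rule manifold_chart[OF assms openin_topspace y])
  then show "\<exists>U K. openin N U \<and> compactin N K \<and> y \<in> U \<and> U \<subseteq> K"
    by (intro exI[of _ "g ` V"] exI[of _ "g ` B"]) (auto intro: rev_image_eqI)
qed

text \<open>A manifold is locally compact and Hausdorff, hence a k-space whose compact sets are
  closed. Over such a base compact preimages make a continuous map proper in the sense of
  \<open>proper_map\<close>.\<close>

lemma compact_preimages_imp_closed_map:
  assumes "manifold n N" "continuous_map X N f" "compact_preimages X N f"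
  shows "closed_map X N f"
proof -
  have "kc_space N" "k_space N"
    using assms(1) manifold_locally_compact[OF assms(1)]
    by (auto simp: manifold_def Hausdorff_imp_kc_space locally_compact_imp_k_space)
  then have "proper_map X N f"
    using assms(2,3) by (intro compact_imp_proper_map)
      (auto simp: compact_preimages_def continuous_map_def)
  then show ?thesis
    by (simp add: proper_map_def)
qed

lemma closedin_branch_values:
  assumes "manifold n N" "branched_cover M N f" "compact_preimages M N f"
  shows "closedin N (f ` branch_set M N f)"
proof -
  have cont: "continuous_map M N f"
    using assms(2) by (simp add: branched_cover_def)
  have "openin M (topspace M - branch_set M N f)"
  proof (subst openin_subopen, intro ballI)
    fix x assume "x \<in> topspace M - branch_set M N f"
    then obtain U where U: "openin M U" "x \<in> U" "openin N (f ` U)"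
      "homeomorphic_map (subtopology M U) (subtopology N (f ` U)) f"
      by (auto simp: branch_set_def)
    moreover have "U \<subseteq> topspace M - branch_set M N f"
      using U openin_subset by (fastforce simp: branch_set_def)
    ultimately show "\<exists>T. openin M T \<and> x \<in> T \<and> T \<subseteq> topspace M - branch_set M N f"
      by blast
  qed
  then have "closedin M (branch_set M N f)"
    by (auto simp: closedin_def branch_set_def)
  then show ?thesis
    using compact_preimages_imp_closed_map[OF assms(1) cont assms(3)] by (simp add: closed_map_def)
qed

lemma acyclic_in_homeomorphic:
  assumes "X homeomorphic_space Y" "acyclic_in p Y"
  shows "acyclic_in p X"
  using homeomorphic_space_imp_isomorphic_homology_groups[OF assms(1), of "int p"] assms(2)
    isomorphic_group_triviality[OF _ group_relative_homology_group group_relative_homology_group]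
  unfolding acyclic_in_iff_trivial_group by blast

text \<open>This is the passage of covering dimension from L to its closed subset
  \<open>K \<inter> L\<close>, with mesh measured in the chart. Open extensions of preimages of
  small balls, together with \<open>L - K\<close>, cover L. A refinement of small order is pulled
  back along g, and what lies in \<open>L - K\<close> pulls back to nothing because g takes B into
  K.\<close>

lemma fine_covers_chart_image:
  assumes hg: "homeomorphic_maps (subtopology N K) (top_of_set B) h g"
    and K: "K \<subseteq> topspace N" "closedin N K" and B: "compact B"
    and L: "K \<inter> E \<subseteq> L" "L \<subseteq> topspace N"
    and dim: "covering_dim_le (subtopology N L) (int m - 1)"
  shows "fine_covers m {x \<in> B. g x \<in> E}"
  unfolding fine_covers_def
proof (intro allI impI)
  fix \<epsilon> :: real assume "\<epsilon> > 0"
  let ?F = "{x \<in> B. g x \<in> E}"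
  have ch: "continuous_map (subtopology N K) (top_of_set B) h"
    and cg: "continuous_map (top_of_set B) (subtopology N K) g"
    and gh: "\<And>x. x \<in> K \<Longrightarrow> g (h x) = x" and hg: "\<And>x. x \<in> B \<Longrightarrow> h (g x) = x"
    using hg K(1) unfolding homeomorphic_maps_def by auto
  have gB: "g x \<in> K" if "x \<in> B" for x
    using cg that by (auto simp: continuous_map_def Pi_iff)
  have hK: "h x \<in> B" if "x \<in> K" for x
    using ch that K(1) by (auto simp: continuous_map_def Pi_iff)
  obtain X where X: "finite X" "B \<subseteq> (\<Union>x\<in>X. ball x (\<epsilon>/2))"
  proof -
    have "B \<subseteq> (\<Union>x\<in>B. ball x (\<epsilon>/2))"
      using \<open>\<epsilon> > 0\<close> by auto
    then show thesis
      using that by (rule compactE_image[OF B open_ball])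
  qed
  have "\<exists>T. openin N T \<and> {p \<in> K. h p \<in> ball x (\<epsilon>/2)} = T \<inter> K" for x
  proof -
    have "openin (top_of_set B) (B \<inter> ball x (\<epsilon>/2))"
      by (rule openin_open_Int) simp
    from openin_continuous_map_preimage[OF ch this]
    have "openin (subtopology N K) {p \<in> K. h p \<in> ball x (\<epsilon>/2)}"
      using K(1) hK by (simp add: Int_absorb1 inf.absorb2 cong: conj_cong)
    then show ?thesis
      by (simp add: openin_subtopology)
  qed
  then obtain T where T: "\<And>x. openin N (T x)" "\<And>x. {p \<in> K. h p \<in> ball x (\<epsilon>/2)} = T x \<inter> K"
    by metis
  define \<U> where "\<U> = insert (L - K) ((\<lambda>x. T x \<inter> L) ` X)"
  have "finite \<U>"
    using X(1) by (simp add: \<U>_def)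
  moreover have "\<forall>U \<in> \<U>. openin (subtopology N L) U"
  proof -
    have "openin (subtopology N L) ((topspace N - K) \<inter> L)"
      using K(2) by (intro openin_subtopology_Int) auto
    moreover have "(topspace N - K) \<inter> L = L - K"
      using L(2) by blast
    ultimately show ?thesis
      using T(1) by (auto simp: \<U>_def intro: openin_subtopology_Int)
  qed
  moreover have "\<Union>\<U> = topspace (subtopology N L)"
  proof -
    have "p \<in> \<Union>\<U>" if "p \<in> L" for p
    proof (cases "p \<in> K")
      case True
      then obtain x where "x \<in> X" "h p \<in> ball x (\<epsilon>/2)"
        using X(2) hK by blast
      then have "p \<in> T x \<inter> L" "x \<in> X"
        using T(2)[of x] True that by blast+
      then show ?thesis
        by (auto simp: \<U>_def)
    qed (use that in \<open>auto simp: \<U>_def\<close>)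
    then show ?thesis
      using L(2) by (auto simp: \<U>_def)
  qed
  ultimately have "finite \<U> \<and> (\<forall>U \<in> \<U>. openin (subtopology N L) U) \<and> \<Union>\<U> = topspace (subtopology N L)"
    by (intro conjI)
  from dim[unfolded covering_dim_le_def, THEN conjunct2, THEN spec[of _ \<U>], THEN mp, OF this]
  obtain \<V> where *: "finite \<V> \<and> (\<forall>V \<in> \<V>. openin (subtopology N L) V) \<and>
    \<Union>\<V> = topspace (subtopology N L) \<and> (\<forall>V \<in> \<V>. \<exists>U \<in> \<U>. V \<subseteq> U) \<and>
    (\<forall>x \<in> topspace (subtopology N L). int (card {V \<in> \<V>. x \<in> V}) \<le> int m - 1 + 1)"
    by (elim exE)
  have \<V>: "finite \<V>" "\<And>V. V \<in> \<V> \<Longrightarrow> openin (subtopology N L) V"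
    "\<Union>\<V> = topspace (subtopology N L)" "\<And>V. V \<in> \<V> \<Longrightarrow> \<exists>U \<in> \<U>. V \<subseteq> U"
    using * by blast+
  have card: "card {V \<in> \<V>. x \<in> V} \<le> m" if "x \<in> topspace (subtopology N L)" for x
  proof -
    have "int (card {V \<in> \<V>. x \<in> V}) \<le> int m - 1 + 1"
      using * that by blast
    then show ?thesis by linarith
  qed
  let ?p = "\<lambda>V. {x \<in> ?F. g x \<in> V}"
  have gL: "g x \<in> L" if "x \<in> ?F" for x
    using that gB L(1) by auto
  show "\<exists>\<W>. finite \<W> \<and>
      (\<forall>U \<in> \<W>. openin (top_of_set ?F) U \<and> (\<forall>x \<in> U. \<forall>y \<in> U. dist x y < \<epsilon>)) \<and>
      \<Union>\<W> = ?F \<and> (\<forall>x \<in> ?F. card {U \<in> \<W>. x \<in> U} \<le> m)"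
  proof (intro exI[of _ "?p ` \<V>"] conjI ballI)
    show "finite (?p ` \<V>)"
      using \<V>(1) by simp
    show "\<Union>(?p ` \<V>) = ?F"
    proof -
      have "\<Union>\<V> = L"
        using \<V>(3) L(2) by auto
      then show ?thesis
        using gL by blast
    qed
    fix P assume "P \<in> ?p ` \<V>"
    then obtain V where V: "V \<in> \<V>" "P = ?p V"
      by blast
    obtain S where S: "openin N S" "V = S \<inter> L"
      using \<V>(2)[OF V(1)] by (auto simp: openin_subtopology)
    have "continuous_map (top_of_set ?F) N g"
      using continuous_map_from_subtopology_mono[OF continuous_map_into_fulltopology[OF cg], of ?F] by auto
    from openin_continuous_map_preimage[OF this S(1)]
    have "openin (top_of_set ?F) {x \<in> ?F. g x \<in> S}"
      by simp
    moreover have "{x \<in> ?F. g x \<in> S} = P"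
      using V(2) S(2) gL by blast
    ultimately show "openin (top_of_set ?F) P"
      by simp
    fix u v assume uv: "u \<in> P" "v \<in> P"
    obtain U where U: "U \<in> \<U>" "V \<subseteq> U"
      using \<V>(4)[OF V(1)] by blast
    have u: "u \<in> B" "g u \<in> U" "g u \<in> K" and v: "v \<in> B" "g v \<in> U" "g v \<in> K"
      using uv V(2) U(2) gB by auto
    then obtain x where "U = T x \<inter> L"
      using U(1) by (auto simp: \<U>_def)
    then have "g u \<in> T x \<inter> K" "g v \<in> T x \<inter> K"
      using u v by blast+
    then have "h (g u) \<in> ball x (\<epsilon>/2)" "h (g v) \<in> ball x (\<epsilon>/2)"
      using T(2)[of x] by blast+
    then have "dist x u < \<epsilon>/2" "dist x v < \<epsilon>/2"
      using hg u v by simp_all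
    then show "dist u v < \<epsilon>"
      using dist_triangle3[of u v x] by linarith
  next
    fix x assume x: "x \<in> ?F"
    have "{U \<in> ?p ` \<V>. x \<in> U} = ?p ` {V \<in> \<V>. g x \<in> V}"
      using x by auto
    then have "card {U \<in> ?p ` \<V>. x \<in> U} \<le> card {V \<in> \<V>. g x \<in> V}"
      using \<V>(1) by (simp add: card_image_le)
    moreover have "g x \<in> topspace (subtopology N L)"
      using gL[OF x] L(2) by auto
    ultimately show "card {U \<in> ?p ` \<V>. x \<in> U} \<le> m"
      using card by (meson order_trans)
  qed
qed

proposition manifold_complement_locally_acyclic:
  assumes N: "manifold n N" and E: "closedin N E" and dim: "local_dim_le N E y (int n - 3)"
    and Q: "openin N Q" "y \<in> Q"
  obtains W where "openin N W" "y \<in> W" "W \<subseteq> Q" "acyclic_in 1 (subtopology N (W - E))"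
    "locally_path_connected_space (subtopology N (W - E))"
proof -
  obtain O1 U where O1: "openin N O1" "y \<in> O1" "O1 \<subseteq> U" "U \<subseteq> topspace N"
    and cov: "covering_dim_le (subtopology N (U \<inter> E)) (int n - 3)"
    using dim by (auto simp: local_dim_le_def)
  \<comment> \<open>A dimension bound is at least -1, so \<open>n - 2\<close> below is not
    truncated.\<close>
  have n2: "2 \<le> n"
    using cov by (simp add: covering_dim_le_def)
  obtain V B h g where V: "openin (Euclidean_space n) V" "fconvex V" "V \<subseteq> B" "compact B"
    and y: "h y \<in> V" "openin N (g ` V)" "g (h y) = y" and gB: "compactin N (g ` B)" "g ` B \<subseteq> Q \<inter> O1"
    and hg: "homeomorphic_maps (subtopology N (g ` B)) (top_of_set B) h g"
    by (rule manifold_chart[OF N, of "Q \<inter> O1" y]) (use Q O1 in auto)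
  have "Hausdorff_space N"
    using N by (simp add: manifold_def)
  then have clgB: "closedin N (g ` B)" "g ` B \<subseteq> topspace N"
    using gB(1) compactin_imp_closedin compactin_subset_topspace by blast+
  let ?F = "{x \<in> B. g x \<in> E}"
  have ch: "continuous_map (subtopology N (g ` B)) (top_of_set B) h"
    and cg: "continuous_map (top_of_set B) (subtopology N (g ` B)) g"
    and hgi: "\<And>x. x \<in> B \<Longrightarrow> h (g x) = x"
    using hg unfolding homeomorphic_maps_def by auto
  have fine: "fine_covers (n - 2) ?F"
  proof (rule fine_covers_chart_image[OF hg clgB(2,1) V(4), of E "U \<inter> E"])
    show "covering_dim_le (subtopology N (U \<inter> E)) (int (n - 2) - 1)"
      using cov n2 by (simp add: of_nat_diff)
  qed (use gB O1 in auto)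
  have "closedin (top_of_set B) {x \<in> topspace (top_of_set B). g x \<in> E}"
    by (rule closedin_continuous_map_preimage[OF continuous_map_into_fulltopology[OF cg] E])
  then have "closedin (top_of_set B) ?F" by simp
  then have cF: "compact ?F"
    using V(4) closedin_compact by blast
  \<comment> \<open>With q = 1 and m = n - 2 the sum q + m is n - 1, the largest value
    allowed.\<close>
  have acyc: "acyclic_in 1 (top_of_set (V - ?F))"
    by (rule acyclic_in_fconvex_complement[OF V(1,2) cF fine]) (use n2 in auto)
  have homeo: "subtopology N (g ` V - E) homeomorphic_space top_of_set (V - ?F)"
    unfolding homeomorphic_space_def homeomorphic_maps_def
  proof (intro exI[of _ h] exI[of _ g] conjI ballI)
    have "g ` V - E \<subseteq> g ` B" using V(3) by blast
    from continuous_map_from_subtopology_mono[OF continuous_map_into_fulltopology[OF ch] this]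
    show "continuous_map (subtopology N (g ` V - E)) (top_of_set (V - ?F)) h"
      using V(3) hgi by (auto simp: continuous_map_in_subtopology)
    have "V - ?F \<subseteq> B" using V(3) by blast
    from continuous_map_from_subtopology_mono[OF continuous_map_into_fulltopology[OF cg] this]
    show "continuous_map (top_of_set (V - ?F)) (subtopology N (g ` V - E)) g"
      using V(3) by (auto simp: continuous_map_in_subtopology)
  qed (use V(3) hgi in auto)
  have "openin (Euclidean_space n) (V - ?F)"
  proof -
    have "openin (Euclidean_space n) (topspace (Euclidean_space n) \<inter> - ?F)"
      using compact_imp_closed[OF cF] by (subst (1) Euclidean_space_eq_top_of_set) (simp only: openin_open_Int open_Compl)
    from openin_Int[OF V(1) this] show ?thesis
      using openin_subset[OF V(1)] by (simp add: Diff_eq inf.absorb1 flip: inf.assoc)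
  qed
  then have "locally_path_connected_space (subtopology (Euclidean_space n) (V - ?F))"
    using locally_path_connected_space_open_subset locally_path_connected_Euclidean_space by blast
  then have lpc: "locally_path_connected_space (top_of_set (V - ?F))"
    using openin_subset[OF V(1)]
    by (subst (asm) Euclidean_space_eq_top_of_set) (simp add: subtopology_subtopology inf.absorb2 Diff_subset[THEN subset_trans])
  show thesis
  proof (rule that[of "g ` V"])
    show "openin N (g ` V)" by fact
    show "y \<in> g ` V"
      using y(1,3) by (metis image_eqI)
    show "g ` V \<subseteq> Q"
      using gB(2) V(3) by blast
    show "acyclic_in 1 (subtopology N (g ` V - E))"
      by (rule acyclic_in_homeomorphic[OF homeo acyc])
    show "locally_path_connected_space (subtopology N (g ` V - E))"
      using homeomorphic_locally_path_connected_space[OF homeo] lpc by blast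
  qed
qed

section \<open>Path classes and the universal cover\<close>

lemma path_homotopicD:
  assumes "path_homotopic X p q"
  shows "pathin X p" "pathin X q" "q 0 = p 0" "q 1 = p 1"
  using homotopic_with_imp_continuous_maps[OF assms[unfolded path_homotopic_def]]
    homotopic_with_imp_property[OF assms[unfolded path_homotopic_def]]
  by (auto simp: pathin_def)

lemma path_homotopic_refl: "pathin X p \<Longrightarrow> path_homotopic X p p"
  by (simp add: path_homotopic_def pathin_def)

lemma path_homotopic_sym:
  assumes "path_homotopic X p q"
  shows "path_homotopic X q p"
  using homotopic_with_symD[OF assms[unfolded path_homotopic_def]] path_homotopicD(3,4)[OF assms]
  by (simp add: path_homotopic_def)

lemma path_homotopic_trans:
  assumes "path_homotopic X p q" "path_homotopic X q r"
  shows "path_homotopic X p r"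
proof -
  have "homotopic_with (\<lambda>r. r 0 = p 0 \<and> r 1 = p 1) (top_of_set {0..1}) X q r"
    using assms(2) path_homotopicD(3,4)[OF assms(1)] by (simp add: path_homotopic_def)
  with assms(1) show ?thesis
    unfolding path_homotopic_def by (rule homotopic_with_trans)
qed

lemma path_homotopic_map:
  assumes "path_homotopic X p q" "continuous_map X Y F"
  shows "path_homotopic Y (F \<circ> p) (F \<circ> q)"
  unfolding path_homotopic_def
  by (rule homotopic_with_compose_continuous_map_left[OF assms(1)[unfolded path_homotopic_def] assms(2)]) simp

lemma path_homotopic_cong:
  assumes "path_homotopic X p q" "\<And>t. t \<in> {0..1} \<Longrightarrow> p' t = p t" "\<And>t. t \<in> {0..1} \<Longrightarrow> q' t = q t"
  shows "path_homotopic X p' q'"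
proof -
  have "homotopic_with (\<lambda>r. r 0 = p' 0 \<and> r 1 = p' 1) (top_of_set {0..1}) X p q"
    using assms(1) assms(2)[of 0] assms(2)[of 1] by (simp add: path_homotopic_def)
  then show ?thesis
    unfolding path_homotopic_def by (rule homotopic_with_eq) (use assms(2,3) in auto)
qed

lemma pathin_cong:
  assumes "pathin X p" "\<And>t. t \<in> {0..1} \<Longrightarrow> p' t = p t"
  shows "pathin X p'"
  using assms unfolding pathin_def by (metis continuous_map_eq topspace_euclidean_subtopology)

lemma pathin_reparam:
  assumes F: "pathin X F" and a: "continuous_on {0..1} a" "a \<in> {0..1} \<rightarrow> {0..1}"
    and p: "\<And>s. s \<in> {0..1} \<Longrightarrow> p s = F (a s)"
  shows "pathin X p"
proof -
  have "continuous_map (top_of_set {0..1}) X (F \<circ> a)"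
    using F a by (intro continuous_map_compose[of _ "top_of_set {0..1}"]) (auto simp: pathin_def)
  then show ?thesis
    unfolding pathin_def by (rule pathin_cong[of X "F \<circ> a", unfolded pathin_def]) (simp add: p)
qed

text \<open>Both paths are images under \<open>F\<close> of paths in an interval, where homotopies are linear.\<close>

lemma path_homotopic_reparam:
  assumes F: "pathin X F" and a: "continuous_on {0..1} a" "a \<in> {0..1} \<rightarrow> {0..1}"
    and b: "continuous_on {0..1} b" "b \<in> {0..1} \<rightarrow> {0..1}" and ends: "a 0 = b 0" "a 1 = b 1"
    and p: "\<And>s. s \<in> {0..1} \<Longrightarrow> p s = F (a s)" and q: "\<And>s. s \<in> {0..1} \<Longrightarrow> q s = F (b s)"
  shows "path_homotopic X p q"
proof -
  have "path_homotopic (top_of_set {0..1}) a b"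
    unfolding path_homotopic_def homotopic_with_def
  proof (intro exI conjI ballI)
    let ?h = "\<lambda>z. (1 - fst z) * a (snd z) + fst z * b (snd z)"
    have "continuous_on ({0..1} \<times> {0..1}) ?h"
      by (intro continuous_intros continuous_on_compose2[OF a(1)] continuous_on_compose2[OF b(1)]) auto
    moreover have "?h z \<in> {0..1}" if "z \<in> {0..1} \<times> {0..1}" for z
    proof -
      have ab: "a (snd z) \<in> {0..1}" "b (snd z) \<in> {0..1}" "fst z \<in> {0..1}"
        using that a(2) b(2) by auto
      then show ?thesis
        using convex_bound_le[of "a (snd z)" 1 "b (snd z)" "1 - fst z" "fst z"] by auto
    qed
    ultimately show "continuous_map (prod_topology (top_of_set {0..1}) (top_of_set {0..1})) (top_of_set {0..1}) ?h"
      by auto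
  qed (use ends in \<open>auto simp: algebra_simps\<close>)
  then have "path_homotopic X (F \<circ> a) (F \<circ> b)"
    by (rule path_homotopic_map[OF _ F[unfolded pathin_def]])
  then show ?thesis
    by (rule path_homotopic_cong) (auto simp: p q)
qed

text \<open>The parameter space X is the interval when paths are joined and the square when
  homotopies are joined.\<close>

lemma continuous_map_concat:
  fixes X :: "'a topology" and \<sigma> :: "'a \<Rightarrow> real"
  assumes "continuous_map X (top_of_set {0..1}) \<sigma>"
    and u: "continuous_map (prod_topology X (top_of_set {0..1})) Y u"
    and v: "continuous_map (prod_topology X (top_of_set {0..1})) Y v"
    and uv: "\<And>x. x \<in> topspace X \<Longrightarrow> u (x, 1) = v (x, 0)"
  shows "continuous_map X Y (\<lambda>x. if \<sigma> x \<le> 1/2 then u (x, 2 * \<sigma> x) else v (x, 2 * \<sigma> x - 1))"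
proof (rule continuous_map_cases_le)
  show \<sigma>: "continuous_map X euclideanreal \<sigma>"
    using assms(1) continuous_map_into_fulltopology by blast
  have mem: "\<sigma> x \<in> {0..1}" if "x \<in> topspace X" for x
    using assms(1) that by (auto simp: continuous_map_in_subtopology Pi_iff)
  show "continuous_map X euclideanreal (\<lambda>x. 1/2)" by simp
  let ?L = "subtopology X {x \<in> topspace X. \<sigma> x \<le> 1/2}" and ?R = "subtopology X {x \<in> topspace X. 1/2 \<le> \<sigma> x}"
  have "continuous_map ?L (prod_topology X (top_of_set {0..1})) (\<lambda>x. (x, 2 * \<sigma> x))"
    using mem \<sigma>
    by (auto simp: continuous_map_paired continuous_map_in_subtopology
        intro!: continuous_map_real_mult_left continuous_map_from_subtopology)
  from continuous_map_compose[OF this u] show "continuous_map ?L Y (\<lambda>x. u (x, 2 * \<sigma> x))"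
    by (simp add: o_def)
  have "continuous_map ?R (prod_topology X (top_of_set {0..1})) (\<lambda>x. (x, 2 * \<sigma> x - 1))"
    using mem \<sigma>
    by (auto simp: continuous_map_paired continuous_map_in_subtopology
        intro!: continuous_map_diff continuous_map_real_mult_left continuous_map_from_subtopology)
  from continuous_map_compose[OF this v] show "continuous_map ?R Y (\<lambda>x. v (x, 2 * \<sigma> x - 1))"
    by (simp add: o_def)
  show "u (x, 2 * \<sigma> x) = v (x, 2 * \<sigma> x - 1)" if "x \<in> topspace X" "\<sigma> x = 1/2" for x
  proof -
    have "2 * \<sigma> x = 1" using that(2) by simp
    then show ?thesis
      using uv[OF that(1)] by (simp only: diff_self)
  qed
qed

lemma pathin_join:
  assumes "pathin X p" "pathin X q" "p 1 = q 0"
  shows "pathin X (path_join p q)"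
proof -
  have "continuous_map (prod_topology (top_of_set {0..1}) (top_of_set {0..1::real})) X (p \<circ> snd)"
    "continuous_map (prod_topology (top_of_set {0..1}) (top_of_set {0..1::real})) X (q \<circ> snd)"
    by (rule continuous_map_compose[OF continuous_map_snd assms(1)[unfolded pathin_def]]
        continuous_map_compose[OF continuous_map_snd assms(2)[unfolded pathin_def]])+
  from continuous_map_concat[OF _ this, of "\<lambda>x. x"] show ?thesis
    using assms(3) by (simp add: pathin_def path_join_def o_def cong: if_cong)
qed

lemma path_join_ends [simp]: "path_join p q 0 = p 0" "path_join p q 1 = q 1"
  by (simp_all add: path_join_def)

lemma path_homotopic_join:
  assumes p: "path_homotopic X p p'" and q: "path_homotopic X q q'" and pq: "p 1 = q 0"
  shows "path_homotopic X (path_join p q) (path_join p' q')"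
proof -
  let ?I = "top_of_set {0..1::real}"
  obtain h where h: "continuous_map (prod_topology ?I ?I) X h" "\<And>s. h (0, s) = p s" "\<And>s. h (1, s) = p' s"
    "\<And>t. t \<in> {0..1} \<Longrightarrow> h (t, 0) = p 0" "\<And>t. t \<in> {0..1} \<Longrightarrow> h (t, 1) = p 1"
    using p unfolding path_homotopic_def homotopic_with_def by metis
  obtain k where k: "continuous_map (prod_topology ?I ?I) X k" "\<And>s. k (0, s) = q s" "\<And>s. k (1, s) = q' s"
    "\<And>t. t \<in> {0..1} \<Longrightarrow> k (t, 0) = q 0" "\<And>t. t \<in> {0..1} \<Longrightarrow> k (t, 1) = q 1"
    using q unfolding path_homotopic_def homotopic_with_def by metis
  let ?h = "\<lambda>z. if snd z \<le> 1/2 then h (fst z, 2 * snd z) else k (fst z, 2 * snd z - 1)"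
  have "continuous_map (prod_topology ?I ?I) X ?h"
  proof -
    let ?u = "\<lambda>w. (fst (fst w), snd w)"
    have "continuous_map (prod_topology (prod_topology ?I ?I) ?I) (prod_topology ?I ?I) ?u"
      unfolding continuous_map_paired
      by (intro conjI continuous_map_snd continuous_map_compose[OF continuous_map_fst continuous_map_fst, unfolded o_def])
    from continuous_map_compose[OF this h(1)] continuous_map_compose[OF this k(1)]
    have "continuous_map (prod_topology (prod_topology ?I ?I) ?I) X (\<lambda>w. h (fst (fst w), snd w))"
      "continuous_map (prod_topology (prod_topology ?I ?I) ?I) X (\<lambda>w. k (fst (fst w), snd w))"
      by (simp_all add: o_def)
    from continuous_map_concat[OF continuous_map_snd this] show ?thesis
      using h(5) k(4) pq by (simp add: mem_Times_iff cong: if_cong)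
  qed
  then show ?thesis
    unfolding path_homotopic_def homotopic_with_def
    by (intro exI[of _ ?h]) (use h k in \<open>auto simp: path_join_def\<close>)
qed

lemma path_homotopic_assoc:
  assumes "pathin X p" "pathin X q" "pathin X r" "p 1 = q 0" "q 1 = r 0"
  shows "path_homotopic X (path_join (path_join p q) r) (path_join p (path_join q r))"
proof (rule path_homotopic_reparam)
  show "pathin X (path_join (path_join p q) r)"
    using assms by (intro pathin_join) auto
  show "continuous_on {0..1} (\<lambda>s::real. s)" "(\<lambda>s::real. s) \<in> {0..1} \<rightarrow> {0..1}" by auto
  \<comment> \<open>This takes the break points 1/2 and 3/4 of the right bracketing to the break
    points 1/4 and 1/2 of the left one. As a maximum of minima it is visibly continuous.\<close>
  let ?b = "\<lambda>s::real. if s \<le> 1/2 then s/2 else if s \<le> 3/4 then s - 1/4 else 2 * s - 1"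
  have eq: "?b s = max (min (s/2) (1/4)) (max (s - 1/4) (2 * s - 1))" for s :: real
    by (auto simp: max_def min_def)
  show "continuous_on {0..1} ?b"
    unfolding eq by (intro continuous_intros) auto
  show "?b \<in> {0..1} \<rightarrow> {0..1}"
    by auto
  show "path_join p (path_join q r) s = path_join (path_join p q) r (?b s)" if "s \<in> {0..1}" for s
    using that by (auto simp: path_join_def algebra_simps intro!: arg_cong[where f = q])
qed auto

lemma path_homotopic_const_join:
  assumes "pathin X p"
  shows "path_homotopic X (path_join (\<lambda>_. p 0) p) p"
proof (rule path_homotopic_reparam[OF assms])
  show "continuous_on {0..1} (\<lambda>s::real. max 0 (2 * s - 1))" "continuous_on {0..1} (\<lambda>s::real. s)"
    by (intro continuous_intros)+
qed (auto simp: path_join_def max_def intro!: arg_cong[where f = p])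

lemma path_homotopic_join_const:
  assumes "pathin X p"
  shows "path_homotopic X (path_join p (\<lambda>_. p 1)) p"
proof (rule path_homotopic_reparam[OF assms])
  show "continuous_on {0..1} (\<lambda>s::real. min 1 (2 * s))" "continuous_on {0..1} (\<lambda>s::real. s)"
    by (intro continuous_intros)+
qed (auto simp: path_join_def min_def intro!: arg_cong[where f = p])

definition path_rev :: "(real \<Rightarrow> 'a) \<Rightarrow> real \<Rightarrow> 'a" where
  "path_rev p = (\<lambda>t. p (1 - t))"

lemma path_rev_ends [simp]: "path_rev p 0 = p 1" "path_rev p 1 = p 0"
  by (simp_all add: path_rev_def)

lemma path_rev_rev [simp]: "path_rev (path_rev p) = p"
  by (simp add: path_rev_def)

lemma pathin_rev [intro]: "pathin X p \<Longrightarrow> pathin X (path_rev p)"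
  by (rule pathin_reparam[of X p "\<lambda>s. 1 - s"]) (auto intro!: continuous_intros simp: path_rev_def)

lemma path_homotopic_join_rev:
  assumes "pathin X p"
  shows "path_homotopic X (path_join p (path_rev p)) (\<lambda>_. p 0)"
proof (rule path_homotopic_reparam[OF assms])
  show "continuous_on {0..1} (\<lambda>s::real. min (2 * s) (2 - 2 * s))" "continuous_on {0..1} (\<lambda>s::real. 0)"
    by (intro continuous_intros)+
qed (auto simp: path_join_def path_rev_def min_def intro!: arg_cong[where f = p])

text \<open>The segments from 0 to a varying t trace the lift of p to the universal cover.\<close>

definition path_seg :: "(real \<Rightarrow> 'a) \<Rightarrow> real \<Rightarrow> real \<Rightarrow> real \<Rightarrow> 'a" where
  "path_seg p a b = (\<lambda>s. p (a + (b - a) * s))"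

lemma path_seg_ends [simp]: "path_seg p a b 0 = p a" "path_seg p a b 1 = p b"
  by (simp_all add: path_seg_def)

lemma path_seg_01 [simp]: "path_seg p 0 1 = p"
  by (simp add: path_seg_def)

lemma seg_mem:
  fixes a b s :: real
  assumes "a \<in> {c..d}" "b \<in> {c..d}" "s \<in> {0..1}"
  shows "a + (b - a) * s \<in> {c..d}"
proof -
  have "a + (b - a) * s = (1 - s) * a + s * b"
    by (simp add: algebra_simps)
  then show ?thesis
    using assms convex_bound_le[of a d b "1 - s" s] convex_bound_le[of "-a" "-c" "-b" "1 - s" s] by auto
qed

lemma pathin_seg:
  assumes "pathin X p" "a \<in> {0..1}" "b \<in> {0..1}"
  shows "pathin X (path_seg p a b)"
  by (rule pathin_reparam[OF assms(1), of "\<lambda>s. a + (b - a) * s"])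
    (use seg_mem[OF assms(2,3)] in \<open>auto intro!: continuous_intros simp: path_seg_def\<close>)

lemma path_homotopic_seg:
  assumes "pathin X p" "a \<in> {0..1}" "b \<in> {0..1}" "c \<in> {0..1}"
  shows "path_homotopic X (path_join (path_seg p a b) (path_seg p b c)) (path_seg p a c)"
proof (rule path_homotopic_reparam[OF assms(1)])
  let ?a = "\<lambda>s::real. a + (b - a) * min 1 (2 * s) + (c - b) * max 0 (2 * s - 1)"
  show "continuous_on {0..1} ?a" "continuous_on {0..1} (\<lambda>s. a + (c - a) * s)"
    by (intro continuous_intros)+
  have eq: "?a s = (if s \<le> 1/2 then a + (b - a) * (2 * s) else b + (c - b) * (2 * s - 1))" for s
  proof -
    have "min 1 (2 * s) = (if s \<le> 1/2 then 2 * s else 1)" "max 0 (2 * s - 1) = (if s \<le> 1/2 then 0 else 2 * s - 1)"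
      by auto
    then show ?thesis by simp
  qed
  show "?a \<in> {0..1} \<rightarrow> {0..1}"
    unfolding eq using seg_mem[OF assms(2,3)] seg_mem[OF assms(3,4)] by auto
  show "(\<lambda>s. a + (c - a) * s) \<in> {0..1} \<rightarrow> {0..1}"
    using seg_mem[OF assms(2,4)] by auto
  show "path_join (path_seg p a b) (path_seg p b c) s = p (?a s)" if "s \<in> {0..1}" for s
    unfolding eq by (simp add: path_join_def path_seg_def)
qed (auto simp: path_seg_def)

lemma path_class_eq_iff:
  assumes "pathin X p"
  shows "path_class X p = path_class X q \<longleftrightarrow> path_homotopic X p q"
proof
  assume "path_class X p = path_class X q"
  moreover have "p \<in> path_class X p"
    using assms by (simp add: path_class_def path_homotopic_refl)
  ultimately show "path_homotopic X p q"
    by (simp add: path_class_def path_homotopic_sym)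
next
  assume *: "path_homotopic X p q"
  show "path_class X p = path_class X q"
    unfolding path_class_def
    using path_homotopic_trans[OF *] path_homotopic_trans[OF path_homotopic_sym[OF *]] by blast
qed

lemma class_mult_path_class:
  assumes "pathin X p" "pathin X q" "p 1 = q 0"
  shows "class_mult X (path_class X p) (path_class X q) = path_class X (path_join p q)"
proof
  show "class_mult X (path_class X p) (path_class X q) \<subseteq> path_class X (path_join p q)"
    using path_homotopic_trans[OF path_homotopic_join[of X p _ q, OF _ _ assms(3)]]
    by (auto simp: class_mult_def path_class_def)
  show "path_class X (path_join p q) \<subseteq> class_mult X (path_class X p) (path_class X q)"
    using path_homotopic_refl[OF assms(1)] path_homotopic_refl[OF assms(2)]
    by (auto simp: class_mult_def path_class_def)
qed

lemma path_class_join_cong: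
  assumes "path_class X p = path_class X p'" "path_class X q = path_class X q'"
    "pathin X p" "pathin X q" "p 1 = q 0"
  shows "path_class X (path_join p q) = path_class X (path_join p' q')"
  using assms path_homotopic_join[of X p p' q q'] pathin_join[of X p q]
  by (simp add: path_class_eq_iff)

lemma path_class_assoc:
  assumes "pathin X p" "pathin X q" "pathin X r" "p 1 = q 0" "q 1 = r 0"
  shows "path_class X (path_join (path_join p q) r) = path_class X (path_join p (path_join q r))"
  using path_homotopic_assoc[OF assms] by (simp add: path_class_eq_iff pathin_join assms)

lemma path_class_const_join:
  assumes "pathin X p" "p 0 = x"
  shows "path_class X (path_join (\<lambda>_. x) p) = path_class X p"
  using path_homotopic_const_join[OF assms(1)] path_homotopicD[of X] assms(2)
  by (metis path_class_eq_iff)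

lemma path_class_join_const:
  assumes "pathin X p" "p 1 = x"
  shows "path_class X (path_join p (\<lambda>_. x)) = path_class X p"
  using path_homotopic_join_const[OF assms(1)] path_homotopicD[of X] assms(2)
  by (metis path_class_eq_iff)

lemma path_class_join_rev:
  assumes "pathin X p" "p 0 = x"
  shows "path_class X (path_join p (path_rev p)) = path_class X (\<lambda>_. x)"
  using path_homotopic_join_rev[OF assms(1)] path_homotopicD[of X] assms(2)
  by (metis path_class_eq_iff)

lemma path_class_rev_join:
  assumes "pathin X p" "p 1 = x"
  shows "path_class X (path_join (path_rev p) p) = path_class X (\<lambda>_. x)"
  using path_class_join_rev[of X "path_rev p" x] assms by (simp add: pathin_rev)

lemma path_class_join_cancel:
  assumes "pathin X p" "pathin X q" "p 1 = q 0"
  shows "path_class X (path_join (path_join p q) (path_rev q)) = path_class X p"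
proof -
  have "path_class X (path_join (path_join p q) (path_rev q)) = path_class X (path_join p (path_join q (path_rev q)))"
    using assms by (intro path_class_assoc) (auto simp: pathin_rev)
  also have "\<dots> = path_class X (path_join p (\<lambda>_. p 1))"
    using assms by (intro path_class_join_cong path_class_join_rev) (auto simp: pathin_rev pathin_join)
  finally show ?thesis
    using assms by (simp add: path_class_join_const)
qed

lemma path_class_join_rev_cancel:
  assumes "pathin X p" "pathin X q" "p 1 = q 1"
  shows "path_class X (path_join (path_join p (path_rev q)) q) = path_class X p"
  using path_class_join_cancel[of X p "path_rev q"] assms by (simp add: pathin_rev)

lemma path_class_ends:
  assumes "path_class X p = path_class X q" "pathin X p"
  shows "p 0 = q 0" "p 1 = q 1" "pathin X q"
  using path_homotopicD[of X p q] path_class_eq_iff[OF assms(2), of q] assms(1) by auto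

lemma path_join_image_subset:
  assumes "p ` {0..1} \<subseteq> U" "q ` {0..1} \<subseteq> U"
  shows "path_join p q ` {0..1} \<subseteq> U"
  using assms by (auto simp: path_join_def image_subset_iff)

section \<open>The fundamental group and path lifting to the universal cover\<close>

abbreviation is_loop :: "'a topology \<Rightarrow> 'a \<Rightarrow> (real \<Rightarrow> 'a) \<Rightarrow> bool" where
  "is_loop X x p \<equiv> pathin X p \<and> p 0 = x \<and> p 1 = x"

lemma carrier_fundamental_group:
  "carrier (fundamental_group X x) = {path_class X p | p. is_loop X x p}"
  by (simp add: fundamental_group_def)

lemma fundamental_group_simps [simp]:
  "\<one>\<^bsub>fundamental_group X x\<^esub> = path_class X (\<lambda>_. x)"
  "a \<otimes>\<^bsub>fundamental_group X x\<^esub> b = class_mult X a b"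
  by (simp_all add: fundamental_group_def)

lemma group_fundamental_group:
  assumes x: "x \<in> topspace X"
  shows "group (fundamental_group X x)"
proof (rule groupI)
  let ?\<pi> = "fundamental_group X x"
  fix a assume "a \<in> carrier ?\<pi>"
  then obtain p where p: "a = path_class X p" "is_loop X x p"
    by (auto simp: carrier_fundamental_group)
  show "\<one>\<^bsub>?\<pi>\<^esub> \<otimes>\<^bsub>?\<pi>\<^esub> a = a"
    using p x by (simp add: class_mult_path_class path_class_const_join)
  show "\<exists>b \<in> carrier ?\<pi>. b \<otimes>\<^bsub>?\<pi>\<^esub> a = \<one>\<^bsub>?\<pi>\<^esub>"
    using p by (intro bexI[of _ "path_class X (path_rev p)"])
      (auto simp: class_mult_path_class path_class_rev_join pathin_rev carrier_fundamental_group
        intro!: exI[of _ "path_rev p"])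
  fix b assume "b \<in> carrier ?\<pi>"
  then obtain q where q: "b = path_class X q" "is_loop X x q"
    by (auto simp: carrier_fundamental_group)
  show "a \<otimes>\<^bsub>?\<pi>\<^esub> b \<in> carrier ?\<pi>"
    using p q by (auto simp: class_mult_path_class carrier_fundamental_group pathin_join
        intro!: exI[of _ "path_join p q"])
  fix c assume "c \<in> carrier ?\<pi>"
  then obtain r where r: "c = path_class X r" "is_loop X x r"
    by (auto simp: carrier_fundamental_group)
  show "a \<otimes>\<^bsub>?\<pi>\<^esub> b \<otimes>\<^bsub>?\<pi>\<^esub> c = a \<otimes>\<^bsub>?\<pi>\<^esub> (b \<otimes>\<^bsub>?\<pi>\<^esub> c)"
    using p q r by (simp add: class_mult_path_class pathin_join path_class_assoc)
next
  show "\<one>\<^bsub>fundamental_group X x\<^esub> \<in> carrier (fundamental_group X x)"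
    using x by (auto simp: carrier_fundamental_group intro!: exI[of _ "\<lambda>_. x"])
qed

lemma sheet_path_class:
  assumes "pathin X p"
  shows "sheet X (path_class X p) U =
    {path_class X (path_join p q) | q. pathin X q \<and> q ` {0..1} \<subseteq> U \<and> q 0 = p 1}"
proof -
  have "path_class X (path_join p' q) = path_class X (path_join p q) \<and> p' 1 = p 1"
    if "p' \<in> path_class X p" "pathin X q" "q 0 = p' 1" for p' q
  proof -
    have "path_homotopic X p p'"
      using that by (simp add: path_class_def)
    then show ?thesis
      using that assms path_homotopicD[of X p p'] path_class_join_cong[of X p p' q q]
      by (simp add: path_class_eq_iff)
  qed
  moreover have "p \<in> path_class X p"
    using assms by (simp add: path_class_def path_homotopic_refl)
  ultimately show ?thesis
    unfolding sheet_def by (intro Collect_cong) metis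
qed

lemma topspace_universal_cover:
  "topspace (universal_cover X x) = {path_class X p | p. pathin X p \<and> p 0 = x}" (is "?L = ?R")
proof
  show "?L \<subseteq> ?R"
  proof
    fix c assume "c \<in> ?L"
    then obtain p U where p: "pathin X p" "p 0 = x" and "c \<in> sheet X (path_class X p) U"
      by (auto simp: universal_cover_def)
    then obtain q where "c = path_class X (path_join p q)" "pathin X q" "q 0 = p 1"
      by (auto simp: sheet_path_class)
    then show "c \<in> ?R"
      using p by (auto intro!: exI[of _ "path_join p q"] pathin_join)
  qed
  show "?R \<subseteq> ?L"
  proof
    fix c assume "c \<in> ?R"
    then obtain p where p: "c = path_class X p" "pathin X p" "p 0 = x"
      by auto
    have "c \<in> sheet X (path_class X p) (topspace X)"
      using p path_finish_in_topspace[OF p(2)]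
      by (auto simp: sheet_path_class path_class_join_const intro!: exI[of _ "\<lambda>_. p 1"])
    then show "c \<in> ?L"
      using p by (auto simp: universal_cover_def)
  qed
qed

lemma openin_universal_cover_sheet:
  assumes "pathin X p" "p 0 = x" "openin X U"
  shows "openin (universal_cover X x) (sheet X (path_class X p) U)"
  using assms unfolding universal_cover_def by (intro topology_generated_by_Basis) auto

text \<open>If the class at time t0 lies in the sheet of U at r, then \<open>\<sigma>\<close> stays
  in U for t near t0. Appending its segment from t0 to t to a path in U gives another path in U, so
  the class at time t lies in the same sheet.\<close>

lemma continuous_map_universal_cover_lift:
  assumes p: "pathin X p" "p 0 = x" and \<sigma>: "pathin X \<sigma>" "\<sigma> 0 = p 1"
  shows "continuous_map (top_of_set {0..1}) (universal_cover X x)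
           (\<lambda>t. path_class X (path_join p (path_seg \<sigma> 0 t)))"
  unfolding universal_cover_def
proof (rule continuous_on_generated_topo)
  let ?f = "\<lambda>t. path_class X (path_join p (path_seg \<sigma> 0 t))"
  let ?S = "{sheet X (path_class X p) U | p U. pathin X p \<and> p 0 = x \<and> openin X U}"
  show "?f ` topspace (top_of_set {0..1}) \<subseteq> \<Union>?S"
  proof clarsimp
    fix t :: real assume "0 \<le> t" "t \<le> 1"
    then have "?f t \<in> topspace (universal_cover X x)"
      unfolding topspace_universal_cover using p \<sigma>
      by (auto intro!: exI[of _ "path_join p (path_seg \<sigma> 0 t)"] pathin_join pathin_seg)
    then show "\<exists>s. (\<exists>p U. s = sheet X (path_class X p) U \<and> pathin X p \<and> p 0 = x \<and> openin X U) \<and> ?f t \<in> s"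
      by (auto simp: universal_cover_def)
  qed
  fix s assume "s \<in> ?S"
  then obtain r U where s: "s = sheet X (path_class X r) U" and r: "pathin X r" "r 0 = x" and U: "openin X U"
    by blast
  have "openin (top_of_set {0..1}) {t \<in> {0..1}. ?f t \<in> s}"
    unfolding openin_euclidean_subtopology_iff
  proof (intro conjI ballI)
    fix t0 assume "t0 \<in> {t \<in> {0..1}. ?f t \<in> s}"
    then have t0: "t0 \<in> {0..1}" "?f t0 \<in> s" by auto
    then obtain q where q: "?f t0 = path_class X (path_join r q)" "pathin X q" "q ` {0..1} \<subseteq> U" "q 0 = r 1"
      by (auto simp: s sheet_path_class r)
    have seg: "pathin X (path_seg \<sigma> a b)" if "a \<in> {0..1}" "b \<in> {0..1}" for a b
      using pathin_seg[OF \<sigma>(1)] that by blast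
    have pt0: "pathin X (path_join p (path_seg \<sigma> 0 t0))"
      using p \<sigma> seg t0 by (intro pathin_join) auto
    have "\<sigma> t0 = q 1"
      using path_class_ends(2)[OF q(1) pt0] by simp
    then have "\<sigma> t0 \<in> U"
      using q(3) by auto
    have "openin (top_of_set {0..1}) {t \<in> topspace (top_of_set {0..1}). \<sigma> t \<in> U}"
      using \<sigma>(1) U unfolding pathin_def by (rule openin_continuous_map_preimage)
    then obtain e where e: "e > 0" "\<And>t. t \<in> {0..1} \<Longrightarrow> dist t t0 < e \<Longrightarrow> \<sigma> t \<in> U"
      using t0(1) \<open>\<sigma> t0 \<in> U\<close> unfolding openin_euclidean_subtopology_iff by force
    have "?f t \<in> s" if t: "t \<in> {0..1}" "dist t t0 < e" for t
    proof -
      let ?q = "path_join q (path_seg \<sigma> t0 t)"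
      have "\<sigma> (t0 + (t - t0) * u) \<in> U" if u: "u \<in> {0..1}" for u
      proof (rule e(2))
        show "t0 + (t - t0) * u \<in> {0..1}"
          using seg_mem[OF t0(1) t(1) u] .
        have "\<bar>t - t0\<bar> * \<bar>u\<bar> \<le> \<bar>t - t0\<bar> * 1"
          using u by (intro mult_left_mono) auto
        then show "dist (t0 + (t - t0) * u) t0 < e"
          using t(2) by (simp add: dist_real_def abs_mult)
      qed
      then have sU: "path_seg \<sigma> t0 t ` {0..1} \<subseteq> U"
        by (auto simp: path_seg_def)
      have st: "pathin X (path_seg \<sigma> t0 t)" "pathin X (path_seg \<sigma> 0 t0)"
        using seg t t0 by auto
      have "path_class X (path_seg \<sigma> 0 t) = path_class X (path_join (path_seg \<sigma> 0 t0) (path_seg \<sigma> t0 t))"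
        using path_homotopic_seg[OF \<sigma>(1), of 0 t0 t] t t0 st
        by (subst eq_commute) (simp add: path_class_eq_iff pathin_join)
      then have "?f t = path_class X (path_join p (path_join (path_seg \<sigma> 0 t0) (path_seg \<sigma> t0 t)))"
        using p \<sigma> seg[of 0 t] t by (intro path_class_join_cong) auto
      also have "\<dots> = path_class X (path_join (path_join p (path_seg \<sigma> 0 t0)) (path_seg \<sigma> t0 t))"
        using p \<sigma> st by (simp add: path_class_assoc)
      also have "\<dots> = path_class X (path_join (path_join r q) (path_seg \<sigma> t0 t))"
        using st pt0 by (intro path_class_join_cong[OF q(1) refl]) auto
      also have "\<dots> = path_class X (path_join r ?q)"
        using r q st \<open>\<sigma> t0 = q 1\<close> by (intro path_class_assoc) auto
      finally have "?f t = path_class X (path_join r ?q)" .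
      moreover have "pathin X ?q" "?q 0 = r 1"
        using q st \<open>\<sigma> t0 = q 1\<close> by (auto intro: pathin_join)
      moreover have "?q ` {0..1} \<subseteq> U"
        by (rule path_join_image_subset[OF q(3) sU])
      ultimately show ?thesis
        unfolding s sheet_path_class[OF r(1)] by blast
    qed
    then show "\<exists>e>0. \<forall>t \<in> {0..1}. dist t t0 < e \<longrightarrow> t \<in> {t \<in> {0..1}. ?f t \<in> s}"
      using e(1) by blast
  qed auto
  moreover have "{t \<in> {0..1}. ?f t \<in> s} = ?f -` s \<inter> topspace (top_of_set {0..1})"
    by auto
  ultimately show "openin (top_of_set {0..1}) (?f -` s \<inter> topspace (top_of_set {0..1}))"
    by simp
qed

section \<open>The quotient of the universal cover by a normal subgroup\<close>

lemma topspace_quotient_topology [simp]: "topspace (quotient_topology X q) = q ` topspace X"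
proof
  show "topspace (quotient_topology X q) \<subseteq> q ` topspace X"
    by (metis openin_quotient_topology openin_topspace)
  have "{x \<in> topspace X. q x \<in> q ` topspace X} = topspace X"
    by auto
  then have "openin (quotient_topology X q) (q ` topspace X)"
    by (simp add: openin_quotient_topology)
  then show "q ` topspace X \<subseteq> topspace (quotient_topology X q)"
    by (rule openin_subset)
qed

lemma continuous_map_quotient_topology: "continuous_map X (quotient_topology X q) q"
  by (auto simp: continuous_map_def openin_quotient_topology)

locale path_orbits =
  fixes P :: "'b topology" and y0 :: 'b and K :: "(real \<Rightarrow> 'b) set set"
  assumes y0: "y0 \<in> topspace P" and K: "normal K (fundamental_group P y0)"
begin

abbreviation "\<pi> \<equiv> fundamental_group P y0"
abbreviation "cl \<equiv> path_class P"

definition orb :: "(real \<Rightarrow> 'b) set \<Rightarrow> (real \<Rightarrow> 'b) set set" where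
  "orb = orbit (\<pi>\<lparr>carrier := K\<rparr>) (class_mult P)"

text \<open>Orbits are named by paths, for which concatenation and end points are directly
  available.\<close>

definition ob :: "(real \<Rightarrow> 'b) \<Rightarrow> (real \<Rightarrow> 'b) set set" where
  "ob p = orb (cl p)"

definition cover :: "(real \<Rightarrow> 'b) set set topology" where
  "cover = quotient_topology (universal_cover P y0) orb"

lemma K_subset: "K \<subseteq> carrier \<pi>"
  using K by (simp add: normal_imp_subgroup subgroup.subset)

lemma ob_eq:
  assumes "pathin P p" "p 0 = y0"
  shows "ob p = {cl (path_join a p) | a. is_loop P y0 a \<and> cl a \<in> K}"
proof -
  have "ob p = {class_mult P k (cl p) | k. k \<in> K}"
    by (simp add: ob_def orb_def orbit_def)
  also have "\<dots> = {class_mult P (cl a) (cl p) | a. is_loop P y0 a \<and> cl a \<in> K}"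
    using K_subset by (auto simp: carrier_fundamental_group)
  also have "\<dots> = {cl (path_join a p) | a. is_loop P y0 a \<and> cl a \<in> K}"
    using assms by (intro Collect_cong ex_cong1) (auto simp: class_mult_path_class)
  finally show ?thesis .
qed

lemma cl_const_in_K: "cl (\<lambda>_. y0) \<in> K"
  using subgroup.one_closed[OF normal_imp_subgroup[OF K]] by simp

lemma cl_join_in_K:
  assumes "is_loop P y0 a" "is_loop P y0 b" "cl a \<in> K" "cl b \<in> K"
  shows "cl (path_join a b) \<in> K"
  using subgroup.m_closed[OF normal_imp_subgroup[OF K] assms(3,4)] assms
  by (simp add: class_mult_path_class)

lemma inv_cl:
  assumes "is_loop P y0 a"
  shows "inv\<^bsub>\<pi>\<^esub> (cl a) = cl (path_rev a)"
proof (rule group.inv_equality[OF group_fundamental_group[OF y0]])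
  show "cl a \<in> carrier \<pi>" "cl (path_rev a) \<in> carrier \<pi>"
    using assms by (auto simp: carrier_fundamental_group pathin_rev intro: exI[of _ "path_rev a"])
  show "cl (path_rev a) \<otimes>\<^bsub>\<pi>\<^esub> cl a = \<one>\<^bsub>\<pi>\<^esub>"
    using assms by (simp add: class_mult_path_class pathin_rev path_class_rev_join)
qed

lemma cl_rev_in_K:
  assumes "is_loop P y0 a" "cl a \<in> K"
  shows "cl (path_rev a) \<in> K"
  using subgroup.m_inv_closed[OF normal_imp_subgroup[OF K] assms(2)] by (simp add: inv_cl assms)

lemma cl_in_ob: "pathin P p \<Longrightarrow> p 0 = y0 \<Longrightarrow> cl p \<in> ob p"
  using cl_const_in_K y0 by (subst ob_eq) (auto intro!: exI[of _ "\<lambda>_. y0"] simp: path_class_const_join)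

lemma ob_cong: "cl p = cl q \<Longrightarrow> ob p = ob q"
  by (simp add: ob_def)

lemma ob_join_K:
  assumes p: "pathin P p" "p 0 = y0" and a: "is_loop P y0 a" "cl a \<in> K"
  shows "ob (path_join a p) = ob p"
proof -
  have ap: "pathin P (path_join a p)" "path_join a p 0 = y0"
    using assms by (auto intro: pathin_join)
  show ?thesis
  proof
    show "ob (path_join a p) \<subseteq> ob p"
    proof
      fix c assume "c \<in> ob (path_join a p)"
      then obtain b where b: "c = cl (path_join b (path_join a p))" "is_loop P y0 b" "cl b \<in> K"
        unfolding ob_eq[OF ap] by blast
      then have "c = cl (path_join (path_join b a) p)"
        using a p by (simp add: path_class_assoc)
      then show "c \<in> ob p"
        using a b p by (auto simp: ob_eq intro!: exI[of _ "path_join b a"] cl_join_in_K pathin_join)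
    qed
    show "ob p \<subseteq> ob (path_join a p)"
    proof
      fix c assume "c \<in> ob p"
      then obtain b where b: "c = cl (path_join b p)" "is_loop P y0 b" "cl b \<in> K"
        by (auto simp: ob_eq p)
      let ?b = "path_join b (path_rev a)"
      have "cl (path_join (path_join ?b a) p) = c"
        unfolding b(1) using a b p
        by (intro path_class_join_cong path_class_join_rev_cancel) (auto intro!: pathin_join pathin_rev)
      moreover have "cl (path_join ?b (path_join a p)) = cl (path_join (path_join ?b a) p)"
        using a b p by (intro path_class_assoc[symmetric]) (auto intro!: pathin_join pathin_rev)
      ultimately show "c \<in> ob (path_join a p)"
        using a b p by (auto simp: ob_eq[OF ap] intro!: exI[of _ ?b] cl_join_in_K cl_rev_in_K pathin_join pathin_rev)
    qed
  qed
qed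

text \<open>K acts at the start of a path while extension happens at its end, so by associativity
  extension is well defined on orbits.\<close>

lemma ob_join_cong:
  assumes p: "pathin P p" "p 0 = y0" and q: "pathin P q" "q 0 = y0" and eq: "ob p = ob q"
    and \<sigma>: "pathin P \<sigma>" "\<sigma> 0 = p 1"
  shows "ob (path_join p \<sigma>) = ob (path_join q \<sigma>)"
proof -
  obtain a where a: "cl p = cl (path_join a q)" "is_loop P y0 a" "cl a \<in> K"
    using cl_in_ob[OF p] eq by (auto simp: ob_eq q)
  have e: "p 1 = q 1"
    using path_class_ends[OF a(1) p(1)] by simp
  have "cl (path_join p \<sigma>) = cl (path_join (path_join a q) \<sigma>)"
    using a p \<sigma> by (intro path_class_join_cong) auto
  also have "\<dots> = cl (path_join a (path_join q \<sigma>))"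
    using a q \<sigma> e by (intro path_class_assoc) auto
  finally have "ob (path_join p \<sigma>) = ob (path_join a (path_join q \<sigma>))"
    by (rule ob_cong)
  also have "\<dots> = ob (path_join q \<sigma>)"
    using a q \<sigma> e by (intro ob_join_K) (auto intro: pathin_join)
  finally show ?thesis .
qed

lemma topspace_cover: "topspace cover = {ob p | p. pathin P p \<and> p 0 = y0}"
  by (auto simp: cover_def topspace_universal_cover ob_def)

lemma continuous_map_lift:
  assumes "pathin P p" "p 0 = y0" "pathin P \<sigma>" "\<sigma> 0 = p 1"
  shows "continuous_map (top_of_set {0..1}) cover (\<lambda>t. ob (path_join p (path_seg \<sigma> 0 t)))"
  using continuous_map_compose[OF continuous_map_universal_cover_lift[OF assms] continuous_map_quotient_topology[of _ orb]]
  by (simp add: cover_def ob_def o_def)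

text \<open>In the universal cover its preimage is the union of the sheets at the translates of p by
  K.\<close>

lemma openin_cover_nbhd:
  assumes p: "pathin P p" "p 0 = y0" and U: "openin P U"
  shows "openin cover {ob (path_join p q) | q. pathin P q \<and> q ` {0..1} \<subseteq> U \<and> q 0 = p 1}" (is "openin _ ?N")
proof -
  have "{c \<in> topspace (universal_cover P y0). orb c \<in> ?N} =
      (\<Union>a \<in> {a. is_loop P y0 a \<and> cl a \<in> K}. sheet P (cl (path_join a p)) U)" (is "?L = ?R")
  proof
    show "?L \<subseteq> ?R"
    proof
      fix c assume "c \<in> ?L"
      then obtain r q where r: "c = cl r" "pathin P r" "r 0 = y0"
        and q: "pathin P q" "q ` {0..1} \<subseteq> U" "q 0 = p 1" "ob r = ob (path_join p q)"
        by (auto simp: topspace_universal_cover ob_def)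
      have pq: "pathin P (path_join p q)" "path_join p q 0 = y0"
        using p q by (auto intro: pathin_join)
      obtain a where a: "is_loop P y0 a" "cl a \<in> K" "cl r = cl (path_join a (path_join p q))"
        using cl_in_ob[OF r(2,3)] by (auto simp: q(4) ob_eq[OF pq])
      then have "cl r = cl (path_join (path_join a p) q)"
        using p q by (simp add: path_class_assoc)
      then have "c \<in> sheet P (cl (path_join a p)) U"
        using r a p q by (subst sheet_path_class) (auto intro: pathin_join)
      then show "c \<in> ?R"
        using a by blast
    qed
    show "?R \<subseteq> ?L"
    proof
      fix c assume "c \<in> ?R"
      then obtain a where a: "is_loop P y0 a" "cl a \<in> K" and "c \<in> sheet P (cl (path_join a p)) U"
        by blast
      then obtain q where q: "c = cl (path_join (path_join a p) q)" "pathin P q" "q ` {0..1} \<subseteq> U" "q 0 = p 1"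
        using p a by (subst (asm) sheet_path_class) (auto intro: pathin_join)
      then have c: "c = cl (path_join a (path_join p q))"
        using p a by (simp add: path_class_assoc)
      have "ob (path_join a (path_join p q)) = ob (path_join p q)"
        using p a q by (intro ob_join_K) (auto intro: pathin_join)
      then have "orb c = ob (path_join p q)"
        unfolding c ob_def .
      moreover have "c \<in> topspace (universal_cover P y0)"
        unfolding topspace_universal_cover using c a p q
        by (auto intro!: exI[of _ "path_join a (path_join p q)"] pathin_join)
      ultimately show "c \<in> ?L"
        using q by blast
    qed
  qed
  moreover have "openin (universal_cover P y0) ?R"
    using p U by (intro openin_Union) (auto intro!: openin_universal_cover_sheet pathin_join)
  moreover have "?N \<subseteq> orb ` topspace (universal_cover P y0)"
    using p by (auto simp: ob_def topspace_universal_cover intro!: imageI exI pathin_join)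
  ultimately show ?thesis
    by (simp add: cover_def openin_quotient_topology)
qed

end

section \<open>Transport along paths as a cocycle\<close>

lemma path_homotopic_fconvex:
  assumes S: "fconvex S" and a: "pathin (top_of_set S) a" and b: "pathin (top_of_set S) b"
    and ends: "a 0 = b 0" "a 1 = b 1"
  shows "path_homotopic (top_of_set S) a b"
  unfolding path_homotopic_def homotopic_with_def
proof (intro exI conjI ballI)
  let ?h = "\<lambda>z i. (1 - fst z) * a (snd z) i + fst z * b (snd z) i"
  have "continuous_on ({0..1::real} \<times> {0..1}) (\<lambda>z. c (snd z) i)"
    if "pathin (top_of_set S) c" for c and i :: nat
  proof (rule continuous_on_product_then_coordinatewise, rule continuous_on_compose2)
    show "continuous_on {0..1} c"
      using that by (auto simp: pathin_def)
  qed (auto intro: continuous_intros)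
  note this[OF a] this[OF b]
  then have "continuous_on ({0..1} \<times> {0..1}) ?h"
    by (intro continuous_on_coordinatewise_then_product continuous_intros)
  moreover have "?h z \<in> S" if "z \<in> {0..1} \<times> {0..1}" for z
    using that S a b by (auto simp: fconvex_def pathin_def Pi_iff)
  ultimately show "continuous_map (prod_topology (top_of_set {0..1}) (top_of_set {0..1})) (top_of_set S) ?h"
    by auto
qed (use ends in \<open>auto simp: algebra_simps\<close>)

definition edge_point :: "real \<Rightarrow> nat \<Rightarrow> real" where
  "edge_point t = (\<lambda>i. if i = 0 then 1 - t else if i = 1 then t else 0)"

definition simplex_path :: "((nat \<Rightarrow> real) \<Rightarrow> 'a) \<Rightarrow> real \<Rightarrow> 'a" where
  "simplex_path f = (\<lambda>t. f (edge_point t))"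

lemma edge_point_in_simplex: "t \<in> {0..1} \<Longrightarrow> edge_point t \<in> standard_simplex 1"
  by (auto simp: standard_simplex_def edge_point_def)

lemma continuous_on_If_const:
  "continuous_on S f \<Longrightarrow> continuous_on S g \<Longrightarrow> continuous_on S (\<lambda>x. if b then f x else g x)"
  by (cases b) simp_all

lemma pathin_edge_point: "pathin (top_of_set (standard_simplex 1)) edge_point"
proof -
  have "continuous_on {0..1} edge_point"
    unfolding edge_point_def
    by (intro continuous_on_coordinatewise_then_product continuous_on_If_const continuous_intros)
  then show ?thesis
    using edge_point_in_simplex by (auto simp: pathin_def)
qed

lemma fconvex_standard_simplex: "fconvex (standard_simplex p)"
  unfolding fconvex_def using convex_standard_simplex[of _ p] by auto

lemma continuous_map_singular_simplex:
  "singular_simplex p X f \<Longrightarrow> continuous_map (top_of_set (standard_simplex p)) X f"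
  by (simp add: singular_simplex_def euclidean_product_topology)

lemma pathin_simplex_path:
  assumes "singular_simplex 1 X f"
  shows "pathin X (simplex_path f)"
  using pathin_compose[OF pathin_edge_point continuous_map_singular_simplex[OF assms]]
  by (simp add: simplex_path_def o_def)

lemma pathin_simplical_face:
  assumes "k \<le> 2"
  shows "pathin (top_of_set (standard_simplex 2)) (\<lambda>t. simplical_face k (edge_point t))"
proof -
  have "continuous_on {0..1} (\<lambda>t. simplical_face k (edge_point t))"
    unfolding edge_point_def simplical_face_def
    by (intro continuous_on_coordinatewise_then_product continuous_on_If_const continuous_intros)
  moreover have "simplical_face k (edge_point t) \<in> standard_simplex 2" if "t \<in> {0..1}" for t
    using simplical_face_in_standard_simplex[of 2 k "edge_point t"] edge_point_in_simplex[OF that] assms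
    by simp
  ultimately show ?thesis
    by (auto simp: pathin_def)
qed

lemma simplex_path_face:
  assumes "t \<in> {0..1}"
  shows "simplex_path (singular_face 2 k f) t = f (simplical_face k (edge_point t))"
  using edge_point_in_simplex[OF assms] by (simp add: simplex_path_def singular_face_def)

text \<open>Face k omits vertex k, so the faces 2, 0 and 1 are the edges from vertex 0 to 1, from 1
  to 2 and from 0 to 2. In the convex simplex the broken path and the direct edge are
  homotopic.\<close>

lemma path_homotopic_boundary:
  assumes f: "singular_simplex 2 X f"
  shows "path_homotopic X (path_join (simplex_path (singular_face 2 2 f)) (simplex_path (singular_face 2 0 f)))
    (simplex_path (singular_face 2 1 f))"
proof -
  let ?e = "\<lambda>k t. simplical_face k (edge_point t)"
  have e: "?e 2 1 = ?e 0 0" "?e 2 0 = ?e 1 0" "?e 0 1 = ?e 1 1"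
    by (auto simp: simplical_face_def edge_point_def fun_eq_iff)
  have "path_homotopic (top_of_set (standard_simplex 2)) (path_join (?e 2) (?e 0)) (?e 1)"
    using e by (intro path_homotopic_fconvex fconvex_standard_simplex pathin_join pathin_simplical_face) auto
  from path_homotopic_map[OF this continuous_map_singular_simplex[OF f]] show ?thesis
    by (rule path_homotopic_cong) (auto simp: path_join_def simplex_path_face)
qed

text \<open>The last conclusion makes a closed path a singular cycle. It is an equality of
  functions, which is possible because faces are extensional.\<close>

lemma path_eq_simplex_path:
  assumes "pathin X \<sigma>"
  obtains f where "singular_simplex 1 X f" "\<And>t. t \<in> {0..1} \<Longrightarrow> simplex_path f t = \<sigma> t"
    "\<sigma> 0 = \<sigma> 1 \<Longrightarrow> singular_face 1 0 f = singular_face 1 1 f"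
proof
  let ?f = "restrict (\<lambda>x. \<sigma> (x 1)) (standard_simplex 1)"
  have "continuous_map (top_of_set (standard_simplex 1)) (top_of_set {0..1}) (\<lambda>x. x 1)"
    using continuous_on_coordinate by (auto simp: standard_simplex_def)
  from continuous_map_compose[OF this assms[unfolded pathin_def]]
  have "continuous_map (top_of_set (standard_simplex 1)) X (\<lambda>x. \<sigma> (x 1))"
    by (simp add: o_def)
  then have "continuous_map (top_of_set (standard_simplex 1)) X ?f"
    by (rule continuous_map_eq) simp
  then show "singular_simplex 1 X ?f"
    by (simp add: singular_simplex_def euclidean_product_topology)
  show "simplex_path ?f t = \<sigma> t" if "t \<in> {0..1}" for t
    using edge_point_in_simplex[OF that] by (simp add: simplex_path_def) (simp add: edge_point_def)
  show "singular_face 1 0 ?f = singular_face 1 1 ?f" if "\<sigma> 0 = \<sigma> 1"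
  proof -
    have "?f (simplical_face k x) = \<sigma> 0" if "x \<in> standard_simplex 0" "k \<le> 1" for k x
    proof -
      have "simplical_face k x \<in> standard_simplex 1"
        using simplical_face_in_standard_simplex[of 1 k x] that by simp
      moreover have "simplical_face k x 1 \<in> {0, 1}"
        using that by (auto simp: standard_simplex_0 simplical_face_def)
      ultimately show ?thesis
        using \<open>\<sigma> 0 = \<sigma> 1\<close> by auto
    qed
    then show ?thesis
      by (auto simp: singular_face_def fun_eq_iff)
  qed
qed

text \<open>Such a \<open>\<phi>\<close> is a singular 1-cocycle: additivity gives its value on the boundary of a 2-simplex.\<close>

proposition transport_loop_trivial:
  assumes acyc: "acyclic_in 1 X" and A: "comm_group A"
    and closed: "\<And>\<sigma>. pathin X \<sigma> \<Longrightarrow> \<phi> \<sigma> \<in> carrier A"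
    and join: "\<And>\<sigma> \<rho>. pathin X \<sigma> \<Longrightarrow> pathin X \<rho> \<Longrightarrow> \<sigma> 1 = \<rho> 0 \<Longrightarrow> \<phi> (path_join \<sigma> \<rho>) = \<phi> \<sigma> \<otimes>\<^bsub>A\<^esub> \<phi> \<rho>"
    and homotopic: "\<And>\<sigma> \<rho>. path_homotopic X \<sigma> \<rho> \<Longrightarrow> \<phi> \<sigma> = \<phi> \<rho>"
    and \<sigma>: "pathin X \<sigma>" "\<sigma> 0 = \<sigma> 1"
  shows "\<phi> \<sigma> = \<one>\<^bsub>A\<^esub>"
proof -
  interpret A: comm_group A by (rule A)
  \<comment> \<open>As the chain group is free, \<open>\<phi>\<close> extends to a homomorphism h on
    1-chains. It remains to see that h kills boundaries of 2-simplexes.\<close>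
  have "(\<lambda>f. \<phi> (simplex_path f)) ` singular_simplex_set 1 X \<subseteq> carrier A"
    using closed pathin_simplex_path by blast
  then obtain h where h: "h \<in> hom (free_Abelian_group (singular_simplex_set 1 X)) A"
    and hf: "\<And>f. f \<in> singular_simplex_set 1 X \<Longrightarrow> h (frag_of f) = \<phi> (simplex_path f)"
    using A.free_Abelian_group_universal by metis
  interpret h: group_hom "chain_group 1 X" A h
    using h by (simp add: group_hom_def group_hom_axioms_def A.group_axioms flip: chain_group_def)
  have h_add: "h (a + b) = h a \<otimes>\<^bsub>A\<^esub> h b" if "singular_chain 1 X a" "singular_chain 1 X b" for a b
    using h.hom_mult[of a b] that by simp
  have h_minus: "h (- a) = inv\<^bsub>A\<^esub> h a" if "singular_chain 1 X a" for a
    using h.hom_inv[of a] that by (simp add: singular_chain_def)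
  have h3: "h (a + (- b + c)) = h a \<otimes>\<^bsub>A\<^esub> (inv\<^bsub>A\<^esub> h b \<otimes>\<^bsub>A\<^esub> h c)"
    if "singular_chain 1 X a" "singular_chain 1 X b" "singular_chain 1 X c" for a b c
  proof -
    have b: "singular_chain 1 X (- b)" "singular_chain 1 X (- b + c)"
      using that by (simp_all only: singular_chain_add singular_chain_minus)
    show ?thesis
      by (simp only: h_add[OF that(1) b(2)] h_add[OF b(1) that(3)] h_minus[OF that(2)])
  qed
  have boundary: "h (chain_boundary 2 (frag_of f)) = \<one>\<^bsub>A\<^esub>" if f: "singular_simplex 2 X f" for f
  proof -
    let ?s = "\<lambda>k. singular_face 2 k f" and ?p = "\<lambda>k. simplex_path (singular_face 2 k f)"
    have s: "singular_simplex 1 X (?s k)" if "k \<le> 2" for k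
      using singular_simplex_singular_face[OF f, of k] that by simp
    then have c: "singular_chain 1 X (frag_of (?s k))" "h (frag_of (?s k)) = \<phi> (?p k)"
      "\<phi> (?p k) \<in> carrier A" "pathin X (?p k)" if "k \<le> 2" for k
      using s[OF that] hf[of "?s k"] pathin_simplex_path[OF s[OF that]]
        closed[OF pathin_simplex_path[OF s[OF that]]] by (simp_all add: singular_chain_of)
    have "path_homotopic X (path_join (?p 2) (?p 0)) (?p 1)"
      by (rule path_homotopic_boundary[OF f])
    moreover have "simplical_face 2 (edge_point 1) = simplical_face 0 (edge_point 0)"
      by (auto simp: simplical_face_def edge_point_def fun_eq_iff)
    then have "?p 2 1 = ?p 0 0"
      by (simp add: simplex_path_face)
    ultimately have eq: "\<phi> (?p 1) = \<phi> (?p 2) \<otimes>\<^bsub>A\<^esub> \<phi> (?p 0)"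
      using homotopic join[of "?p 2" "?p 0"] c(4) by simp
    have "chain_boundary 2 (frag_of f) = frag_of (?s 0) + (- frag_of (?s 1) + frag_of (?s 2))"
      by (simp add: chain_boundary_of numeral_2_eq_2)
    then have "h (chain_boundary 2 (frag_of f)) = h (frag_of (?s 0) + (- frag_of (?s 1) + frag_of (?s 2)))"
      by (simp only:)
    also have "\<dots> = h (frag_of (?s 0)) \<otimes>\<^bsub>A\<^esub> (inv\<^bsub>A\<^esub> h (frag_of (?s 1)) \<otimes>\<^bsub>A\<^esub> h (frag_of (?s 2)))"
      by (rule h3) (use c in simp_all)
    also have "\<dots> = \<phi> (?p 0) \<otimes>\<^bsub>A\<^esub> (inv\<^bsub>A\<^esub> \<phi> (?p 1) \<otimes>\<^bsub>A\<^esub> \<phi> (?p 2))"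
      using c(2)[of 0] c(2)[of 1] c(2)[of 2] by simp
    \<comment> \<open>The middle edge is the product of the other two, and commutativity of A lets
      everything cancel. This is why transport must be taken modulo commutators.\<close>
    also have "\<dots> = \<one>\<^bsub>A\<^esub>"
      using c(3)[of 0] c(3)[of 2] unfolding eq
      by (simp add: A.inv_mult A.m_ac A.r_inv)
    finally show ?thesis .
  qed
  have bounds: "h (chain_boundary 2 c) = \<one>\<^bsub>A\<^esub>" if "singular_chain 2 X c" for c
  proof -
    have "Poly_Mapping.keys c \<subseteq> singular_simplex_set 2 X"
      using that by (simp add: singular_chain_def)
    then show ?thesis
    proof (rule free_Abelian_group_induct)
      show "h (chain_boundary 2 0) = \<one>\<^bsub>A\<^esub>"
        using h.hom_one by simp
      show "h (chain_boundary 2 (frag_of f)) = \<one>\<^bsub>A\<^esub>" if "f \<in> singular_simplex_set 2 X" for f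
        using boundary that by simp
      fix x y
      assume xy: "Poly_Mapping.keys x \<subseteq> singular_simplex_set 2 X" "Poly_Mapping.keys y \<subseteq> singular_simplex_set 2 X"
        and h1: "h (chain_boundary 2 x) = \<one>\<^bsub>A\<^esub>" "h (chain_boundary 2 y) = \<one>\<^bsub>A\<^esub>"
      then have c: "singular_chain 1 X (chain_boundary 2 x)" "singular_chain 1 X (chain_boundary 2 y)"
        using singular_chain_boundary_alt[of 1 X] by (auto simp: singular_chain_def numeral_2_eq_2)
      have "h (chain_boundary 2 x + - chain_boundary 2 y) = h (chain_boundary 2 x) \<otimes>\<^bsub>A\<^esub> inv\<^bsub>A\<^esub> h (chain_boundary 2 y)"
        by (subst h_add[OF c(1)]) (use c(2) in \<open>simp_all only: singular_chain_minus h_minus\<close>)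
      then show "h (chain_boundary 2 (x - y)) = \<one>\<^bsub>A\<^esub>"
        using h1 by (simp add: chain_boundary_diff)
    qed
  qed
  obtain f where f: "singular_simplex 1 X f" "\<And>t. t \<in> {0..1} \<Longrightarrow> simplex_path f t = \<sigma> t"
    "singular_face 1 0 f = singular_face 1 1 f"
    by (rule path_eq_simplex_path[OF \<sigma>(1)]) (use \<sigma>(2) in blast)
  have "chain_boundary 1 (frag_of f) = 0"
    by (simp add: chain_boundary_of f(3)[simplified])
  then have "singular_relcycle 1 X {} (frag_of f)"
    using f(1) by (simp add: singular_cycle singular_chain_of)
  then obtain c where "singular_chain 2 X c" "chain_boundary 2 c = frag_of f"
    using acyc by (auto simp: acyclic_in_def singular_boundary numeral_2_eq_2)
  then have "\<phi> (simplex_path f) = \<one>\<^bsub>A\<^esub>"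
    using bounds hf f(1) by (metis mem_Collect_eq)
  moreover have "path_homotopic X \<sigma> (simplex_path f)"
    by (rule path_homotopic_cong[OF path_homotopic_refl[OF \<sigma>(1)]]) (auto simp: f(2))
  ultimately show ?thesis
    using homotopic by simp
qed

section \<open>Local monodromy\<close>

text \<open>\<open>K\<close> is not assumed to be a subgroup: with \<open>k \<in> K\<close>, the coset \<open>C = K k\<^sup>-\<^sup>1\<close> satisfies
  \<open>K \<subseteq> C \<subseteq> C\<^sup>2 \<subseteq> \<dots>\<close>, and some power of \<open>C\<close> is the unit \<open>K\<close> of the finite quotient.\<close>

lemma (in group) normal_of_finite_quotient:
  assumes K: "K \<subseteq> carrier G" and Q: "group (G Mod K)" "finite (carrier (G Mod K))" and "K \<noteq> {}"
  shows "K \<lhd> G"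
proof -
  interpret Q: group "G Mod K" by (rule Q)
  have one: "A <#> K = A" "K <#> A = A" if "A \<in> carrier (G Mod K)" for A
    using Q.r_one[OF that] Q.l_one[OF that] by simp_all
  have coset: "K #> a \<in> carrier (G Mod K)" if "a \<in> carrier G" for a
    using that by (simp add: carrier_FactGroup)
  have "K \<in> carrier (G Mod K)"
    using Q.one_closed by simp
  then have KK: "a \<otimes> b \<in> K" if "a \<in> K" "b \<in> K" for a b
    using one(1)[of K] that by (auto simp: set_mult_def)
  have unit: "\<one> \<in> K \<and> inv k \<in> K" if k: "k \<in> K" for k
  proof -
    let ?C = "K #> inv k"
    have kG: "k \<in> carrier G" using k K by blast
    have C: "?C \<in> carrier (G Mod K)"
      using coset kG by simp
    have 1: "\<one> \<in> ?C"
      using k kG by (auto simp: r_coset_def intro!: bexI[of _ k])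
    have pow: "?C \<subseteq> ?C [^]\<^bsub>G Mod K\<^esub> Suc m" for m
    proof (induction m)
      case 0
      show ?case using C one by simp
    next
      case (Suc m)
      have CG: "?C \<subseteq> carrier G"
        using K kG by (simp add: r_coset_subset_G)
      have "x \<in> (?C [^]\<^bsub>G Mod K\<^esub> Suc m) <#> ?C" if x: "x \<in> ?C" for x
      proof -
        have "x = x \<otimes> \<one>" using x CG by auto
        then show ?thesis
          using x Suc.IH 1 unfolding set_mult_def by blast
      qed
      then show ?case by auto
    qed
    have "Coset.order (G Mod K) > 0"
      using Q(2) Q.one_closed by (auto simp: Coset.order_def card_gt_0_iff)
    then obtain m where m: "Coset.order (G Mod K) = Suc m"
      using gr0_implies_Suc by blast
    have "?C \<subseteq> K"
      using pow[of m] Q.pow_order_eq_1[OF C] unfolding m by simp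
    then have "\<one> \<in> K"
      using 1 by blast
    moreover have "inv k \<in> ?C"
      using kG \<open>\<one> \<in> K\<close> by (auto simp: r_coset_def intro!: bexI[of _ \<one>])
    ultimately show ?thesis
      using \<open>?C \<subseteq> K\<close> by blast
  qed
  have sub: "subgroup K G"
    by (rule subgroupI) (use K KK unit \<open>K \<noteq> {}\<close> in auto)
  show ?thesis
  proof (rule normal_invI[OF sub])
    fix x h assume x: "x \<in> carrier G" and h: "h \<in> K"
    \<comment> \<open>Since K is the unit of the quotient, the coset \<open>K #> x\<close> absorbs K
      from the right; hence \<open>x \<otimes> h\<close> lies in it.\<close>
    have "x \<in> K #> x"
      using x unit[OF h] by (auto simp: r_coset_def intro!: bexI[of _ \<one>])
    then have "x \<otimes> h \<in> (K #> x) <#> K"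
      using h by (auto simp: set_mult_def)
    then have "x \<otimes> h \<in> K #> x"
      using one(1)[OF coset[OF x]] by simp
    then obtain k where k: "k \<in> K" "x \<otimes> h = k \<otimes> x"
      by (auto simp: r_coset_def)
    moreover have "k \<in> carrier G"
      using k(1) K by blast
    ultimately have "x \<otimes> h \<otimes> inv x = k"
      using x by (simp add: m_assoc)
    then show "x \<otimes> h \<otimes> inv x \<in> K"
      using k by simp
  qed
qed

section \<open>The normalization and the action of the monodromy group\<close>

locale monodromy_setup =
  fixes M :: "'a topology" and N :: "'b topology" and f :: "'a \<Rightarrow> 'b" and n :: nat
    and y0 :: 'b
    and X :: "'x topology" and \<iota> :: "(real \<Rightarrow> 'b) set set \<Rightarrow> 'x" and fbar :: "'x \<Rightarrow> 'b"
    and \<psi> :: "(real \<Rightarrow> 'b) set set \<Rightarrow> 'x \<Rightarrow> 'x"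
  assumes N: "manifold n N" and f: "branched_cover M N f" "compact_preimages M N f"
    and y0_regular: "y0 \<in> topspace (regular_base M N f)"
    and norm: "normalization M N f y0 X \<iota> fbar"
    and act: "extended_deck_action M N f y0 X \<iota> \<psi>"
begin

definition E where "E = f ` branch_set M N f"
definition P where "P = regular_base M N f"
definition K where "K = monodromy_kernel M N f y0"
definition G where "G = monodromy_group M N f y0"
definition NC where "NC = normal_cover M N f y0"

lemma closedin_E: "closedin N E"
  unfolding E_def by (rule closedin_branch_values[OF N f])

lemma P_eq: "P = subtopology N (topspace N - E)"
  by (simp add: P_def E_def regular_base_def)

lemma topspace_P: "topspace P = topspace N - E"
  by (auto simp: P_eq)

lemma y0_P: "y0 \<in> topspace P"
  using y0_regular by (simp add: P_def)

lemma K_carrier: "K \<subseteq> carrier (fundamental_group P y0)"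
  by (auto simp: K_def P_def monodromy_kernel_def kernel_def)

lemma G_eq: "G = fundamental_group P y0 Mod K"
  by (simp add: G_def K_def P_def monodromy_group_def)

lemma NC_eq: "NC = quotient_topology (universal_cover P y0)
    (orbit ((fundamental_group P y0)\<lparr>carrier := K\<rparr>) (class_mult P))"
  by (simp add: NC_def P_def K_def normal_cover_def)

lemma action: "group_action G (topspace X) \<psi>"
  using act by (simp add: extended_deck_action_def G_def)

lemma group_G: "group G"
  using action group_action.group_hom group_hom.axioms(1) by blast

lemma Hausdorff_X: "Hausdorff_space X"
  and locally_connected_X: "locally_connected_space X"
  and embed: "embedding_map NC X \<iota>"
  and open_image: "openin X (\<iota> ` topspace NC)"
  and dense: "X closure_of (\<iota> ` topspace NC) = topspace X"
  and not_sep: "\<not> locally_separates X (topspace X - \<iota> ` topspace NC)"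
  and fbar_branched: "branched_cover X N fbar" and fbar_compact: "compact_preimages X N fbar"
  and fbar_\<iota>: "\<And>C. C \<in> topspace NC \<Longrightarrow> fbar (\<iota> C) = normal_cover_proj C"
  using norm by (simp_all add: normalization_def NC_def)

lemma cont_fbar: "continuous_map X N fbar" and open_fbar: "open_map X N fbar"
  using fbar_branched by (auto simp: branched_cover_def)

lemma closed_fbar: "closed_map X N fbar"
  by (rule compact_preimages_imp_closed_map[OF N cont_fbar fbar_compact])

lemma finite_fibre:
  assumes "w \<in> topspace N"
  shows "finite (fibre X fbar w)"
proof -
  have "compactin X {x \<in> topspace X. fbar x \<in> {w}}"
    using fbar_compact assms unfolding compact_preimages_def by (meson compactin_sing)
  then have "compact_space (subtopology X (fibre X fbar w))"
    unfolding fibre_def by (simp add: compactin_subspace)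
  moreover have "subtopology X (fibre X fbar w) = discrete_topology (fibre X fbar w)"
    using fbar_branched assms by (simp add: branched_cover_def)
  ultimately show ?thesis
    by (simp add: compact_space_discrete_topology)
qed

lemma inj_\<iota>: "inj_on \<iota> (topspace NC)"
  using embed by (metis embedding_map_def homeomorphic_imp_injective_map)

lemma dense_open:
  assumes "openin X O'" "O' \<noteq> {}"
  shows "\<exists>C \<in> topspace NC. \<iota> C \<in> O'"
  using dense[unfolded dense_intersects_open, rule_format, of O'] assms by auto

lemma \<psi>_homeo: "g \<in> carrier G \<Longrightarrow> homeomorphic_map X X (\<psi> g)"
  using act by (simp add: extended_deck_action_def G_def)

lemma \<psi>_cont: "g \<in> carrier G \<Longrightarrow> continuous_map X X (\<psi> g)"
  using \<psi>_homeo homeomorphic_imp_continuous_map by blast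

lemma \<psi>_open: "g \<in> carrier G \<Longrightarrow> openin X U \<Longrightarrow> openin X (\<psi> g ` U)"
  using \<psi>_homeo homeomorphic_map_openness_eq by metis

lemma \<psi>_mem: "g \<in> carrier G \<Longrightarrow> x \<in> topspace X \<Longrightarrow> \<psi> g x \<in> topspace X"
  using group_action.element_image[OF action] by blast

lemma \<psi>_mult: "g \<in> carrier G \<Longrightarrow> h \<in> carrier G \<Longrightarrow> x \<in> topspace X \<Longrightarrow> \<psi> (g \<otimes>\<^bsub>G\<^esub> h) x = \<psi> g (\<psi> h x)"
  by (rule group_action.composition_rule[OF action])

lemma \<psi>_inv: "g \<in> carrier G \<Longrightarrow> x \<in> topspace X \<Longrightarrow> \<psi> (inv\<^bsub>G\<^esub> g) (\<psi> g x) = x"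
  using group_action.orbit_sym_aux[OF action] by blast

text \<open>Without the lifting theory of f it is not known that the constant class acts as the
  identity, so K might be empty. Then every coset is empty and the quotient has one element.\<close>

lemma trivial_case:
  assumes "K = {}" "H \<subseteq> carrier G" "subgroup H G"
  shows "finite H \<and> perfect_group (G\<lparr>carrier := H\<rparr>)"
proof -
  have "carrier (fundamental_group P y0) \<noteq> {}"
    using y0_P by (auto simp: carrier_fundamental_group intro!: exI[of _ "\<lambda>_. y0"])
  then have G: "carrier G = {{}}"
    using assms(1) by (auto simp: G_eq carrier_FactGroup r_coset_def)
  interpret G: group G by (rule group_G)
  have "\<one>\<^bsub>G\<^esub> = {}"
    using G.one_closed G by auto
  then have H: "H = {\<one>\<^bsub>G\<^esub>}"
    using subgroup.one_closed[OF assms(3)] assms(2) G by auto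
  have "derived G H = H"
    using G.derived_incl[OF subset_refl assms(3)] subgroup.one_closed[OF G.derived_is_subgroup[OF assms(2)]] H
    by auto
  then have "derived (G\<lparr>carrier := H\<rparr>) H = H"
    using G.derived_consistent[OF subset_refl assms(3)] by simp
  then show ?thesis
    using H subgroup.subgroup_is_group[OF assms(3) group_G] by (simp add: perfect_group_def)
qed

lemma normal_cover_proj_eq:
  assumes "C \<noteq> {}" "\<And>c. c \<in> C \<Longrightarrow> \<exists>q. pathin P q \<and> c = path_class P q \<and> q 1 = z"
  shows "normal_cover_proj C = z"
  unfolding normal_cover_proj_def
proof (rule the_equality)
  obtain c where c: "c \<in> C" using assms(1) by blast
  then obtain q where q: "pathin P q" "c = path_class P q" "q 1 = z"
    using assms(2) by blast
  then have "q \<in> c"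
    by (simp add: path_class_def path_homotopic_refl)
  then show "\<exists>c \<in> C. \<exists>p \<in> c. p 1 = z"
    using c q by blast
  fix z' assume "\<exists>c \<in> C. \<exists>p \<in> c. p 1 = z'"
  then obtain c p where "c \<in> C" "p \<in> c" "p 1 = z'"
    by blast
  moreover obtain q where "pathin P q" "c = path_class P q" "q 1 = z"
    using assms(2)[OF \<open>c \<in> C\<close>] by blast
  ultimately show "z' = z"
    using path_homotopicD(4)[of P q p] by (simp add: path_class_def)
qed

lemma coset_eq:
  assumes "is_loop P y0 a"
  shows "K #>\<^bsub>fundamental_group P y0\<^esub> path_class P a =
    orbit ((fundamental_group P y0)\<lparr>carrier := K\<rparr>) (class_mult P) (path_class P a)"
  by (auto simp: r_coset_def orbit_def)

text \<open>A coset of K is, as a set, an orbit of a loop and hence a point of the normal covering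
  above \<open>y0\<close>. So \<open>\<iota>\<close> embeds the group into a finite fibre.\<close>

lemma finite_G:
  assumes "K \<noteq> {}"
  shows "finite (carrier G)"
proof -
  have "A \<in> topspace NC \<and> \<iota> A \<in> fibre X fbar y0" if AG: "A \<in> carrier G" for A
  proof -
    obtain a where a: "is_loop P y0 a" "A = K #>\<^bsub>fundamental_group P y0\<^esub> path_class P a"
      using AG by (auto simp: G_eq carrier_FactGroup carrier_fundamental_group)
    then have A: "A \<in> topspace NC"
      by (auto simp: NC_eq coset_eq topspace_universal_cover)
    have "\<exists>q. pathin P q \<and> c = path_class P q \<and> q 1 = y0" if c: "c \<in> A" for c
    proof -
      obtain b where "is_loop P y0 b" "c = class_mult P (path_class P b) (path_class P a)"
        using c K_carrier by (auto simp: a(2) r_coset_def carrier_fundamental_group)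
      then show ?thesis
        using a by (auto simp: class_mult_path_class intro!: exI[of _ "path_join b a"] pathin_join)
    qed
    moreover have "A \<noteq> {}"
      using assms by (auto simp: a(2) r_coset_def)
    ultimately have "normal_cover_proj A = y0"
      by (intro normal_cover_proj_eq)
    moreover have "\<iota> A \<in> topspace X"
      using A open_image openin_subset by blast
    ultimately show ?thesis
      using A fbar_\<iota>[OF A] by (simp add: fibre_def)
  qed
  then have "\<iota> ` carrier G \<subseteq> fibre X fbar y0" "inj_on \<iota> (carrier G)"
    using inj_\<iota> inj_on_subset by blast+
  then show ?thesis
    using finite_fibre[of y0] y0_P topspace_P by (metis Diff_iff finite_imageD finite_subset)
qed

end

locale nontrivial_monodromy_setup = monodromy_setup +
  assumes K_ne: "K \<noteq> {}"
begin

lemma normal_K: "normal K (fundamental_group P y0)"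
  using group.normal_of_finite_quotient[OF group_fundamental_group[OF y0_P] K_carrier]
    group_G finite_G[OF K_ne] K_ne by (simp add: G_eq)

sublocale path_orbits P y0 K
  by (rule path_orbits.intro[OF y0_P normal_K])

lemma cover_eq: "cover = NC"
  by (simp add: cover_def orb_def NC_eq)

text \<open>The regular points of X, parametrized by paths from \<open>y0\<close> to their images in
  N.\<close>

definition pt :: "(real \<Rightarrow> 'b) \<Rightarrow> 'c" where
  "pt p = \<iota> (ob p)"

abbreviation based :: "(real \<Rightarrow> 'b) \<Rightarrow> bool" where
  "based p \<equiv> pathin P p \<and> p 0 = y0"

lemma coset_ob: "is_loop P y0 a \<Longrightarrow> K #>\<^bsub>\<pi>\<^esub> cl a = ob a"
  by (simp add: coset_eq ob_def orb_def)

lemma carrier_G: "carrier G = {ob a | a. is_loop P y0 a}"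
proof -
  have "carrier G = (\<lambda>x. K #>\<^bsub>\<pi>\<^esub> x) ` {cl a | a. is_loop P y0 a}"
    by (simp add: G_eq carrier_FactGroup carrier_fundamental_group)
  also have "\<dots> = {ob a | a. is_loop P y0 a}"
    using coset_ob by (auto simp: image_iff)
  finally show ?thesis .
qed

lemma mult_G:
  assumes "is_loop P y0 a" "is_loop P y0 b"
  shows "ob a \<otimes>\<^bsub>G\<^esub> ob b = ob (path_join a b)"
proof -
  have "cl a \<in> carrier \<pi>" "cl b \<in> carrier \<pi>"
    using assms by (auto simp: carrier_fundamental_group)
  then have "(K #>\<^bsub>\<pi>\<^esub> cl a) \<otimes>\<^bsub>G\<^esub> (K #>\<^bsub>\<pi>\<^esub> cl b) = K #>\<^bsub>\<pi>\<^esub> (cl a \<otimes>\<^bsub>\<pi>\<^esub> cl b)"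
    using normal.rcos_sum[OF normal_K] by (simp add: G_eq)
  moreover have "is_loop P y0 (path_join a b)"
    using assms by (auto intro: pathin_join)
  ultimately show ?thesis
    using assms coset_ob by (simp add: class_mult_path_class)
qed

lemma conj_in_K:
  assumes "is_loop P y0 a" "is_loop P y0 b" "cl b \<in> K"
  shows "cl (path_join (path_join a b) (path_rev a)) \<in> K"
proof -
  have "cl a \<in> carrier \<pi>"
    using assms by (auto simp: carrier_fundamental_group)
  from normal.inv_op_closed2[OF normal_K this assms(3)] show ?thesis
    using assms by (simp add: inv_cl class_mult_path_class pathin_rev pathin_join)
qed

text \<open>For b and b' in K, (b a)(b' p) = b (a b' a^-1)(a p), and the conjugate lies in K by
  normality.\<close>

lemma deck_action_ob:
  assumes a: "is_loop P y0 a" and p: "based p"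
  shows "deck_action M N f (ob a) (ob p) = ob (path_join a p)"
proof
  have ap: "based (path_join a p)"
    using a p by (auto intro: pathin_join)
  show "deck_action M N f (ob a) (ob p) \<subseteq> ob (path_join a p)"
  proof
    fix c assume "c \<in> deck_action M N f (ob a) (ob p)"
    then obtain a' p' where "a' \<in> ob a" "p' \<in> ob p" "c = class_mult P a' p'"
      by (auto simp: deck_action_def P_def)
    then obtain b b' where b: "is_loop P y0 b" "cl b \<in> K" and b': "is_loop P y0 b'" "cl b' \<in> K"
      and c: "c = class_mult P (cl (path_join b a)) (cl (path_join b' p))"
      using a p by (auto simp: ob_eq)
    let ?d = "path_join (path_join a b') (path_rev a)"
    have d: "is_loop P y0 ?d" "cl ?d \<in> K"
      using a b' conj_in_K by (auto intro!: pathin_join pathin_rev)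
    have s: "pathin P (path_join b a)" "pathin P (path_join b' p)" "pathin P (path_join a b')"
      using a b b' p by (auto intro!: pathin_join)
    have "cl (path_join ?d (path_join a p)) = cl (path_join (path_join ?d a) p)"
      using a p d by (intro path_class_assoc[symmetric]) auto
    also have "\<dots> = cl (path_join (path_join a b') p)"
      using a b' p d s by (intro path_class_join_cong path_class_join_rev_cancel refl) (auto intro: pathin_join)
    also have "\<dots> = cl (path_join a (path_join b' p))"
      using a b' p by (intro path_class_assoc) auto
    finally have "ob (path_join ?d (path_join a p)) = ob (path_join a (path_join b' p))"
      by (rule ob_cong)
    then have 1: "ob (path_join a (path_join b' p)) = ob (path_join a p)"
      using ob_join_K[OF _ _ d, of "path_join a p"] ap by simp
    have c': "c = cl (path_join b (path_join a (path_join b' p)))"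
      using c s a b b' p by (simp add: class_mult_path_class path_class_assoc)
    have 2: "ob (path_join b (path_join a (path_join b' p))) = ob (path_join a (path_join b' p))"
      using a b b' p s by (intro ob_join_K) (auto intro: pathin_join)
    have "c \<in> ob (path_join b (path_join a (path_join b' p)))"
      unfolding c' using a b b' p s by (intro cl_in_ob) (auto intro!: pathin_join)
    then show "c \<in> ob (path_join a p)"
      by (simp add: 1 2)
  qed
  show "ob (path_join a p) \<subseteq> deck_action M N f (ob a) (ob p)"
  proof
    fix c assume "c \<in> ob (path_join a p)"
    then obtain d where d: "is_loop P y0 d" "cl d \<in> K" "c = cl (path_join d (path_join a p))"
      using ob_eq[of "path_join a p"] ap by auto
    then have "c = class_mult P (cl (path_join d a)) (cl p)"
      using a p by (simp add: class_mult_path_class path_class_assoc pathin_join)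
    moreover have "cl (path_join d a) \<in> ob a"
      using ob_eq[of a] a d by auto
    moreover have "cl p \<in> ob p"
      using p by (intro cl_in_ob) auto
    ultimately show "c \<in> deck_action M N f (ob a) (ob p)"
      by (auto simp: deck_action_def P_def)
  qed
qed

lemma ob_in_NC: "based p \<Longrightarrow> ob p \<in> topspace NC"
  using topspace_cover cover_eq by auto

lemma image_\<iota>: "\<iota> ` topspace NC = {pt p | p. based p}"
  unfolding cover_eq[symmetric] topspace_cover pt_def by auto

lemma pt_mem: "based p \<Longrightarrow> pt p \<in> topspace X"
  using image_\<iota> openin_subset[OF open_image] by blast

lemma pt_eq_iff: "based p \<Longrightarrow> based q \<Longrightarrow> pt p = pt q \<longleftrightarrow> ob p = ob q"
  using inj_onD[OF inj_\<iota>] ob_in_NC unfolding pt_def by metis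

lemma dense_pt:
  assumes "openin X U" "U \<noteq> {}"
  obtains p where "based p" "pt p \<in> U"
proof -
  obtain C where "C \<in> topspace NC" "\<iota> C \<in> U"
    using dense_open[OF assms] by blast
  moreover from this have "\<iota> C \<in> {pt p | p. based p}"
    unfolding image_\<iota>[symmetric] by blast
  ultimately show thesis
    using that by auto
qed

lemma fbar_pt:
  assumes p: "based p"
  shows "fbar (pt p) = p 1"
proof -
  have "\<exists>q. pathin P q \<and> c = cl q \<and> q 1 = p 1" if c: "c \<in> ob p" for c
  proof -
    obtain a where "c = cl (path_join a p)" "is_loop P y0 a"
      using c p by (auto simp: ob_eq)
    then show ?thesis
      using p by (intro exI[of _ "path_join a p"]) (auto intro: pathin_join)
  qed
  moreover have "ob p \<noteq> {}"
    using cl_in_ob p by blast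
  ultimately have "normal_cover_proj (ob p) = p 1"
    by (intro normal_cover_proj_eq)
  then show ?thesis
    using fbar_\<iota>[OF ob_in_NC[OF p]] by (simp add: pt_def)
qed

lemma \<psi>_pt:
  assumes a: "is_loop P y0 a" and p: "based p"
  shows "\<psi> (ob a) (pt p) = pt (path_join a p)"
proof -
  have "ob a \<in> carrier (monodromy_group M N f y0)"
    using a carrier_G by (auto simp: G_def)
  moreover have "ob p \<in> topspace (normal_cover M N f y0)"
    using ob_in_NC[OF p] by (simp add: NC_def)
  ultimately have "\<psi> (ob a) (\<iota> (ob p)) = \<iota> (deck_action M N f (ob a) (ob p))"
    using act unfolding extended_deck_action_def by blast
  then show ?thesis
    by (simp add: pt_def deck_action_ob[OF a p])
qed

text \<open>Going along p and back along q is a loop at \<open>y0\<close>; its deck transformation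
  takes the point of q to that of p.\<close>

lemma pt_translate:
  assumes p: "based p" and q: "based q" and e: "p 1 = q 1"
  shows "pt p = \<psi> (ob (path_join p (path_rev q))) (pt q)" "ob (path_join p (path_rev q)) \<in> carrier G"
proof -
  have l: "is_loop P y0 (path_join p (path_rev q))"
    using p q e by (auto intro!: pathin_join pathin_rev)
  then show "ob (path_join p (path_rev q)) \<in> carrier G"
    using carrier_G by auto
  have "cl (path_join (path_join p (path_rev q)) q) = cl p"
    using p q e by (intro path_class_join_rev_cancel) auto
  from ob_cong[OF this] have "pt (path_join (path_join p (path_rev q)) q) = pt p"
    by (simp only: pt_def)
  then show "pt p = \<psi> (ob (path_join p (path_rev q))) (pt q)"
    using \<psi>_pt[OF l q] by simp
qed

lemma continuous_map_pt_lift: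
  assumes "based p" "pathin P \<sigma>" "\<sigma> 0 = p 1"
  shows "continuous_map (top_of_set {0..1}) X (\<lambda>t. pt (path_join p (path_seg \<sigma> 0 t)))"
proof -
  have "continuous_map NC X \<iota>"
    using embed by (metis embedding_map_def homeomorphic_imp_continuous_map continuous_map_into_fulltopology)
  then have "continuous_map (top_of_set {0..1}) X (\<iota> \<circ> (\<lambda>t. ob (path_join p (path_seg \<sigma> 0 t))))"
    using continuous_map_lift[of p \<sigma>] assms by (intro continuous_map_compose[of _ NC]) (auto simp: cover_eq)
  then show ?thesis
    by (simp add: pt_def o_def)
qed

lemma openin_pt_nbhd:
  assumes p: "based p" and U: "openin P U"
  shows "openin X {pt (path_join p q) | q. pathin P q \<and> q ` {0..1} \<subseteq> U \<and> q 0 = p 1}"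
proof -
  let ?S = "{ob (path_join p q) | q. pathin P q \<and> q ` {0..1} \<subseteq> U \<and> q 0 = p 1}"
  have "openin NC ?S"
    using openin_cover_nbhd[of p U] p U by (simp add: cover_eq)
  moreover have "open_map NC (subtopology X (\<iota> ` topspace NC)) \<iota>"
    using embed by (simp add: embedding_map_def homeomorphic_imp_open_map)
  ultimately have "openin (subtopology X (\<iota> ` topspace NC)) (\<iota> ` ?S)"
    by (simp add: open_map_def)
  then have "openin X (\<iota> ` ?S)"
    using open_image openin_trans_full by blast
  moreover have "\<iota> ` ?S = {pt (path_join p q) | q. pathin P q \<and> q ` {0..1} \<subseteq> U \<and> q 0 = p 1}"
    unfolding pt_def by blast
  ultimately show ?thesis by simp
qed

text \<open>The group is finite, so the neighbourhoods that separate b from the single translates of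
  c can be intersected.\<close>

lemma separate_translates:
  assumes S: "S \<subseteq> carrier G" and c: "c \<in> topspace X" and b: "b \<in> topspace X"
    and ne: "\<And>g. g \<in> S \<Longrightarrow> \<psi> g c \<noteq> b"
  obtains U V where "openin X U" "openin X V" "c \<in> U" "b \<in> V" "\<And>g z. g \<in> S \<Longrightarrow> z \<in> U \<Longrightarrow> \<psi> g z \<notin> V"
proof -
  have "\<exists>U V. openin X U \<and> openin X V \<and> \<psi> g c \<in> U \<and> b \<in> V \<and> disjnt U V" if "g \<in> S" for g
  proof -
    have "\<psi> g c \<in> topspace X"
      using \<psi>_mem that S c by blast
    then show ?thesis
      using Hausdorff_X b ne[OF that] unfolding Hausdorff_space_def by blast
  qed
  then obtain U V where UV: "\<And>g. g \<in> S \<Longrightarrow> openin X (U g)" "\<And>g. g \<in> S \<Longrightarrow> openin X (V g)"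
    "\<And>g. g \<in> S \<Longrightarrow> \<psi> g c \<in> U g" "\<And>g. g \<in> S \<Longrightarrow> b \<in> V g" "\<And>g. g \<in> S \<Longrightarrow> disjnt (U g) (V g)"
    by metis
  have fin: "finite S"
    using S finite_G[OF K_ne] finite_subset by blast
  let ?U = "topspace X \<inter> (\<Inter>g\<in>S. {z \<in> topspace X. \<psi> g z \<in> U g})"
  let ?V = "topspace X \<inter> (\<Inter>g\<in>S. V g)"
  have "openin X {z \<in> topspace X. \<psi> g z \<in> U g}" if "g \<in> S" for g
    using openin_continuous_map_preimage[OF \<psi>_cont UV(1)[OF that]] that S by blast
  then have "openin X ?U" "openin X ?V"
    using fin UV(2) by (cases "S = {}"; auto intro!: openin_Int openin_INT2)+
  moreover have "\<psi> g z \<notin> ?V" if "g \<in> S" "z \<in> ?U" for g z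
    using that UV(5)[OF that(1)] by (auto simp: disjnt_iff)
  ultimately show thesis
    using that[of ?U ?V] c b UV(3,4) by blast
qed

text \<open>The point b might lie outside the image of \<open>\<iota>\<close>. If it were no
  translate, choose by density a regular point near b whose image also has a regular preimage near
  \<open>pt p\<close>. These two differ by a deck transformation, contrary to the
  separation.\<close>

lemma fibre_over_regular:
  assumes p: "based p" and b: "b \<in> topspace X" "fbar b = p 1"
  shows "\<exists>g \<in> carrier G. \<psi> g (pt p) = b"
proof (rule ccontr)
  assume *: "\<not> (\<exists>g \<in> carrier G. \<psi> g (pt p) = b)"
  then have "\<psi> g (pt p) \<noteq> b" if "g \<in> carrier G" for g
    using that by blast
  then obtain U V where UV: "openin X U" "openin X V" "pt p \<in> U" "b \<in> V"
    "\<And>g z. g \<in> carrier G \<Longrightarrow> z \<in> U \<Longrightarrow> \<psi> g z \<notin> V"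
    by (rule separate_translates[OF subset_refl pt_mem[OF p] b(1)]) blast+
  let ?Q = "fbar ` (U \<inter> \<iota> ` topspace NC)"
  have "pt p \<in> \<iota> ` topspace NC"
    using p image_\<iota> by blast
  then have "p 1 \<in> ?Q"
    using UV(3) fbar_pt[OF p] by (metis IntI image_eqI)
  have "openin N ?Q"
    using open_fbar UV(1) open_image unfolding open_map_def by (meson openin_Int)
  then have "openin X {z \<in> topspace X. fbar z \<in> ?Q}"
    by (rule openin_continuous_map_preimage[OF cont_fbar])
  then have "openin X (V \<inter> {z \<in> topspace X. fbar z \<in> ?Q})"
    using UV(2) by blast
  moreover have "V \<inter> {z \<in> topspace X. fbar z \<in> ?Q} \<noteq> {}"
    using UV(4) b \<open>p 1 \<in> ?Q\<close> by auto
  ultimately obtain q where q1: "based q" and q2: "pt q \<in> V \<inter> {z \<in> topspace X. fbar z \<in> ?Q}"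
    by (rule dense_pt)
  have q: "based q" "pt q \<in> V" "fbar (pt q) \<in> ?Q"
    using q1 q2 by blast+
  then obtain u where u: "u \<in> U" "u \<in> \<iota> ` topspace NC" "fbar u = fbar (pt q)"
    by auto
  then obtain r where r: "based r" "u = pt r"
    using image_\<iota> by blast
  then have "q 1 = r 1"
    using u(3) fbar_pt q(1) by simp
  then have "pt q = \<psi> (ob (path_join q (path_rev r))) u" "ob (path_join q (path_rev r)) \<in> carrier G"
    using pt_translate[OF q(1) r(1)] r(2) by auto
  then show False
    using UV(5)[OF _ u(1)] q(2) by simp
qed

text \<open>The same approximation, now near an arbitrary a. The partner v of the regular point p is
  only known to lie in V, which is why the preceding lemma admits arbitrary points b.\<close>

lemma fibre_orbit:
  assumes a: "a \<in> topspace X" and b: "b \<in> topspace X" "fbar b = fbar a"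
  shows "\<exists>g \<in> carrier G. \<psi> g a = b"
proof (rule ccontr)
  assume *: "\<not> (\<exists>g \<in> carrier G. \<psi> g a = b)"
  then have "\<psi> g a \<noteq> b" if "g \<in> carrier G" for g
    using that by blast
  then obtain U V where UV: "openin X U" "openin X V" "a \<in> U" "b \<in> V"
    "\<And>g z. g \<in> carrier G \<Longrightarrow> z \<in> U \<Longrightarrow> \<psi> g z \<notin> V"
    by (rule separate_translates[OF subset_refl a b(1)]) blast+
  have "openin N (fbar ` V)"
    using open_fbar UV(2) by (simp add: open_map_def)
  then have "openin X {z \<in> topspace X. fbar z \<in> fbar ` V}"
    by (rule openin_continuous_map_preimage[OF cont_fbar])
  then have "openin X (U \<inter> {z \<in> topspace X. fbar z \<in> fbar ` V})"
    using UV(1) by blast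
  moreover have "U \<inter> {z \<in> topspace X. fbar z \<in> fbar ` V} \<noteq> {}"
  proof -
    have "fbar a \<in> fbar ` V"
      using imageI[OF UV(4), of fbar] b(2) by simp
    then show ?thesis
      using UV(3) a by blast
  qed
  ultimately obtain p where p1: "based p" and p2: "pt p \<in> U \<inter> {z \<in> topspace X. fbar z \<in> fbar ` V}"
    by (rule dense_pt)
  have p: "based p" "pt p \<in> U" "fbar (pt p) \<in> fbar ` V"
    using p1 p2 by blast+
  then obtain v where v: "v \<in> V" "fbar v = p 1"
    using fbar_pt[OF p(1)] by auto
  moreover have "v \<in> topspace X"
    using v(1) UV(2) openin_subset by blast
  ultimately obtain g where "g \<in> carrier G" "\<psi> g (pt p) = v"
    using fibre_over_regular[OF p(1)] by blast
  then show False
    using UV(5) p(2) v(1) by blast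
qed

end

lemma path_component_of_iff_pathin:
  "path_component_of X x y \<longleftrightarrow> (\<exists>g. pathin X g \<and> g 0 = x \<and> g 1 = y)"
  by (auto simp: path_component_of_def)

section \<open>Transport above a small neighbourhood of a branch value\<close>

context nontrivial_monodromy_setup
begin

text \<open>Over \<open>W - E\<close>, the regular part of \<open>V\<close> is a normal covering with deck group \<open>H\<close>.\<close>

context
  fixes x :: 'c and H V W
  assumes x: "x \<in> topspace X"
    and H_def: "H = stabilizer G \<psi> x"
    and V: "openin X V" "x \<in> V"
    and V_inv: "\<And>h z. h \<in> H \<Longrightarrow> z \<in> V \<Longrightarrow> \<psi> h z \<in> V"
    and V_moved: "\<And>g z. g \<in> carrier G \<Longrightarrow> z \<in> V \<Longrightarrow> \<psi> g z \<in> V \<Longrightarrow> g \<in> H"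
    and W: "openin N W" "fbar x \<in> W" "W \<subseteq> fbar ` V"
    and W_pre: "\<And>z. z \<in> topspace X \<Longrightarrow> fbar z \<in> W \<Longrightarrow> \<exists>g \<in> carrier G. \<exists>v \<in> V. z = \<psi> g v"
    and W_acyclic: "acyclic_in 1 (subtopology N (W - E))"
    and W_lpc: "locally_path_connected_space (subtopology N (W - E))"
begin

abbreviation "T \<equiv> subtopology N (W - E)"

lemma W_sub: "W \<subseteq> topspace N"
  using W(1) openin_subset by blast

lemma openin_WE: "openin N (W - E)"
  using W(1) closedin_E by blast

lemma openin_P_WE: "openin P (W - E)"
  using openin_WE W_sub by (auto simp: P_eq openin_subtopology)

lemma topspace_T: "topspace T = W - E"
  using W_sub by auto

lemma pathin_T: "pathin T \<sigma> \<longleftrightarrow> pathin P \<sigma> \<and> \<sigma> ` {0..1} \<subseteq> W - E"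
  using path_image_subset_topspace[of N \<sigma>] W_sub
  by (auto simp: P_eq pathin_subtopology image_subset_iff)

lemma pathin_T_mem: "pathin T \<sigma> \<Longrightarrow> t \<in> {0..1} \<Longrightarrow> \<sigma> t \<in> W - E"
  unfolding pathin_T by blast

lemma continuous_T_P: "continuous_map T P id"
  using W_sub by (auto simp: P_eq continuous_map_in_subtopology)

lemma H_sub: "H \<subseteq> carrier G"
  by (auto simp: H_def stabilizer_def)

lemma subgroup_H: "subgroup H G"
  unfolding H_def by (rule group_action.stabilizer_subgroup[OF action x])

text \<open>The translates of V cover the preimage of W, and those by elements outside H are
  disjoint from V. The lift of a path is connected, so it cannot leave V.\<close>

lemma pt_in_V:
  assumes p: "based p" "pt p \<in> V" and \<sigma>: "pathin T \<sigma>" "\<sigma> 0 = p 1"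
  shows "pt (path_join p \<sigma>) \<in> V"
proof -
  have \<sigma>P: "pathin P \<sigma>" and \<sigma>W: "\<And>t. t \<in> {0..1} \<Longrightarrow> \<sigma> t \<in> W - E"
    using \<sigma>(1) pathin_T_mem by (simp_all only: pathin_T)
  let ?\<gamma> = "\<lambda>t. pt (path_join p (path_seg \<sigma> 0 t))"
  have cont: "continuous_map (top_of_set {0..1}) X ?\<gamma>"
    using p \<sigma>P \<sigma>(2) by (intro continuous_map_pt_lift) auto
  have conn: "connectedin X (?\<gamma> ` {0..1})"
    using connectedin_continuous_map_image[OF cont, of "{0..1}"] by (simp add: connectedin_subtopology)
  define V' where "V' = (\<Union>g \<in> carrier G - H. \<psi> g ` V)"
  have "openin X V'"
    unfolding V'_def using \<psi>_open V(1) by (intro openin_Union) auto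
  moreover have "?\<gamma> ` {0..1} \<subseteq> V \<union> V'"
  proof clarify
    fix t :: real assume t: "t \<in> {0..1}" "?\<gamma> t \<notin> V'"
    have b: "based (path_join p (path_seg \<sigma> 0 t))"
      using p \<sigma>P \<sigma>(2) t by (auto intro!: pathin_join pathin_seg)
    have "fbar (?\<gamma> t) \<in> W"
      using fbar_pt[OF b] \<sigma>W[OF t(1)] by simp
    then obtain g v where g: "g \<in> carrier G" "v \<in> V" "?\<gamma> t = \<psi> g v"
      using W_pre[OF pt_mem[OF b]] by blast
    then have "g \<in> H"
      using t(2) unfolding V'_def by blast
    then show "?\<gamma> t \<in> V"
      using V_inv g by simp
  qed
  moreover have "V \<inter> V' = {}"
    using V_moved unfolding V'_def by blast
  moreover have "?\<gamma> 0 \<in> V"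
  proof -
    have "path_seg \<sigma> 0 0 = (\<lambda>_. p 1)"
      using \<sigma>(2) by (simp add: path_seg_def)
    then have "cl (path_join p (path_seg \<sigma> 0 0)) = cl p"
      using p by (simp add: path_class_join_const)
    then show ?thesis
      using p(2) ob_cong by (metis pt_def)
  qed
  then have "V \<inter> ?\<gamma> ` {0..1} \<noteq> {}"
    by auto
  ultimately have "V' \<inter> ?\<gamma> ` {0..1} = {}"
    using conn V(1) unfolding connectedin by blast
  moreover have "?\<gamma> 1 \<in> ?\<gamma> ` {0..1}"
    by (intro imageI) simp
  ultimately have "?\<gamma> 1 \<in> V"
    using \<open>?\<gamma> ` {0..1} \<subseteq> V \<union> V'\<close> by blast
  then show ?thesis
    by simp
qed

text \<open>Some point of V lies above w, but it is not known to be in the image of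
  \<open>\<iota>\<close>. Density gives a regular point of V above the path component of w in T,
  which is open; a path in that component then leads to w.\<close>

lemma ex_pt_in_V:
  assumes w: "w \<in> W - E"
  shows "\<exists>p. based p \<and> p 1 = w \<and> pt p \<in> V"
proof -
  let ?C = "Collect (path_component_of T w)"
  have "openin T ?C"
    by (rule openin_path_component_of_locally_path_connected_space[OF W_lpc])
  then have C: "openin N ?C"
    using openin_WE openin_trans_full by blast
  have "w \<in> ?C"
    using w topspace_T by (simp add: path_component_of_refl)
  obtain v where v: "v \<in> V" "fbar v = w"
    using w W(3) by blast
  have "openin X (V \<inter> {z \<in> topspace X. fbar z \<in> ?C})"
    using V(1) openin_continuous_map_preimage[OF cont_fbar C] by blast
  moreover have "v \<in> V \<inter> {z \<in> topspace X. fbar z \<in> ?C}"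
    using v \<open>w \<in> ?C\<close> V(1) openin_subset by blast
  then have "V \<inter> {z \<in> topspace X. fbar z \<in> ?C} \<noteq> {}"
    by blast
  ultimately obtain p where p1: "based p" and p2: "pt p \<in> V \<inter> {z \<in> topspace X. fbar z \<in> ?C}"
    by (rule dense_pt)
  then have "path_component_of T w (p 1)"
    using fbar_pt[OF p1] by simp
  then have "path_component_of T (p 1) w"
    by (simp add: path_component_of_sym)
  then obtain \<sigma> where \<sigma>: "pathin T \<sigma>" "\<sigma> 0 = p 1" "\<sigma> 1 = w"
    by (auto simp: path_component_of_iff_pathin)
  have "pt (path_join p \<sigma>) \<in> V"
    using pt_in_V[OF p1 _ \<sigma>(1,2)] p2 by blast
  moreover have "based (path_join p \<sigma>)"
    using p1 \<sigma> by (auto simp: pathin_T intro: pathin_join)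
  ultimately show ?thesis
    using \<sigma>(3) by (intro exI[of _ "path_join p \<sigma>"]) simp
qed

lemma translate_in_H:
  assumes "based p" "based q" "p 1 = q 1" "pt p \<in> V" "pt q \<in> V"
  shows "ob (path_join p (path_rev q)) \<in> H"
  using V_moved pt_translate[OF assms(1,2,3)] assms(4,5) by metis

text \<open>The loop \<open>a \<sigma>\<close> is \<open>\<sigma>\<close> closed up through the
  chosen paths r. It acts by an element of H because the lift of \<open>\<sigma>\<close> from the
  chosen point stays in V. For joined paths the inner r and its reverse cancel, so modulo
  commutators this is a cocycle.\<close>

lemma transport_in_derived:
  assumes r: "\<And>w. w \<in> W - E \<Longrightarrow> based (r w)" "\<And>w. w \<in> W - E \<Longrightarrow> r w 1 = w" "\<And>w. w \<in> W - E \<Longrightarrow> pt (r w) \<in> V"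
    and \<sigma>: "pathin T \<sigma>" "\<sigma> 0 = \<sigma> 1"
  shows "ob (path_join (path_join (r (\<sigma> 0)) \<sigma>) (path_rev (r (\<sigma> 1)))) \<in> derived G H"
proof -
  define H' where "H' = G\<lparr>carrier := H\<rparr>"
  let ?D = "derived G H"
  define a where "a = (\<lambda>\<sigma>. path_join (path_join (r (\<sigma> 0)) \<sigma>) (path_rev (r (\<sigma> 1))))"
  interpret G: group G by (rule group_G)
  have normal: "?D \<lhd> H'"
    unfolding H'_def by (rule G.derived_subgroup_is_normal[OF subgroup_H])
  then interpret D: normal ?D H' .
  have comm: "comm_group (H' Mod ?D)"
    unfolding H'_def by (rule G.derived_quot_of_subgroup_is_comm_group[OF subgroup_H])
  have ends: "\<rho> 0 \<in> W - E" "\<rho> 1 \<in> W - E" "pathin P \<rho>" if "pathin T \<rho>" for \<rho>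
    using that pathin_T_mem[OF that, of 0] pathin_T_mem[OF that, of 1] by (auto simp: pathin_T)
  have r\<rho>: "based (path_join (r (\<rho> 0)) \<rho>)" "path_join (r (\<rho> 0)) \<rho> 1 = r (\<rho> 1) 1" if "pathin T \<rho>" for \<rho>
    using r ends[OF that] by (auto intro: pathin_join)
  have loop: "is_loop P y0 (a \<rho>)" if "pathin T \<rho>" for \<rho>
    unfolding a_def using r r\<rho>[OF that] ends[OF that] by (auto intro!: pathin_join pathin_rev)
  have aH: "ob (a \<rho>) \<in> carrier H'" if \<rho>: "pathin T \<rho>" for \<rho>
  proof -
    have "pt (path_join (r (\<rho> 0)) \<rho>) \<in> V"
      using r ends[OF \<rho>] \<rho> by (intro pt_in_V) auto
    then have "ob (a \<rho>) \<in> H"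
      unfolding a_def using r ends[OF \<rho>] r\<rho>[OF \<rho>] by (intro translate_in_H) auto
    then show ?thesis
      by (simp add: H'_def)
  qed
  have join: "ob (a (path_join \<rho> \<tau>)) = ob (a \<rho>) \<otimes>\<^bsub>H'\<^esub> ob (a \<tau>)"
    if \<rho>: "pathin T \<rho>" and \<tau>: "pathin T \<tau>" and \<rho>\<tau>: "\<rho> 1 = \<tau> 0" for \<rho> \<tau>
  proof -
    let ?p = "path_join (r (\<rho> 0)) \<rho>" and ?q = "path_rev (r (\<tau> 1))" and ?s = "r (\<rho> 1)"
    have P: "pathin P \<rho>" "pathin P \<tau>" "pathin P ?p" "pathin P ?q" "pathin P ?s" "pathin P (path_rev ?s)"
      "pathin P (r (\<rho> 0))" and E: "?p 1 = \<rho> 1" "?q 0 = \<tau> 1" "?s 1 = \<rho> 1" "?s 0 = y0" "r (\<rho> 0) 1 = \<rho> 0"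
      using r ends[OF \<rho>] ends[OF \<tau>] r\<rho>[OF \<rho>] by (auto intro: pathin_rev)
    have "ob (a \<rho>) \<otimes>\<^bsub>H'\<^esub> ob (a \<tau>) = ob (path_join (a \<rho>) (a \<tau>))"
      using mult_G[OF loop[OF \<rho>] loop[OF \<tau>]] by (simp add: H'_def)
    also have "\<dots> = ob (a (path_join \<rho> \<tau>))"
    proof (rule ob_cong)
      have "cl (path_join (a \<rho>) (a \<tau>)) =
          cl (path_join (path_join (path_join ?p (path_rev ?s)) (path_join ?s \<tau>)) ?q)"
        unfolding a_def using P E \<rho>\<tau> by (simp add: path_class_assoc pathin_join)
      also have "\<dots> = cl (path_join (path_join (path_join (path_join ?p (path_rev ?s)) ?s) \<tau>) ?q)"
        using P E \<rho>\<tau> by (intro path_class_join_cong path_class_assoc[symmetric] refl) (auto intro!: pathin_join)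
      also have "\<dots> = cl (path_join (path_join ?p \<tau>) ?q)"
      proof (rule path_class_join_cong[OF _ refl])
        have "cl (path_join (path_join ?p (path_rev ?s)) ?s) = cl ?p"
          using P E by (intro path_class_join_rev_cancel) auto
        then show "cl (path_join (path_join (path_join ?p (path_rev ?s)) ?s) \<tau>) = cl (path_join ?p \<tau>)"
          using P E \<rho>\<tau> by (intro path_class_join_cong[OF _ refl]) (auto intro!: pathin_join)
      qed (use P E \<rho>\<tau> in \<open>auto intro!: pathin_join\<close>)
      also have "\<dots> = cl (a (path_join \<rho> \<tau>))"
      proof -
        have "cl (path_join ?p \<tau>) = cl (path_join (r (\<rho> 0)) (path_join \<rho> \<tau>))"
          using P E \<rho>\<tau> by (intro path_class_assoc) auto
        then have "cl (path_join (path_join ?p \<tau>) ?q) = cl (path_join (path_join (r (\<rho> 0)) (path_join \<rho> \<tau>)) ?q)"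
          using P E \<rho>\<tau> by (intro path_class_join_cong[OF _ refl]) (auto intro!: pathin_join)
        then show ?thesis
          by (simp add: a_def)
      qed
      finally show "cl (path_join (a \<rho>) (a \<tau>)) = cl (a (path_join \<rho> \<tau>))" .
    qed
    finally show ?thesis by simp
  qed
  have homotopic: "ob (a \<rho>) = ob (a \<tau>)" if h: "path_homotopic T \<rho> \<tau>" for \<rho> \<tau>
  proof (rule ob_cong)
    have \<rho>: "pathin T \<rho>" "\<tau> 0 = \<rho> 0" "\<tau> 1 = \<rho> 1"
      using path_homotopicD[OF h] by auto
    have "path_homotopic P \<rho> \<tau>"
      using path_homotopic_map[OF h continuous_T_P] by simp
    then have "cl \<rho> = cl \<tau>"
      using ends(3)[OF \<rho>(1)] by (simp add: path_class_eq_iff)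
    then show "cl (a \<rho>) = cl (a \<tau>)"
      unfolding a_def \<rho>(2,3) using r ends[OF \<rho>(1)]
      by (intro path_class_join_cong[OF path_class_join_cong[OF refl] refl]) (auto intro!: pathin_join pathin_rev)
  qed
  have "?D #>\<^bsub>H'\<^esub> ob (a \<sigma>) = \<one>\<^bsub>H' Mod ?D\<^esub>"
  proof (rule transport_loop_trivial[OF W_acyclic comm, where \<phi> = "\<lambda>\<rho>. ?D #>\<^bsub>H'\<^esub> ob (a \<rho>)"])
    show "?D #>\<^bsub>H'\<^esub> ob (a \<rho>) \<in> carrier (H' Mod ?D)" if "pathin T \<rho>" for \<rho>
      using aH[OF that] by (simp add: carrier_FactGroup)
    show "?D #>\<^bsub>H'\<^esub> ob (a (path_join \<rho> \<tau>)) = (?D #>\<^bsub>H'\<^esub> ob (a \<rho>)) \<otimes>\<^bsub>H' Mod ?D\<^esub> (?D #>\<^bsub>H'\<^esub> ob (a \<tau>))"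
      if "pathin T \<rho>" "pathin T \<tau>" "\<rho> 1 = \<tau> 0" for \<rho> \<tau>
      using aH[OF that(1)] aH[OF that(2)] by (simp add: join[OF that] D.rcos_sum)
    show "?D #>\<^bsub>H'\<^esub> ob (a \<rho>) = ?D #>\<^bsub>H'\<^esub> ob (a \<tau>)" if "path_homotopic T \<rho> \<tau>" for \<rho> \<tau>
      using homotopic[OF that] by simp
  qed (rule \<sigma>)+
  then have "?D #>\<^bsub>H'\<^esub> ob (a \<sigma>) = ?D"
    by simp
  moreover have "ob (a \<sigma>) \<in> ?D #>\<^bsub>H'\<^esub> ob (a \<sigma>)"
    by (rule D.rcos_self[OF aH[OF \<sigma>(1)] normal_imp_subgroup[OF normal]])
  ultimately show ?thesis
    by (simp add: a_def)
qed

text \<open>Near x a regular point and its translate by h lie in a connected regular set, so they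
  are joined by the lift of a loop \<open>\<sigma>\<close> in \<open>W - E\<close>. Hence h is
  conjugate in H to the transport of \<open>\<sigma>\<close>.\<close>

lemma H_subset_derived: "H \<subseteq> derived G H"
proof
  fix h assume h: "h \<in> H"
  interpret G: group G by (rule group_G)
  have hG: "h \<in> carrier G" using h H_sub by blast
  have hx: "\<psi> h x = x"
    using h by (simp add: H_def stabilizer_def)
  have "openin X (V \<inter> {z \<in> topspace X. fbar z \<in> W})"
    using V(1) openin_continuous_map_preimage[OF cont_fbar W(1)] by blast
  moreover have "x \<in> V \<inter> {z \<in> topspace X. fbar z \<in> W}"
    using V(2) x W(2) by blast
  ultimately have "\<exists>U. openin X U \<and> connectedin X U \<and> x \<in> U \<and> U \<subseteq> V \<inter> {z \<in> topspace X. fbar z \<in> W}"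
    by (intro locally_connected_X[unfolded locally_connected_space, rule_format] conjI)
  then obtain V2 where V2: "openin X V2" "connectedin X V2" "x \<in> V2" "V2 \<subseteq> V \<inter> {z \<in> topspace X. fbar z \<in> W}"
    by (elim exE conjE)
  \<comment> \<open>The point x may be a branch point. Since h fixes it, nearby regular points have
    their translates in V2 as well.\<close>
  have "openin X {z \<in> topspace X. \<psi> h z \<in> V2}"
    by (rule openin_continuous_map_preimage[OF \<psi>_cont[OF hG] V2(1)])
  then have "openin X (V2 \<inter> {z \<in> topspace X. \<psi> h z \<in> V2})"
    using V2(1) by blast
  moreover have "V2 \<inter> {z \<in> topspace X. \<psi> h z \<in> V2} \<noteq> {}"
    using V2(3) hx x by auto
  ultimately obtain p where p: "based p" and pt2: "pt p \<in> V2 \<inter> {z \<in> topspace X. \<psi> h z \<in> V2}"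
    by (rule dense_pt)
  obtain a where a: "is_loop P y0 a" "h = ob a"
    using hG carrier_G by auto
  have ap: "based (path_join a p)"
    using a p by (auto intro: pathin_join)
  have apV2: "pt (path_join a p) \<in> V2"
    using pt2 \<psi>_pt[OF a(1) p] a(2) by auto
  have WE: "q 1 \<in> W - E" if "based q" "pt q \<in> V2" for q
  proof -
    have "q 1 \<in> W"
      using fbar_pt[OF that(1)] V2(4) that(2) by auto
    moreover have "q 1 \<in> topspace P"
      using that(1) path_finish_in_topspace by blast
    ultimately show ?thesis
      by (auto simp: topspace_P)
  qed
  \<comment> \<open>These serve as path components above \<open>W - E\<close>: each is open, and
    \<open>pt q\<close> is reached from p as soon as the sets of p and q meet.\<close>
  define R where "R = (\<lambda>q. {pt (path_join q \<sigma>) | \<sigma>. pathin P \<sigma> \<and> \<sigma> ` {0..1} \<subseteq> W - E \<and> \<sigma> 0 = q 1})"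
  have R_open: "openin X (R q)" if "based q" for q
    unfolding R_def by (rule openin_pt_nbhd[OF that openin_P_WE])
  have R_self: "pt q \<in> R q" if q: "based q" "pt q \<in> V2" for q
  proof -
    have "cl (path_join q (\<lambda>_. q 1)) = cl q"
      using q by (intro path_class_join_const) auto
    from ob_cong[OF this] have "pt (path_join q (\<lambda>_. q 1)) = pt q"
      by (simp only: pt_def)
    moreover have "pathin P (\<lambda>_. q 1)"
      using q path_finish_in_topspace[of P q] by simp
    ultimately show ?thesis
      using WE[OF q] unfolding R_def by (intro CollectI exI[of _ "\<lambda>_. q 1"]) auto
  qed
  have R_disj: "pt q \<in> R p" if q: "based q" and z: "z \<in> R q" "z \<in> R p" for q z
  proof -
    obtain \<tau> where \<tau>: "z = pt (path_join q \<tau>)" "pathin P \<tau>" "\<tau> ` {0..1} \<subseteq> W - E" "\<tau> 0 = q 1"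
      using z(1) unfolding R_def by blast
    obtain \<sigma> where \<sigma>: "z = pt (path_join p \<sigma>)" "pathin P \<sigma>" "\<sigma> ` {0..1} \<subseteq> W - E" "\<sigma> 0 = p 1"
      using z(2) unfolding R_def by blast
    have b: "based (path_join q \<tau>)" "based (path_join p \<sigma>)"
      using p q \<sigma> \<tau> by (auto intro: pathin_join)
    have ob: "ob (path_join q \<tau>) = ob (path_join p \<sigma>)"
      using pt_eq_iff[OF b] \<sigma>(1) \<tau>(1) by simp
    have e: "\<tau> 1 = \<sigma> 1"
      using fbar_pt[OF b(1)] fbar_pt[OF b(2)] \<sigma>(1) \<tau>(1) by simp
    have rev: "pathin P (path_rev \<tau>)" "path_rev \<tau> ` {0..1} \<subseteq> W - E"
      using \<tau>(2,3) by (auto simp: path_rev_def image_subset_iff intro: pathin_rev[unfolded path_rev_def])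
    have "ob q = ob (path_join (path_join q \<tau>) (path_rev \<tau>))"
      using q \<tau> by (intro ob_cong path_class_join_cancel[symmetric]) auto
    also have "\<dots> = ob (path_join (path_join p \<sigma>) (path_rev \<tau>))"
      using b rev ob by (intro ob_join_cong) auto
    also have "\<dots> = ob (path_join p (path_join \<sigma> (path_rev \<tau>)))"
      using p \<sigma> rev e by (intro ob_cong path_class_assoc) auto
    finally have "pt q = pt (path_join p (path_join \<sigma> (path_rev \<tau>)))"
      by (simp only: pt_def)
    moreover have "pathin P (path_join \<sigma> (path_rev \<tau>))"
      using \<sigma> rev e by (intro pathin_join) auto
    moreover have "path_join \<sigma> (path_rev \<tau>) ` {0..1} \<subseteq> W - E"
      by (rule path_join_image_subset[OF \<sigma>(3) rev(2)])
    ultimately show ?thesis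
      using \<sigma>(4) unfolding R_def by (intro CollectI exI[of _ "path_join \<sigma> (path_rev \<tau>)"]) auto
  qed
  \<comment> \<open>The complement of the regular part does not separate V2, so all regular points
    of V2 are reached from p, the translate by h among them.\<close>
  let ?V2' = "V2 - (topspace X - \<iota> ` topspace NC)"
  have conn: "connectedin X ?V2'"
    using not_sep V2(1,2) unfolding locally_separates_def by blast
  define R' where "R' = (\<Union>q \<in> {q. based q \<and> pt q \<in> V2 \<and> pt q \<notin> R p}. R q)"
  have "openin X R'"
    unfolding R'_def using R_open by (intro openin_Union) auto
  moreover have cover: "?V2' \<subseteq> R p \<union> R'"
  proof
    fix z assume "z \<in> ?V2'"
    then have "z \<in> {pt q | q. based q}" "z \<in> V2"
      using V2(1) openin_subset image_\<iota> by blast+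
    then obtain q where q: "based q" "z = pt q" "pt q \<in> V2"
      by blast
    then show "z \<in> R p \<union> R'"
      using R_self[OF q(1,3)] unfolding R'_def by blast
  qed
  moreover have "R p \<inter> R' = {}"
    using R_disj unfolding R'_def by blast
  moreover have "pt p \<in> R p \<inter> ?V2'"
    using R_self[OF p] pt2 p image_\<iota> by blast
  ultimately have "R' \<inter> ?V2' = {}"
    using conn R_open[OF p] unfolding connectedin by blast
  moreover have "pt (path_join a p) \<in> ?V2'"
    using apV2 ap image_\<iota> by blast
  ultimately have "pt (path_join a p) \<in> R p"
    using cover by blast
  then obtain \<sigma> where \<sigma>: "pt (path_join a p) = pt (path_join p \<sigma>)" "pathin P \<sigma>" "\<sigma> ` {0..1} \<subseteq> W - E" "\<sigma> 0 = p 1"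
    unfolding R_def by blast
  have p\<sigma>: "based (path_join p \<sigma>)"
    using p \<sigma> by (auto intro: pathin_join)
  have \<sigma>1: "\<sigma> 1 = p 1"
    using fbar_pt[OF ap] fbar_pt[OF p\<sigma>] \<sigma>(1) by simp
  have ob\<sigma>: "ob (path_join a p) = ob (path_join p \<sigma>)"
    using pt_eq_iff[OF ap p\<sigma>] \<sigma>(1) by simp
  have "h = ob (path_join (path_join a p) (path_rev p))"
    unfolding a(2) using a p by (intro ob_cong path_class_join_cancel[symmetric]) auto
  also have "\<dots> = ob (path_join (path_join p \<sigma>) (path_rev p))"
    using ap p\<sigma> ob\<sigma> p by (intro ob_join_cong) (auto intro: pathin_rev)
  finally have h_eq: "h = ob (path_join (path_join p \<sigma>) (path_rev p))" .
  obtain r where r: "\<And>w. w \<in> W - E \<Longrightarrow> based (r w)" "\<And>w. w \<in> W - E \<Longrightarrow> r w 1 = w" "\<And>w. w \<in> W - E \<Longrightarrow> pt (r w) \<in> V"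
    using ex_pt_in_V by metis
  define w where "w = p 1"
  have w: "w \<in> W - E"
    using WE[OF p] pt2 by (simp add: w_def)
  have "pathin T \<sigma>"
    using \<sigma>(2,3) by (simp add: pathin_T)
  moreover have "\<sigma> 0 = \<sigma> 1"
    using \<sigma>(4) \<sigma>1 by simp
  ultimately have "ob (path_join (path_join (r (\<sigma> 0)) \<sigma>) (path_rev (r (\<sigma> 1)))) \<in> derived G H"
    using transport_in_derived[of r \<sigma>] r by blast
  then have d: "ob (path_join (path_join (r w) \<sigma>) (path_rev (r w))) \<in> derived G H" (is "?d \<in> _")
    by (simp add: \<sigma>(4) \<sigma>1 w_def)
  \<comment> \<open>The chosen point above w need not be \<open>pt p\<close>. The element
    \<open>?g\<close> of H takes it there, and h is the conjugate by \<open>?g\<close> of the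
    transport \<open>?d\<close>.\<close>
  let ?g = "ob (path_join p (path_rev (r w)))"
  have g: "?g \<in> H"
    using p pt2 V2(4) r[OF w] by (intro translate_in_H) (auto simp: w_def)
  have gG: "?g \<in> carrier G" using g H_sub by blast
  let ?q = "r w"
  have q: "pathin P ?q" "?q 0 = y0" "?q 1 = p 1" "pathin P (path_rev ?q)" "pathin P (path_rev p)"
    using r(1,2)[OF w] p by (auto simp: w_def intro: pathin_rev)
  have P: "pathin P (path_join p \<sigma>)" "pathin P (path_join ?q \<sigma>)" "pathin P (path_join p (path_rev ?q))"
    "pathin P (path_join (path_join p \<sigma>) (path_rev p))" "pathin P (path_join (path_join ?q \<sigma>) (path_rev ?q))"
    using p q \<sigma> \<sigma>1 by (auto intro!: pathin_join)
  have "h \<otimes>\<^bsub>G\<^esub> ?g = ob (path_join (path_join (path_join p \<sigma>) (path_rev p)) (path_join p (path_rev ?q)))"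
    unfolding h_eq using p q P by (intro mult_G) auto
  also have "\<dots> = ob (path_join (path_join p \<sigma>) (path_rev ?q))"
  proof (rule ob_cong)
    have "cl (path_join (path_join (path_join p \<sigma>) (path_rev p)) (path_join p (path_rev ?q))) =
        cl (path_join (path_join (path_join (path_join p \<sigma>) (path_rev p)) p) (path_rev ?q))"
      using p q P by (intro path_class_assoc[symmetric]) auto
    also have "\<dots> = cl (path_join (path_join p \<sigma>) (path_rev ?q))"
      using p q P \<sigma>1 by (intro path_class_join_cong[OF path_class_join_rev_cancel refl]) (auto intro: pathin_join)
    finally show "cl (path_join (path_join (path_join p \<sigma>) (path_rev p)) (path_join p (path_rev ?q))) =
        cl (path_join (path_join p \<sigma>) (path_rev ?q))" .
  qed
  also have "\<dots> = ob (path_join (path_join p (path_rev ?q)) (path_join (path_join ?q \<sigma>) (path_rev ?q)))"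
  proof (rule ob_cong)
    have "cl (path_join (path_join p (path_rev ?q)) (path_join (path_join ?q \<sigma>) (path_rev ?q))) =
        cl (path_join (path_join (path_join p (path_rev ?q)) (path_join ?q \<sigma>)) (path_rev ?q))"
      using p q P \<sigma> \<sigma>1 by (intro path_class_assoc[symmetric]) auto
    also have "\<dots> = cl (path_join (path_join (path_join (path_join p (path_rev ?q)) ?q) \<sigma>) (path_rev ?q))"
      using p q P \<sigma> \<sigma>1 by (intro path_class_join_cong[OF path_class_assoc[symmetric] refl]) (auto intro: pathin_join)
    also have "\<dots> = cl (path_join (path_join p \<sigma>) (path_rev ?q))"
      using p q P \<sigma> \<sigma>1
      by (intro path_class_join_cong[OF path_class_join_cong[OF path_class_join_rev_cancel refl] refl])
        (auto intro!: pathin_join)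
    finally show "cl (path_join (path_join p \<sigma>) (path_rev ?q)) =
        cl (path_join (path_join p (path_rev ?q)) (path_join (path_join ?q \<sigma>) (path_rev ?q)))" by simp
  qed
  also have "\<dots> = ?g \<otimes>\<^bsub>G\<^esub> ?d"
    using p q P by (intro mult_G[symmetric]) auto
  finally have "h \<otimes>\<^bsub>G\<^esub> ?g = ?g \<otimes>\<^bsub>G\<^esub> ?d" .
  moreover have dG: "?d \<in> carrier G"
    using d G.derived_in_carrier[OF H_sub] by blast
  ultimately have "h = ?g \<otimes>\<^bsub>G\<^esub> ?d \<otimes>\<^bsub>G\<^esub> inv\<^bsub>G\<^esub> ?g"
    using hG gG by (metis G.inv_solve_right G.m_closed)
  moreover have "?g \<otimes>\<^bsub>G\<^esub> ?d \<otimes>\<^bsub>G\<^esub> inv\<^bsub>G\<^esub> ?g \<in> derived G H"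
    using normal.inv_op_closed2[OF G.derived_subgroup_is_normal[OF subgroup_H], of ?g ?d] g d
      G.m_inv_consistent[OF subgroup_H g] by simp
  ultimately show "h \<in> derived G H"
    by simp
qed

end

text \<open>The finite group admits an H-invariant slice V at x, which meets its translates only
  under H. As the fibre of x is one orbit and \<open>fbar\<close> is closed, the translates of V
  contain the whole preimage of a small W.\<close>

proposition stabilizer_perfect:
  assumes x: "x \<in> topspace X" and dim: "local_dim_le N E (fbar x) (int n - 3)"
  defines "H \<equiv> stabilizer G \<psi> x"
  shows "finite H \<and> perfect_group (G\<lparr>carrier := H\<rparr>)"
proof -
  interpret G: group G by (rule group_G)
  have HG: "H \<subseteq> carrier G" and sub: "subgroup H G"
    using group_action.stabilizer_subgroup[OF action x] by (auto simp: H_def stabilizer_def)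
  have "\<psi> g x \<noteq> x" if "g \<in> carrier G - H" for g
    using that by (auto simp: H_def stabilizer_def)
  then obtain U1 U2 where U: "openin X U1" "openin X U2" "x \<in> U1" "x \<in> U2"
    "\<And>g z. g \<in> carrier G - H \<Longrightarrow> z \<in> U1 \<Longrightarrow> \<psi> g z \<notin> U2"
    by (rule separate_translates[OF Diff_subset x x]) blast+
  define U where "U = U1 \<inter> U2"
  define V where "V = (\<Union>h \<in> H. \<psi> h ` U)"
  have U_sub: "U \<subseteq> topspace X"
    using U(1) openin_subset by (auto simp: U_def)
  have U_moved: "g \<in> H" if "g \<in> carrier G" "z \<in> U" "\<psi> g z \<in> U" for g z
    using U(5)[of g z] that by (auto simp: U_def)
  have "openin X U"
    using U by (auto simp: U_def)
  then have V_open: "openin X V"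
    unfolding V_def using \<psi>_open HG by (intro openin_Union) auto
  have hx: "\<psi> h x = x" if "h \<in> H" for h
    using that by (simp add: H_def stabilizer_def)
  have oneH: "\<one>\<^bsub>G\<^esub> \<in> H"
    by (rule subgroup.one_closed[OF sub])
  have "\<psi> \<one>\<^bsub>G\<^esub> x \<in> \<psi> \<one>\<^bsub>G\<^esub> ` U"
    using U(3,4) by (intro imageI) (simp add: U_def)
  then have xV: "x \<in> V"
    using oneH hx[OF oneH] unfolding V_def by auto
  have V_inv: "\<psi> h z \<in> V" if h: "h \<in> H" and z: "z \<in> V" for h z
  proof -
    obtain k u where k: "k \<in> H" "u \<in> U" "z = \<psi> k u"
      using z unfolding V_def by blast
    then have "h \<in> carrier G" "k \<in> carrier G" "u \<in> topspace X"
      using h HG U_sub by blast+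
    then have "\<psi> h z = \<psi> (h \<otimes>\<^bsub>G\<^esub> k) u"
      using \<psi>_mult[of h k u] k(3) by simp
    moreover have "h \<otimes>\<^bsub>G\<^esub> k \<in> H"
      using subgroup.m_closed[OF sub h k(1)] .
    ultimately show ?thesis
      using k(2) unfolding V_def by blast
  qed
  have V_moved: "g \<in> H" if g: "g \<in> carrier G" and z: "z \<in> V" "\<psi> g z \<in> V" for g z
  proof -
    obtain k u where k: "k \<in> H" "u \<in> U" "z = \<psi> k u"
      using z(1) unfolding V_def by blast
    obtain l v where l: "l \<in> H" "v \<in> U" "\<psi> g z = \<psi> l v"
      using z(2) unfolding V_def by blast
    have kG: "k \<in> carrier G" "l \<in> carrier G" and uv: "u \<in> topspace X" "v \<in> topspace X"
      using k l HG U_sub by blast+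
    \<comment> \<open>If g takes k u to l v with u and v in U, then l^-1 g k takes u to v within U
      and so lies in H; hence so does g.\<close>
    have "\<psi> (inv\<^bsub>G\<^esub> l \<otimes>\<^bsub>G\<^esub> (g \<otimes>\<^bsub>G\<^esub> k)) u = \<psi> (inv\<^bsub>G\<^esub> l) (\<psi> g (\<psi> k u))"
      using \<psi>_mult[of "inv\<^bsub>G\<^esub> l" "g \<otimes>\<^bsub>G\<^esub> k" u] \<psi>_mult[of g k u] g kG uv by simp
    also have "\<dots> = v"
      using l(3) k(3) \<psi>_inv[OF kG(2) uv(2)] by simp
    finally have "inv\<^bsub>G\<^esub> l \<otimes>\<^bsub>G\<^esub> (g \<otimes>\<^bsub>G\<^esub> k) \<in> H"
      using U_moved[of "inv\<^bsub>G\<^esub> l \<otimes>\<^bsub>G\<^esub> (g \<otimes>\<^bsub>G\<^esub> k)" u] k(2) l(2) g kG by simp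
    then have "l \<otimes>\<^bsub>G\<^esub> (inv\<^bsub>G\<^esub> l \<otimes>\<^bsub>G\<^esub> (g \<otimes>\<^bsub>G\<^esub> k)) \<otimes>\<^bsub>G\<^esub> inv\<^bsub>G\<^esub> k \<in> H"
      using subgroup.m_closed[OF sub] subgroup.m_inv_closed[OF sub] k(1) l(1) by blast
    moreover have "l \<otimes>\<^bsub>G\<^esub> (inv\<^bsub>G\<^esub> l \<otimes>\<^bsub>G\<^esub> (g \<otimes>\<^bsub>G\<^esub> k)) \<otimes>\<^bsub>G\<^esub> inv\<^bsub>G\<^esub> k = g"
      using g kG by (simp add: G.m_assoc[symmetric]) (simp add: G.m_assoc)
    ultimately show ?thesis by simp
  qed
  \<comment> \<open>The translates of V miss only Z, whose image is closed and does not contain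
    \<open>fbar x\<close>. Any W outside this image has its preimage in the translates.\<close>
  define Z where "Z = topspace X - (\<Union>g \<in> carrier G. \<psi> g ` V)"
  have "openin X (\<Union>g \<in> carrier G. \<psi> g ` V)"
    using \<psi>_open V_open by (intro openin_Union) auto
  then have "closedin X Z"
    unfolding Z_def by blast
  then have clZ: "closedin N (fbar ` Z)"
    using closed_fbar by (simp add: closed_map_def)
  have yZ: "fbar x \<notin> fbar ` Z"
  proof
    assume "fbar x \<in> fbar ` Z"
    then obtain z where z: "z \<in> Z" "fbar z = fbar x"
      by auto
    then obtain g where "g \<in> carrier G" "\<psi> g x = z"
      using fibre_orbit[OF x, of z] unfolding Z_def by blast
    then show False
      using z(1) xV unfolding Z_def by blast
  qed
  define Q where "Q = fbar ` V \<inter> (topspace N - fbar ` Z)"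
  have "openin N (fbar ` V)"
    using open_fbar V_open by (simp add: open_map_def)
  then have Q: "openin N Q" "fbar x \<in> Q"
    using clZ xV yZ cont_fbar x unfolding Q_def by (auto simp: continuous_map_def)
  obtain W where W: "openin N W" "fbar x \<in> W" "W \<subseteq> Q" "acyclic_in 1 (subtopology N (W - E))"
    "locally_path_connected_space (subtopology N (W - E))"
    by (rule manifold_complement_locally_acyclic[OF N closedin_E dim Q])
  have W_pre: "\<exists>g \<in> carrier G. \<exists>v \<in> V. z = \<psi> g v" if "z \<in> topspace X" "fbar z \<in> W" for z
  proof -
    have "fbar z \<notin> fbar ` Z"
      using W(3) that(2) unfolding Q_def by blast
    then show ?thesis
      using that(1) unfolding Z_def by blast
  qed
  have WV: "W \<subseteq> fbar ` V"
    using W(3) unfolding Q_def by blast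
  have "H \<subseteq> derived G H"
    by (rule H_subset_derived[OF x meta_eq_to_obj_eq[OF H_def] V_open xV V_inv V_moved W(1,2) WV W_pre W(4,5)])
  then have "derived G H = H"
    using G.derived_incl[OF subset_refl sub] by blast
  then have "derived (G\<lparr>carrier := H\<rparr>) H = H"
    using G.derived_consistent[OF subset_refl sub] by simp
  moreover have "finite H"
    using HG finite_G[OF K_ne] finite_subset by blast
  ultimately show ?thesis
    using subgroup.subgroup_is_group[OF sub group_G] by (simp add: perfect_group_def)
qed

end

theorem theorem1:
  fixes M :: "'a topology" and N :: "'b topology" and f :: "'a \<Rightarrow> 'b" and n :: nat
    and y y0 :: 'b
    and X :: "'x topology" and \<iota> :: "(real \<Rightarrow> 'b) set set \<Rightarrow> 'x" and fbar :: "'x \<Rightarrow> 'b"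
    and \<psi> :: "(real \<Rightarrow> 'b) set set \<Rightarrow> 'x \<Rightarrow> 'x"
  assumes "manifold n M" and "manifold n N"
    and "branched_cover M N f" and "compact_preimages M N f"
    and "y0 \<in> topspace (regular_base M N f)"
    and "normalization M N f y0 X \<iota> fbar"
    and "extended_deck_action M N f y0 X \<iota> \<psi>"
    and "y \<in> f ` branch_set M N f"
    and "local_dim_le N (f ` branch_set M N f) y (int n - 3)"
  shows "\<forall>H \<in> local_monodromy M N f y0 X fbar \<psi> y.
           finite H \<and> perfect_group ((monodromy_group M N f y0)\<lparr>carrier := H\<rparr>)"
proof
  interpret monodromy_setup M N f n y0 X \<iota> fbar \<psi>
    by unfold_locales (rule assms)+
  fix H assume "H \<in> local_monodromy M N f y0 X fbar \<psi> y"
  then obtain x where x: "x \<in> topspace X" "fbar x = y" "H = stabilizer G \<psi> x"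
    by (auto simp: local_monodromy_def fibre_def G_def)
  show "finite H \<and> perfect_group ((monodromy_group M N f y0)\<lparr>carrier := H\<rparr>)"
  proof (cases "K = {}")
    case True
    have "H \<subseteq> carrier G" "subgroup H G"
      using group_action.stabilizer_subgroup[OF action x(1)] x(3) by (auto simp: stabilizer_def)
    from trivial_case[OF True this] show ?thesis
      by (simp add: G_def)
  next
    case False
    interpret nontrivial_monodromy_setup M N f n y0 X \<iota> fbar \<psi>
      by unfold_locales (rule False)
    show ?thesis
      using stabilizer_perfect[OF x(1)] x assms(9) by (simp add: G_def E_def)
  qed
qed

end
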